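(* Let $X$ be an orthodomain. The following are equivalent: 1. $X$ is short and has enough directions; 2. $X\simeq\mathrm{BSub}(A)^*$ for some proper orthoalgebra $A$. When these conditions hold, $\mathrm{Dir}(X)$ is an orthoalgebra and $X\simeq\mathrm{BSub}(\mathrm{Dir}(X))^*$.
   Context: **Orthoalgebras.** An orthoalgebra is a set $A$ with a partial binary operation $\oplus$ (write $a\perp b$ when $a\oplus b$ is defined), a unary operation $'$ and constants $0,1$ such that: (1) $\oplus$ is commutative and associative in the usual sense for partial operations (if one side is defined so is the other and they are equal); (2) $a'$ is the unique element with $a\oplus a'$ defined and equal to $1$; (3) $a\oplus a$ is defined iff $a=0$. It is Boolean if it arises from a Boolean algebra by restricting the join to pairs of orthogonal elements. A subalgebra is a subset containing $0,1$, closed under $'$ and under $\oplus$ (when defined); a Boolean subalgebra is a subalgebra that is a Boolean orthoalgebra. $\mathrm{BSub}(A)$ is the set of Boolean subalgebras ordered by inclusion. A block is a maximal Boolean subalgebra; it is small if it has at most $4$ elements. $A$ is proper if it has no small blocks. **Boolean domains.** $\mathrm{Sub}(B)$ is the lattice of Boolean subalgebras of a Boolean algebra $B$, ordered by inclusion. A Boolean domain is a lattice isomorphic to $\mathrm{Sub}(B)$ for some Boolean algebra $B$ (by a theorem of Grätzer et al., equivalently an algebraic lattice in which, for each compact $x$, $\downarrow x$ is isomorphic to the lattice of partitions of a finite set, finer partitions being larger). Its least and largest elements are $\bot,\top$. In a poset with least element, an element is basic if it is an atom or the least element. An element $x$ of a lattice is dual modular if $(x\vee y)\wedge z=x\vee(y\wedge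 z)$ for all $y$ and all $z\ge x$, and $(w\vee x)\wedge y=w\vee(x\wedge y)$ for all $w\le y$. A principal pair of a Boolean domain is an ordered pair $(y,z)$ of dual modular elements such that (1) $y=\top$ and $z$ is basic, or (2) $z=\top$ and $y$ is basic, or (3) $y\vee z=\top$ and $y\wedge z$ is a basic element that is not dual modular. It is a principal pair for the basic element $x$ if $y\wedge z=x$. **Orthodomains and directions.** $x\lessdot z$ means $z$ covers $x$. An orthodomain is a poset $X$ with least element $\bot$ such that: (1) every directed subset has a join; (2) $X$ is atomistic and its atoms are compact; (3) each $\downarrow x$ is a Boolean domain; (4) if $x,y$ are distinct atoms and $x,y\lessdot w$, then $x\vee y=w$. A direction for a basic element $x$ of $X$ is a map $d\colon\uparrow x\to X^2$ such that for all $y,z\in\uparrow x$: (1) $d(y)$ is a principal pair for $x$ in the Boolean domain $\downarrow y$; (2) if $y\le z$ and $d(z)=(v,w)$ then $d(y)=(y\wedge v,y\wedge w)$; (3) if $x\lessdot y,z$ and $d(y)=(x,y)$, $d(z)=(z,x)$, then $y\vee z$ exists and $y,z\lessdot y\vee z$. $\mathrm{Dir}(X)$ is the set of all directions for basic elements of $X$. $X$ is proper if no maximal element is basic; $X$ has enough directions if it is proper and each basic element has a direction (it then has exactly two). **Operations on $\mathrm{Dir}(X)$** (for $X$ an orthodomain with enough directions). If $d$ is a direction for $x$, then $d'$ is the direction for $x$ with $d'(w)=(z,y)$ when $d(w)=(y,z)$. $0$ and $1$ are the directions for $\bot$ given by $0(w)=(\bot,w)$, $1(w)=(w,\bot)$.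 Two atoms $x,y$ are near if they are distinct and their join exists and covers both; then there is exactly one further atom below $x\vee y$. The partial operation $\oplus$ is defined exactly in these cases: $d\oplus 0=d=0\oplus d$; $d\oplus d'=1$; and if $d$ is a direction for $x$, $e$ a direction for $y$, with $x,y$ near, $w=x\vee y$, $z$ the third atom below $w$, and $d(w)=(x,w)$, $e(w)=(y,w)$, then $d\oplus e$ is the direction for $z$ with $(d\oplus e)(w)=(w,z)$. **Shortness.** For an orthodomain $X$, $X^*$ is the sub-poset of elements of $X$ of height at most $3$ ($\bot$ has height $0$, atoms height $1$). $X$ is short if $X=X^*$. *)

theory Defs
  imports Main "HOL-Library.Extended_Nat"
begin

section \<open>Posets\<close>

text \<open>
  A poset is a subset of a type of class \<^class>\<open>order\<close> with the inherited order.  All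
  order-theoretic notions are relative to that subset.  Sets of subalgebras are posets of this kind,
  since \<open>\<le>\<close> on sets is inclusion.  The operations defined by \<open>THE\<close> are only meaningful
  when the element in question exists.
\<close>

definition is_lub :: "'x::order set \<Rightarrow> 'x set \<Rightarrow> 'x \<Rightarrow> bool" where
  "is_lub X S u \<longleftrightarrow> u \<in> X \<and> (\<forall>s\<in>S. s \<le> u) \<and> (\<forall>v\<in>X. (\<forall>s\<in>S. s \<le> v) \<longrightarrow> u \<le> v)"

definition is_glb :: "'x::order set \<Rightarrow> 'x set \<Rightarrow> 'x \<Rightarrow> bool" where
  "is_glb X S u \<longleftrightarrow> u \<in> X \<and> (\<forall>s\<in>S. u \<le> s) \<and> (\<forall>v\<in>X. (\<forall>s\<in>S. v \<le> s) \<longrightarrow> v \<le> u)"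

definition join_in :: "'x::order set \<Rightarrow> 'x \<Rightarrow> 'x \<Rightarrow> 'x" where
  "join_in X x y = (THE u. is_lub X {x, y} u)"

definition meet_in :: "'x::order set \<Rightarrow> 'x \<Rightarrow> 'x \<Rightarrow> 'x" where
  "meet_in X x y = (THE u. is_glb X {x, y} u)"

definition is_least :: "'x::order set \<Rightarrow> 'x \<Rightarrow> bool" where
  "is_least X b \<longleftrightarrow> b \<in> X \<and> (\<forall>x\<in>X. b \<le> x)"

definition is_greatest :: "'x::order set \<Rightarrow> 'x \<Rightarrow> bool" where
  "is_greatest X t \<longleftrightarrow> t \<in> X \<and> (\<forall>x\<in>X. x \<le> t)"

definition bot_of :: "'x::order set \<Rightarrow> 'x" where
  "bot_of X = (THE b. is_least X b)"

definition down_in :: "'x::order set \<Rightarrow> 'x \<Rightarrow> 'x set" where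
  "down_in X x = {y \<in> X. y \<le> x}"

definition up_in :: "'x::order set \<Rightarrow> 'x \<Rightarrow> 'x set" where
  "up_in X x = {y \<in> X. x \<le> y}"

definition covers :: "'x::order set \<Rightarrow> 'x \<Rightarrow> 'x \<Rightarrow> bool" where
  \<comment> \<open>\<open>z\<close> covers \<open>x\<close>\<close>
  "covers X x z \<longleftrightarrow> x \<in> X \<and> z \<in> X \<and> x < z \<and> \<not> (\<exists>y\<in>X. x < y \<and> y < z)"

definition is_maximal :: "'x::order set \<Rightarrow> 'x \<Rightarrow> bool" where
  "is_maximal X x \<longleftrightarrow> x \<in> X \<and> (\<forall>y\<in>X. x \<le> y \<longrightarrow> y = x)"

definition is_atom :: "'x::order set \<Rightarrow> 'x \<Rightarrow> bool" where
  "is_atom X a \<longleftrightarrow> (\<exists>b. is_least X b \<and> covers X b a)"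

definition basic :: "'x::order set \<Rightarrow> 'x \<Rightarrow> bool" where
  "basic X x \<longleftrightarrow> is_atom X x \<or> is_least X x"

definition directed_in :: "'x::order set \<Rightarrow> 'x set \<Rightarrow> bool" where
  "directed_in X D \<longleftrightarrow> D \<subseteq> X \<and> D \<noteq> {} \<and> (\<forall>x\<in>D. \<forall>y\<in>D. \<exists>z\<in>D. x \<le> z \<and> y \<le> z)"

definition compact_in :: "'x::order set \<Rightarrow> 'x \<Rightarrow> bool" where
  "compact_in X a \<longleftrightarrow> a \<in> X \<and>
     (\<forall>D u. directed_in X D \<and> is_lub X D u \<and> a \<le> u \<longrightarrow> (\<exists>d\<in>D. a \<le> d))"

definition atomistic :: "'x::order set \<Rightarrow> bool" where
  "atomistic X \<longleftrightarrow> (\<forall>x\<in>X. is_lub X {a. is_atom X a \<and> a \<le> x} x)"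

text \<open>
  The height of \<open>x\<close> is the supremum of the lengths of the finite chains below \<open>x\<close>, where a
  chain with \<open>n + 1\<close> elements has length \<open>n\<close>.
\<close>

definition height :: "'x::order set \<Rightarrow> 'x \<Rightarrow> enat" where
  "height X x = Sup {enat n | n C. C \<subseteq> down_in X x \<and> Complete_Partial_Order.chain (\<le>) C
                                   \<and> finite C \<and> card C = Suc n}"

definition star :: "'x::order set \<Rightarrow> 'x set" where
  "star X = {x \<in> X. height X x \<le> 3}"

definition short :: "'x::order set \<Rightarrow> bool" where
  "short X \<longleftrightarrow> star X = X"

definition poset_iso :: "'x::order set \<Rightarrow> 'y::order set \<Rightarrow> bool" where
  "poset_iso X Y \<longleftrightarrow>
     (\<exists>f. bij_betw f X Y \<and> (\<forall>x\<in>X. \<forall>y\<in>X. x \<le> y \<longleftrightarrow> f x \<le> f y))"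


section \<open>Boolean algebras and Boolean domains\<close>

record 'b boolalg =
  ba_carrier :: "'b set"
  ba_join :: "'b \<Rightarrow> 'b \<Rightarrow> 'b"
  ba_meet :: "'b \<Rightarrow> 'b \<Rightarrow> 'b"
  ba_compl :: "'b \<Rightarrow> 'b"
  ba_zero :: "'b"
  ba_one :: "'b"

text \<open>
  These are the axioms of \<^locale>\<open>abstract_boolean_algebra\<close>, relativised to a carrier.
\<close>

locale boolalg =
  fixes B :: "'b boolalg" (structure)
  assumes zero_closed: "ba_zero B \<in> ba_carrier B"
    and one_closed: "ba_one B \<in> ba_carrier B"
    and compl_closed: "a \<in> ba_carrier B \<Longrightarrow> ba_compl B a \<in> ba_carrier B"
    and join_closed: "\<lbrakk>a \<in> ba_carrier B; b \<in> ba_carrier B\<rbrakk> \<Longrightarrow> ba_join B a b \<in> ba_carrier B"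
    and meet_closed: "\<lbrakk>a \<in> ba_carrier B; b \<in> ba_carrier B\<rbrakk> \<Longrightarrow> ba_meet B a b \<in> ba_carrier B"
    and join_assoc: "\<lbrakk>a \<in> ba_carrier B; b \<in> ba_carrier B; c \<in> ba_carrier B\<rbrakk>
          \<Longrightarrow> ba_join B (ba_join B a b) c = ba_join B a (ba_join B b c)"
    and meet_assoc: "\<lbrakk>a \<in> ba_carrier B; b \<in> ba_carrier B; c \<in> ba_carrier B\<rbrakk>
          \<Longrightarrow> ba_meet B (ba_meet B a b) c = ba_meet B a (ba_meet B b c)"
    and join_commute: "\<lbrakk>a \<in> ba_carrier B; b \<in> ba_carrier B\<rbrakk> \<Longrightarrow> ba_join B a b = ba_join B b a"
    and meet_commute: "\<lbrakk>a \<in> ba_carrier B; b \<in> ba_carrier B\<rbrakk> \<Longrightarrow> ba_meet B a b = ba_meet B b a"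
    and meet_join_distrib: "\<lbrakk>a \<in> ba_carrier B; b \<in> ba_carrier B; c \<in> ba_carrier B\<rbrakk>
          \<Longrightarrow> ba_meet B a (ba_join B b c) = ba_join B (ba_meet B a b) (ba_meet B a c)"
    and join_meet_distrib: "\<lbrakk>a \<in> ba_carrier B; b \<in> ba_carrier B; c \<in> ba_carrier B\<rbrakk>
          \<Longrightarrow> ba_join B a (ba_meet B b c) = ba_meet B (ba_join B a b) (ba_join B a c)"
    and join_zero: "a \<in> ba_carrier B \<Longrightarrow> ba_join B a (ba_zero B) = a"
    and meet_one: "a \<in> ba_carrier B \<Longrightarrow> ba_meet B a (ba_one B) = a"
    and join_compl: "a \<in> ba_carrier B \<Longrightarrow> ba_join B a (ba_compl B a) = ba_one B"
    and meet_compl: "a \<in> ba_carrier B \<Longrightarrow> ba_meet B a (ba_compl B a) = ba_zero B"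

definition Sub :: "'b boolalg \<Rightarrow> 'b set set" where
  "Sub B = {S. S \<subseteq> ba_carrier B \<and> ba_zero B \<in> S \<and> ba_one B \<in> S
              \<and> (\<forall>a\<in>S. ba_compl B a \<in> S)
              \<and> (\<forall>a\<in>S. \<forall>b\<in>S. ba_join B a b \<in> S \<and> ba_meet B a b \<in> S)}"

text \<open>
  HOL cannot quantify over all types in a definition.  The choice of the type \<open>'x \<times> bool\<close>
  for the elements of the Boolean algebra is no restriction: the map sending \<open>b\<close> to the subalgebra
  \<open>{0, b, b', 1}\<close> is at most two-to-one, so a Boolean algebra \<open>B\<close> over any type for which
  \<open>Sub B\<close> is isomorphic to \<open>L\<close> has a copy in \<open>'x \<times> bool\<close>.  This is lemma
  \<open>boolean_domainI\<close> below.
\<close>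

definition boolean_domain :: "'x::order set \<Rightarrow> bool" where
  "boolean_domain L \<longleftrightarrow> (\<exists>B :: ('x \<times> bool) boolalg. boolalg B \<and> poset_iso L (Sub B))"

lemma (in boolalg) compl_unique:
  assumes a: "a \<in> ba_carrier B" and b: "b \<in> ba_carrier B"
    and j: "ba_join B a b = ba_one B" and m: "ba_meet B a b = ba_zero B"
  shows "b = ba_compl B a"
proof -
  let ?c = "ba_compl B a"
  have c: "?c \<in> ba_carrier B" using a compl_closed by blast
  have "b = ba_meet B b (ba_join B a ?c)" using meet_one[OF b] join_compl[OF a] by simp
  also have "\<dots> = ba_join B (ba_meet B b a) (ba_meet B b ?c)" using meet_join_distrib[OF b a c] .
  also have "ba_meet B b a = ba_meet B ?c a"
    using m meet_commute[OF a b] meet_compl[OF a] meet_commute[OF a c] by simp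
  also have "ba_meet B b ?c = ba_meet B ?c b" using meet_commute[OF b c] .
  also have "ba_join B (ba_meet B ?c a) (ba_meet B ?c b) = ba_meet B ?c (ba_join B a b)"
    using meet_join_distrib[OF c a b] by simp
  also have "\<dots> = ?c" using j meet_one[OF c] by simp
  finally show ?thesis .
qed

lemma (in boolalg) compl_compl: "a \<in> ba_carrier B \<Longrightarrow> ba_compl B (ba_compl B a) = a"
  using compl_unique[of "ba_compl B a" a] compl_closed join_commute meet_commute
    join_compl meet_compl by metis

lemma (in boolalg) compl_zero: "ba_compl B (ba_zero B) = ba_one B"
  using compl_unique[of "ba_zero B" "ba_one B"] zero_closed one_closed join_commute join_zero
    meet_one by metis

lemma (in boolalg) compl_one: "ba_compl B (ba_one B) = ba_zero B"
  using compl_zero compl_compl zero_closed by metis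

lemma (in boolalg) join_idem: "a \<in> ba_carrier B \<Longrightarrow> ba_join B a a = a"
  using join_meet_distrib[of a a "ba_compl B a"] meet_compl join_zero join_compl meet_one
    compl_closed join_closed by metis

lemma (in boolalg) meet_idem: "a \<in> ba_carrier B \<Longrightarrow> ba_meet B a a = a"
  using meet_join_distrib[of a a "ba_compl B a"] meet_compl join_zero join_compl meet_one
    compl_closed meet_closed by metis

lemma (in boolalg) join_one: "a \<in> ba_carrier B \<Longrightarrow> ba_join B a (ba_one B) = ba_one B"
  using join_assoc[of a a "ba_compl B a"] join_idem join_compl compl_closed by metis

lemma (in boolalg) meet_zero: "a \<in> ba_carrier B \<Longrightarrow> ba_meet B a (ba_zero B) = ba_zero B"
  using meet_assoc[of a a "ba_compl B a"] meet_idem meet_compl compl_closed by metis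

lemma (in boolalg) four_element_Sub:
  assumes a: "a \<in> ba_carrier B"
  shows "{ba_zero B, ba_one B, a, ba_compl B a} \<in> Sub B"
proof -
  let ?c = "ba_compl B a"
  have c: "?c \<in> ba_carrier B" using a compl_closed by blast
  note z = zero_closed and o = one_closed
  have "ba_join B x y \<in> {ba_zero B, ba_one B, a, ?c} \<and> ba_meet B x y \<in> {ba_zero B, ba_one B, a, ?c}"
    if xy: "x \<in> {ba_zero B, ba_one B, a, ?c}" "y \<in> {ba_zero B, ba_one B, a, ?c}" for x y
  proof -
    have x: "x \<in> ba_carrier B" and y: "y \<in> ba_carrier B" using xy a c z o by auto
    consider "x = ba_zero B" | "x = ba_one B" | "y = ba_zero B" | "y = ba_one B"
      | "x = y" | "x = a" "y = ?c" | "x = ?c" "y = a"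
      using xy unfolding insert_iff empty_iff by blast
    then show ?thesis
    proof cases
      case 1 then show ?thesis
        using xy(2) join_commute[OF x y] meet_commute[OF x y] join_zero[OF y] meet_zero[OF y] by simp
    next
      case 2 then show ?thesis
        using xy(2) join_commute[OF x y] meet_commute[OF x y] join_one[OF y] meet_one[OF y] by simp
    next
      case 3 then show ?thesis using xy(1) join_zero[OF x] meet_zero[OF x] by simp
    next
      case 4 then show ?thesis using xy(1) join_one[OF x] meet_one[OF x] by simp
    next
      case 5 then show ?thesis using xy(1) join_idem[OF x] meet_idem[OF x] by simp
    next
      case 6 then show ?thesis using join_compl[OF a] meet_compl[OF a] by simp
    next
      case 7 then show ?thesis
        using join_compl[OF a] meet_compl[OF a] join_commute[OF a c] meet_commute[OF a c] by simp
    qed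
  qed
  then show ?thesis
    unfolding Sub_def using a c z o compl_zero compl_one compl_compl[OF a] by auto
qed

definition transport_boolalg :: "('b \<Rightarrow> 'c) \<Rightarrow> 'b boolalg \<Rightarrow> 'c boolalg" where
  "transport_boolalg h B = (let g = inv_into (ba_carrier B) h in
     \<lparr>ba_carrier = h ` ba_carrier B,
      ba_join = (\<lambda>x y. h (ba_join B (g x) (g y))),
      ba_meet = (\<lambda>x y. h (ba_meet B (g x) (g y))),
      ba_compl = (\<lambda>x. h (ba_compl B (g x))),
      ba_zero = h (ba_zero B),
      ba_one = h (ba_one B)\<rparr>)"

lemma (in boolalg) transport:
  assumes h: "inj_on h (ba_carrier B)"
  shows "boolalg (transport_boolalg h B)" and "Sub (transport_boolalg h B) = (`) h ` Sub B"
proof -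
  let ?T = "transport_boolalg h B"
  have [simp]: "inv_into (ba_carrier B) h (h x) = x" if "x \<in> ba_carrier B" for x
    using h that by simp
  have T: "ba_carrier ?T = h ` ba_carrier B" "ba_zero ?T = h (ba_zero B)" "ba_one ?T = h (ba_one B)"
    by (simp_all add: transport_boolalg_def Let_def)
  have Tc [simp]: "ba_compl ?T (h x) = h (ba_compl B x)" if "x \<in> ba_carrier B" for x
    using that by (simp add: transport_boolalg_def Let_def)
  have Tj [simp]: "ba_join ?T (h x) (h y) = h (ba_join B x y)"
    "ba_meet ?T (h x) (h y) = h (ba_meet B x y)"
    if "x \<in> ba_carrier B" "y \<in> ba_carrier B" for x y
    using that by (simp_all add: transport_boolalg_def Let_def)
  note cl = zero_closed one_closed compl_closed join_closed meet_closed
  show "boolalg ?T"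
    by unfold_locales
      (auto simp: T cl join_zero meet_one join_compl meet_compl intro!: arg_cong[where f = h]
        intro: join_assoc meet_assoc join_commute meet_commute meet_join_distrib join_meet_distrib)
  show "Sub ?T = (`) h ` Sub B"
  proof (intro subset_antisym subsetI)
    fix R assume R: "R \<in> Sub ?T"
    define S where "S = {b \<in> ba_carrier B. h b \<in> R}"
    have RS: "R = h ` S" using R unfolding Sub_def S_def by (auto simp: T)
    have Rc: "ba_compl ?T r \<in> R" "ba_join ?T r t \<in> R" "ba_meet ?T r t \<in> R"
      if "r \<in> R" "t \<in> R" for r t using R that by (auto simp: Sub_def)
    have "h (ba_compl B x) \<in> R" "h (ba_join B x y) \<in> R" "h (ba_meet B x y) \<in> R"
      if "x \<in> S" "y \<in> S" for x y
      using Rc[of "h x" "h y"] that by (auto simp: S_def)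
    moreover have "h (ba_zero B) \<in> R" "h (ba_one B) \<in> R" using R by (auto simp: Sub_def T)
    ultimately have "S \<in> Sub B" using cl by (simp add: Sub_def S_def)
    then show "R \<in> (`) h ` Sub B" using RS by blast
  next
    fix R assume "R \<in> (`) h ` Sub B"
    then obtain S where S: "S \<in> Sub B" "R = h ` S" by blast
    then have sub: "S \<subseteq> ba_carrier B" by (simp add: Sub_def)
    have c: "ba_compl ?T (h x) = h (ba_compl B x)" if "x \<in> S" for x using that sub by auto
    have j: "ba_join ?T (h x) (h y) = h (ba_join B x y)"
      "ba_meet ?T (h x) (h y) = h (ba_meet B x y)" if "x \<in> S" "y \<in> S" for x y
      using Tj[of x y] that sub by blast+
    show "R \<in> Sub ?T" using S c j by (auto simp: Sub_def T)
  qed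
qed

lemma boolean_domainI:
  fixes L :: "'x::order set" and B :: "'b boolalg"
  assumes B: "boolalg B" and iso: "poset_iso L (Sub B)"
  shows "boolean_domain L"
proof -
  interpret boolalg B by (rule B)
  obtain f where f: "bij_betw f L (Sub B)" "\<forall>x\<in>L. \<forall>y\<in>L. x \<le> y \<longleftrightarrow> f x \<le> f y"
    using iso by (auto simp: poset_iso_def)
  define S where "S b = {ba_zero B, ba_one B, b, ba_compl B b}" for b
  define rep where "rep b = (SOME c. c \<in> {b, ba_compl B b})" for b
  define h where "h b = (inv_into L f (S b), b = rep b)" for b
  have "inj_on h (ba_carrier B)"
  proof (rule inj_onI)
    fix b c assume b: "b \<in> ba_carrier B" and c: "c \<in> ba_carrier B" and e: "h b = h c"
    have "S b \<in> f ` L" "S c \<in> f ` L"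
      using four_element_Sub b c f(1) by (auto simp: S_def bij_betw_def)
    then have "S b = S c" using e inv_into_injective[of L f] by (simp add: h_def)
    then have "c \<in> S b" "b \<in> S c" by (auto simp: S_def)
    then have cb: "c = b \<or> c = ba_compl B b"
      unfolding S_def using compl_compl[OF b] compl_compl[OF c] compl_zero compl_one by auto
    then have "{b, ba_compl B b} = {c, ba_compl B c}" using compl_compl[OF b] by auto
    then have r: "rep b = rep c" by (simp add: rep_def)
    have "rep b \<in> {b, ba_compl B b}" unfolding rep_def by (rule someI_ex) blast
    then show "b = c" using e r cb by (auto simp: h_def)
  qed
  note T = transport[OF this]
  have inj: "inj_on ((`) h) (Sub B)"
    using inj_on_image_Pow[OF \<open>inj_on h (ba_carrier B)\<close>] by (rule inj_on_subset) (auto simp: Sub_def)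
  have "bij_betw (\<lambda>x. h ` f x) L (Sub (transport_boolalg h B))"
    using bij_betw_trans[OF f(1) inj_on_imp_bij_betw[OF inj]] unfolding T(2) comp_def .
  moreover have "\<forall>x\<in>L. \<forall>y\<in>L. x \<le> y \<longleftrightarrow> h ` f x \<le> h ` f y"
  proof (intro ballI)
    fix x y assume "x \<in> L" "y \<in> L"
    then have "f x \<in> Sub B" "f y \<in> Sub B" using bij_betwE[OF f(1)] by blast+
    then have "f x \<subseteq> ba_carrier B" "f y \<subseteq> ba_carrier B" by (simp_all add: Sub_def)
    then have "f x \<subseteq> f y \<longleftrightarrow> h ` f x \<subseteq> h ` f y"
      using \<open>inj_on h (ba_carrier B)\<close> by (metis image_mono inv_into_image_cancel)
    then show "x \<le> y \<longleftrightarrow> h ` f x \<le> h ` f y" using f(2) \<open>x \<in> L\<close> \<open>y \<in> L\<close> by simp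
  qed
  ultimately have "poset_iso L (Sub (transport_boolalg h B))" unfolding poset_iso_def by blast
  then show ?thesis unfolding boolean_domain_def using T(1) by blast
qed

definition dual_modular :: "'x::order set \<Rightarrow> 'x \<Rightarrow> bool" where
  "dual_modular L x \<longleftrightarrow> x \<in> L \<and>
     (\<forall>y\<in>L. \<forall>z\<in>L. x \<le> z \<longrightarrow>
        meet_in L (join_in L x y) z = join_in L x (meet_in L y z)) \<and>
     (\<forall>w\<in>L. \<forall>y\<in>L. w \<le> y \<longrightarrow>
        meet_in L (join_in L w x) y = join_in L w (meet_in L x y))"

definition principal_pair :: "'x::order set \<Rightarrow> 'x \<times> 'x \<Rightarrow> bool" where
  "principal_pair L = (\<lambda>(y, z). dual_modular L y \<and> dual_modular L z \<and>
     (is_greatest L y \<and> basic L z \<or>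
      is_greatest L z \<and> basic L y \<or>
      is_greatest L (join_in L y z) \<and> basic L (meet_in L y z) \<and> \<not> dual_modular L (meet_in L y z)))"

definition principal_pair_for :: "'x::order set \<Rightarrow> 'x \<Rightarrow> 'x \<times> 'x \<Rightarrow> bool" where
  "principal_pair_for L x = (\<lambda>(y, z). principal_pair L (y, z) \<and> basic L x \<and> meet_in L y z = x)"


section \<open>Orthodomains and directions\<close>

definition orthodomain :: "'x::order set \<Rightarrow> bool" where
  "orthodomain X \<longleftrightarrow>
     (\<exists>b. is_least X b) \<and>
     (\<forall>D. directed_in X D \<longrightarrow> (\<exists>u. is_lub X D u)) \<and>
     atomistic X \<and> (\<forall>a. is_atom X a \<longrightarrow> compact_in X a) \<and>
     (\<forall>x\<in>X. boolean_domain (down_in X x)) \<and>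
     (\<forall>x y w. is_atom X x \<and> is_atom X y \<and> x \<noteq> y \<and> covers X x w \<and> covers X y w
        \<longrightarrow> is_lub X {x, y} w)"

text \<open>
  A map \<open>\<up>x \<rightarrow> X\<^sup>2\<close> is a partial map with domain \<open>\<up>x\<close>, so that maps with
  different domains are different.
\<close>

type_synonym 'x dir = "'x \<rightharpoonup> 'x \<times> 'x"

definition is_direction :: "'x::order set \<Rightarrow> 'x \<Rightarrow> 'x dir \<Rightarrow> bool" where
  "is_direction X x d \<longleftrightarrow> basic X x \<and> dom d = up_in X x \<and>
     (\<forall>y\<in>up_in X x. \<forall>p. d y = Some p \<longrightarrow> principal_pair_for (down_in X y) x p) \<and>
     (\<forall>y\<in>up_in X x. \<forall>z\<in>up_in X x. \<forall>v w. y \<le> z \<and> d z = Some (v, w)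
        \<longrightarrow> d y = Some (meet_in X y v, meet_in X y w)) \<and>
     (\<forall>y\<in>up_in X x. \<forall>z\<in>up_in X x.
        covers X x y \<and> covers X x z \<and> d y = Some (x, y) \<and> d z = Some (z, x)
        \<longrightarrow> (\<exists>u. is_lub X {y, z} u \<and> covers X y u \<and> covers X z u))"

definition Dir :: "'x::order set \<Rightarrow> 'x dir set" where
  "Dir X = {d. \<exists>x. is_direction X x d}"

definition od_proper :: "'x::order set \<Rightarrow> bool" where
  "od_proper X \<longleftrightarrow> \<not> (\<exists>x. is_maximal X x \<and> basic X x)"

definition enough_directions :: "'x::order set \<Rightarrow> bool" where
  "enough_directions X \<longleftrightarrow> od_proper X \<and> (\<forall>x. basic X x \<longrightarrow> (\<exists>d. is_direction X x d))"


section \<open>Orthoalgebras\<close>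

text \<open>
  The partial sum is an option-valued operation: \<open>a \<perp> b\<close> iff \<open>oa_plus A a b \<noteq> None\<close>.
\<close>

record 'a orthoalg =
  oa_carrier :: "'a set"
  oa_plus :: "'a \<Rightarrow> 'a \<Rightarrow> 'a option"
  oa_compl :: "'a \<Rightarrow> 'a"
  oa_zero :: "'a"
  oa_one :: "'a"

locale orthoalgebra =
  fixes A :: "'a orthoalg" (structure)
  assumes zero_closed: "oa_zero A \<in> oa_carrier A"
    and one_closed: "oa_one A \<in> oa_carrier A"
    and compl_closed: "a \<in> oa_carrier A \<Longrightarrow> oa_compl A a \<in> oa_carrier A"
    and plus_closed: "\<lbrakk>a \<in> oa_carrier A; b \<in> oa_carrier A; oa_plus A a b = Some c\<rbrakk>
          \<Longrightarrow> c \<in> oa_carrier A"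
    and plus_commute: "\<lbrakk>a \<in> oa_carrier A; b \<in> oa_carrier A\<rbrakk> \<Longrightarrow> oa_plus A a b = oa_plus A b a"
    and plus_assoc: "\<lbrakk>a \<in> oa_carrier A; b \<in> oa_carrier A; c \<in> oa_carrier A\<rbrakk>
          \<Longrightarrow> Option.bind (oa_plus A a b) (\<lambda>s. oa_plus A s c)
            = Option.bind (oa_plus A b c) (\<lambda>t. oa_plus A a t)"
    and plus_eq_one_iff: "\<lbrakk>a \<in> oa_carrier A; b \<in> oa_carrier A\<rbrakk>
          \<Longrightarrow> oa_plus A a b = Some (oa_one A) \<longleftrightarrow> b = oa_compl A a"
    and plus_self_defined_iff: "a \<in> oa_carrier A \<Longrightarrow> oa_plus A a a \<noteq> None \<longleftrightarrow> a = oa_zero A"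

definition boolean_orthoalgebra :: "'a orthoalg \<Rightarrow> bool" where
  "boolean_orthoalgebra A \<longleftrightarrow> orthoalgebra A \<and>
     (\<exists>B. boolalg B \<and> ba_carrier B = oa_carrier A \<and>
          ba_zero B = oa_zero A \<and> ba_one B = oa_one A \<and>
          (\<forall>a\<in>oa_carrier A. ba_compl B a = oa_compl A a) \<and>
          (\<forall>a\<in>oa_carrier A. \<forall>b\<in>oa_carrier A.
             oa_plus A a b = (if ba_meet B a b = ba_zero B then Some (ba_join B a b) else None)))"

definition oa_subalgebra :: "'a orthoalg \<Rightarrow> 'a set \<Rightarrow> bool" where
  "oa_subalgebra A S \<longleftrightarrow> S \<subseteq> oa_carrier A \<and> oa_zero A \<in> S \<and> oa_one A \<in> S \<and>
     (\<forall>a\<in>S. oa_compl A a \<in> S) \<and>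
     (\<forall>a\<in>S. \<forall>b\<in>S. \<forall>c. oa_plus A a b = Some c \<longrightarrow> c \<in> S)"

definition BSub :: "'a orthoalg \<Rightarrow> 'a set set" where
  "BSub A = {S. oa_subalgebra A S \<and> boolean_orthoalgebra (A\<lparr>oa_carrier := S\<rparr>)}"

definition is_block :: "'a orthoalg \<Rightarrow> 'a set \<Rightarrow> bool" where
  "is_block A S \<longleftrightarrow> is_maximal (BSub A) S"

definition oa_proper :: "'a orthoalg \<Rightarrow> bool" where
  "oa_proper A \<longleftrightarrow> \<not> (\<exists>S. is_block A S \<and> finite S \<and> card S \<le> 4)"


section \<open>The operations on directions\<close>

definition near :: "'x::order set \<Rightarrow> 'x \<Rightarrow> 'x \<Rightarrow> bool" where
  "near X x y \<longleftrightarrow> is_atom X x \<and> is_atom X y \<and> x \<noteq> y \<and>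
     (\<exists>w. is_lub X {x, y} w \<and> covers X x w \<and> covers X y w)"

definition dir_zero :: "'x::order set \<Rightarrow> 'x dir" where
  "dir_zero X = (\<lambda>w. if w \<in> X then Some (bot_of X, w) else None)"

definition dir_one :: "'x::order set \<Rightarrow> 'x dir" where
  "dir_one X = (\<lambda>w. if w \<in> X then Some (w, bot_of X) else None)"

definition dir_compl :: "'x dir \<Rightarrow> 'x dir" where
  "dir_compl d = (\<lambda>w. map_option prod.swap (d w))"

text \<open>
  \<open>z\<close> is the third atom below \<open>w\<close>; whether a sum is defined depends only on the hypotheses on
  the summands, not on the existence of its value.
\<close>

definition near_summands :: "'x::order set \<Rightarrow> 'x dir \<Rightarrow> 'x dir \<Rightarrow> 'x \<Rightarrow> 'x \<Rightarrow> bool" where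
  "near_summands X d e w z \<longleftrightarrow>
     (\<exists>x y. is_direction X x d \<and> is_direction X y e \<and> near X x y \<and> is_lub X {x, y} w \<and>
        is_atom X z \<and> z \<le> w \<and> z \<noteq> x \<and> z \<noteq> y \<and>
        d w = Some (x, w) \<and> e w = Some (y, w))"

definition dir_plus :: "'x::order set \<Rightarrow> 'x dir \<Rightarrow> 'x dir \<Rightarrow> 'x dir option" where
  "dir_plus X d e =
     (if e = dir_zero X then Some d
      else if d = dir_zero X then Some e
      else if e = dir_compl d then Some (dir_one X)
      else if \<exists>w z. near_summands X d e w z
        then Some (THE f. \<exists>w z. near_summands X d e w z \<and> is_direction X z f \<and> f w = Some (w, z))
      else None)"

definition Dir_orthoalg :: "'x::order set \<Rightarrow> 'x dir orthoalg" where
  "Dir_orthoalg X = \<lparr>oa_carrier = Dir X, oa_plus = dir_plus X, oa_compl = dir_compl,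
     oa_zero = dir_zero X, oa_one = dir_one X\<rparr>"

end

theory Submission
  imports Defs
begin

text \<open>
  Everything rests on a dictionary between a Boolean algebra \<open>B\<close> and the lattice \<open>Sub B\<close>.  An
  element \<open>a\<close> is recorded by the ordered pair \<open>(psub a, psub a')\<close>, where \<open>psub a = \<down>a \<union> \<up>a'\<close>;
  the two subalgebras meet in \<open>four a = {0, 1, a, a'}\<close>, and exchanging them is complementation.  In
  order-theoretic terms these are the principal pairs.  Indeed \<open>psub a\<close> is always dual modular
  (\<open>psub_dual_modular\<close>), while \<open>four a\<close> is dual modular only if it equals \<open>psub a\<close> or \<open>psub a'\<close>
  (\<open>dual_modular_four\<close>), and when \<open>Sub B\<close> has height at most \<open>3\<close> there are no other
  principal pairs (\<open>principal_pair_forD\<close>).  A direction with base \<open>x\<close> therefore chooses, coherently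
  for all \<open>w\<close> above \<open>x\<close>, one of the two generators \<open>a\<close>, \<open>a'\<close> of the four-element
  subalgebra that represents \<open>x\<close> in \<open>\<down>w\<close>.

  Given a proper orthoalgebra \<open>A\<close>, an element \<open>a\<close> of \<open>A\<close> assigns to each Boolean
  subalgebra \<open>S\<close> of height at most \<open>3\<close> containing it the pair \<open>(psub a, psub a')\<close> of \<open>S\<close>.  This is a direction; the
  condition that needs an argument is the last one.  It concerns two eight-element subalgebras \<open>S\<close> and
  \<open>R\<close>, where \<open>a\<close> is an atom of \<open>S\<close> and \<open>a'\<close> is an atom of \<open>R\<close>.  The sums
  \<open>s \<oplus> t\<close> with \<open>s \<le> a'\<close> in \<open>S\<close> and \<open>t \<le> a\<close> in \<open>R\<close> form a copy of the product of two
  intervals (\<open>amalgam_in_BSub\<close>), hence a Boolean subalgebra with sixteen elements, which is the join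
  of \<open>S\<close> and \<open>R\<close>.

  Conversely, let \<open>X\<close> be a short orthodomain with enough directions.  A direction is determined by its
  value at any one element strictly above its base (\<open>direction_determined\<close>): if two directions
  agreed at one cover of the base and disagreed at another, one of them would be oriented oppositely at these
  covers, and the join that the last condition provides would propagate the agreement.  So for \<open>w\<close>
  not basic and \<open>\<down>w \<cong> Sub B\<close>, the directions with base below \<open>w\<close> are in bijection with
  \<open>B\<close>, and under this bijection the sum of directions is the orthogonal join (\<open>phi_plus\<close>).  The
  axioms of orthoalgebras are inherited from the algebras \<open>B\<close>, provided that the elements involved lie
  below a common \<open>w\<close>.  For associativity this is again the last condition on directions: if
  \<open>(d \<oplus> e) \<oplus> f\<close> is defined, then \<open>d \<oplus> e\<close> is oriented one way at the join of the bases of its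
  summands and the other way at the join of its own base with that of \<open>f\<close>
  (\<open>common_big_three\<close>).

  Finally \<open>w \<mapsto> dirs_at w\<close> is the isomorphism from \<open>X\<close> to the poset of Boolean subalgebras of
  \<open>Dir X\<close> of height at most \<open>3\<close>.  It is onto because such a subalgebra consists of the joins of at
  most four orthogonal elements, and these directions lie below a common \<open>w\<close> (\<open>star_BSub_below\<close>).
\<close>

section \<open>Boolean algebras and two-valued homomorphisms\<close>

definition valuation :: "'b boolalg \<Rightarrow> ('b \<Rightarrow> bool) \<Rightarrow> bool" where
  "valuation B v \<longleftrightarrow> \<not> v (ba_zero B) \<and> v (ba_one B) \<and>
     (\<forall>a\<in>ba_carrier B. v (ba_compl B a) \<longleftrightarrow> \<not> v a) \<and>
     (\<forall>a\<in>ba_carrier B. \<forall>b\<in>ba_carrier B.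
        (v (ba_join B a b) \<longleftrightarrow> v a \<or> v b) \<and> (v (ba_meet B a b) \<longleftrightarrow> v a \<and> v b))"

definition four :: "'b boolalg \<Rightarrow> 'b \<Rightarrow> 'b set" where
  "four B a = {ba_zero B, ba_one B, a, ba_compl B a}"

text \<open>
  The subalgebra \<open>\<down>a \<union> \<up>a'\<close>.  It is expressed by orthogonality to \<open>a'\<close> alone, so that
  the same formula makes sense in an orthoalgebra.
\<close>

definition psub :: "'b boolalg \<Rightarrow> 'b \<Rightarrow> 'b set" where
  "psub B a = {t \<in> ba_carrier B. ba_meet B t (ba_compl B a) = ba_zero B
                 \<or> ba_meet B (ba_compl B t) (ba_compl B a) = ba_zero B}"

definition gen :: "'b boolalg \<Rightarrow> 'b set \<Rightarrow> 'b set" where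
  "gen B G = \<Inter> {S \<in> Sub B. G \<subseteq> S}"

context boolalg
begin

abbreviation join_here (infixl "\<squnion>" 65) where "a \<squnion> b \<equiv> ba_join B a b"
abbreviation meet_here (infixl "\<sqinter>" 70) where "a \<sqinter> b \<equiv> ba_meet B a b"
abbreviation compl_here ("\<sim> _" [81] 80) where "\<sim> a \<equiv> ba_compl B a"
abbreviation zero_here ("\<zero>") where "\<zero> \<equiv> ba_zero B"
abbreviation one_here ("\<one>") where "\<one> \<equiv> ba_one B"
abbreviation carrier_here ("\<C>") where "\<C> \<equiv> ba_carrier B"

lemmas closed [simp, intro] = zero_closed one_closed compl_closed join_closed meet_closed

definition pfilter :: "'b set \<Rightarrow> bool" where
  "pfilter F \<longleftrightarrow> F \<subseteq> \<C> \<and> \<one> \<in> F \<and> \<zero> \<notin> F \<and> (\<forall>a\<in>F. \<forall>b\<in>F. a \<sqinter> b \<in> F)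
     \<and> (\<forall>a\<in>F. \<forall>b\<in>\<C>. a \<sqinter> b = a \<longrightarrow> b \<in> F)"

lemma meet_left_commute:
  "\<lbrakk>a \<in> \<C>; b \<in> \<C>; c \<in> \<C>\<rbrakk> \<Longrightarrow> a \<sqinter> (b \<sqinter> c) = b \<sqinter> (a \<sqinter> c)"
  using meet_assoc meet_commute by metis

lemma meet_left_idem: "\<lbrakk>a \<in> \<C>; b \<in> \<C>\<rbrakk> \<Longrightarrow> a \<sqinter> (a \<sqinter> b) = a \<sqinter> b"
  using meet_assoc meet_idem by metis

text \<open>
  Otherwise the filter generated by \<open>F\<close> and \<open>x\<close> would be a larger proper filter.
\<close>

lemma maximal_pfilter_meets_zero:
  assumes F: "pfilter F" and max: "\<And>G. pfilter G \<Longrightarrow> F \<subseteq> G \<Longrightarrow> G = F"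
    and x: "x \<in> \<C>" "x \<notin> F"
  shows "\<exists>f\<in>F. f \<sqinter> x = \<zero>"
proof (rule ccontr)
  assume no: "\<not> ?thesis"
  define G where "G = {y \<in> \<C>. \<exists>f\<in>F. (f \<sqinter> x) \<sqinter> y = f \<sqinter> x}"
  have FC: "\<And>f. f \<in> F \<Longrightarrow> f \<in> \<C>" using F by (auto simp: pfilter_def)
  have "pfilter G"
    unfolding pfilter_def
  proof (intro conjI ballI impI)
    show "G \<subseteq> \<C>" by (auto simp: G_def)
    have "\<one> \<in> F" using F by (simp add: pfilter_def)
    then have "\<exists>f\<in>F. (f \<sqinter> x) \<sqinter> \<one> = f \<sqinter> x" using x by (intro bexI[of _ \<one>]) (simp_all add: meet_one)
    then show "\<one> \<in> G" by (simp add: G_def)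
    have "(f \<sqinter> x) \<sqinter> \<zero> \<noteq> f \<sqinter> x" if "f \<in> F" for f
      using no x(1) FC[OF that] that meet_zero[of "f \<sqinter> x"] by auto
    then show "\<zero> \<notin> G" by (auto simp: G_def)
  next
    fix a b assume "a \<in> G" "b \<in> G"
    then obtain f g where fg: "f \<in> F" "g \<in> F" "(f \<sqinter> x) \<sqinter> a = f \<sqinter> x" "(g \<sqinter> x) \<sqinter> b = g \<sqinter> x"
      and ab: "a \<in> \<C>" "b \<in> \<C>"
      by (auto simp: G_def)
    have C: "f \<in> \<C>" "g \<in> \<C>" using fg FC by auto
    have "((f \<sqinter> g) \<sqinter> x) \<sqinter> (a \<sqinter> b) = ((f \<sqinter> x) \<sqinter> a) \<sqinter> ((g \<sqinter> x) \<sqinter> b)"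
      using C ab x by (simp add: meet_assoc meet_commute meet_left_commute meet_left_idem meet_idem)
    also have "\<dots> = (f \<sqinter> g) \<sqinter> x"
      unfolding fg using C x by (simp add: meet_assoc meet_commute meet_left_commute meet_left_idem meet_idem)
    finally show "a \<sqinter> b \<in> G" using ab F fg unfolding G_def pfilter_def by blast
  next
    fix a b assume "a \<in> G" and b: "b \<in> \<C>" "a \<sqinter> b = a"
    then obtain f where f: "f \<in> F" "(f \<sqinter> x) \<sqinter> a = f \<sqinter> x" and a: "a \<in> \<C>" by (auto simp: G_def)
    have "(f \<sqinter> x) \<sqinter> b = f \<sqinter> x" using meet_assoc[of "f \<sqinter> x" a b] f a b x FC by auto
    then show "b \<in> G" using f b by (auto simp: G_def)
  qed
  moreover have "F \<subseteq> G"
  proof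
    fix f assume f: "f \<in> F"
    then have "(f \<sqinter> x) \<sqinter> f = f \<sqinter> x"
      using FC x meet_commute[of "f \<sqinter> x" f] meet_left_idem[of f x] by auto
    then show "f \<in> G" using f FC by (auto simp: G_def)
  qed
  moreover have "x \<in> G"
    using F x meet_assoc[of \<one> x x] meet_idem[of x] by (auto simp: G_def pfilter_def)
  ultimately show False using max x by blast
qed

text \<open>
  By Zorn's lemma there is a maximal proper filter containing \<open>c\<close>; it contains exactly one of
  \<open>x\<close> and \<open>x'\<close>, and membership in it is a valuation.
\<close>

lemma valuation_exists:
  assumes c: "c \<in> \<C>" "c \<noteq> \<zero>"
  shows "\<exists>v. valuation B v \<and> v c"
proof -
  define \<F> where "\<F> = {F. pfilter F \<and> c \<in> F}"
  define U where "U = {y \<in> \<C>. c \<sqinter> y = c}"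
  have "a \<sqinter> b \<in> U" if "a \<in> U" "b \<in> U" for a b
    using that c meet_assoc[of c a b] by (auto simp: U_def)
  moreover have "b \<in> U" if "a \<in> U" "b \<in> \<C>" "a \<sqinter> b = a" for a b
    using that c meet_assoc[of c a b] by (auto simp: U_def)
  moreover have "U \<subseteq> \<C>" "\<one> \<in> U" "\<zero> \<notin> U" "c \<in> U"
    using c meet_one[of c] meet_idem[of c] meet_zero[of c] by (auto simp: U_def)
  ultimately have "U \<in> \<F>" by (simp add: \<F>_def pfilter_def)
  then have ne: "\<F> \<noteq> {}" by blast
  have "\<Union>\<K> \<in> \<F>" if K: "\<K> \<noteq> {}" "subset.chain \<F> \<K>" for \<K>
  proof -
    have sub: "\<And>F. F \<in> \<K> \<Longrightarrow> pfilter F \<and> c \<in> F" using K by (auto simp: subset_chain_def \<F>_def)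
    have "a \<sqinter> b \<in> \<Union>\<K>" if ab: "a \<in> \<Union>\<K>" "b \<in> \<Union>\<K>" for a b
    proof -
      obtain F G where "F \<in> \<K>" "G \<in> \<K>" "a \<in> F" "b \<in> G" using ab by blast
      moreover then have "F \<subseteq> G \<or> G \<subseteq> F" using K by (auto simp: subset_chain_def)
      ultimately obtain H where "H \<in> \<K>" "a \<in> H" "b \<in> H" by blast
      then show ?thesis using sub unfolding pfilter_def by blast
    qed
    moreover have "\<Union>\<K> \<subseteq> \<C>" "\<one> \<in> \<Union>\<K>" "\<zero> \<notin> \<Union>\<K>" "c \<in> \<Union>\<K>"
      using sub K(1) unfolding pfilter_def by blast+
    moreover have "b \<in> \<Union>\<K>" if ab: "a \<in> \<Union>\<K>" "b \<in> \<C>" "a \<sqinter> b = a" for a b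
    proof -
      obtain F where "F \<in> \<K>" "a \<in> F" using ab by blast
      then show ?thesis using sub[of F] ab unfolding pfilter_def by blast
    qed
    ultimately show ?thesis by (simp add: \<F>_def pfilter_def)
  qed
  from subset_Zorn_nonempty[OF ne this] obtain F
    where F: "F \<in> \<F>" "\<And>G. G \<in> \<F> \<Longrightarrow> F \<subseteq> G \<Longrightarrow> G = F" by blast
  have pf: "pfilter F" and cF: "c \<in> F" using F by (auto simp: \<F>_def)
  have FC: "F \<subseteq> \<C>" "\<And>a b. a \<in> F \<Longrightarrow> b \<in> F \<Longrightarrow> a \<sqinter> b \<in> F" "\<zero> \<notin> F" "\<one> \<in> F"
    "\<And>a b. a \<in> F \<Longrightarrow> b \<in> \<C> \<Longrightarrow> a \<sqinter> b = a \<Longrightarrow> b \<in> F" using pf by (auto simp: pfilter_def)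
  have mz: "\<exists>f\<in>F. f \<sqinter> x = \<zero>" if "x \<in> \<C>" "x \<notin> F" for x
    using maximal_pfilter_meets_zero[OF pf _ that] F(2) cF by (auto simp: \<F>_def)
  have compl: "\<sim> x \<in> F \<longleftrightarrow> x \<notin> F" if x: "x \<in> \<C>" for x
  proof
    assume "\<sim> x \<in> F" then show "x \<notin> F" using FC(2)[of x "\<sim> x"] FC(3) meet_compl[OF x] by auto
  next
    assume xF: "x \<notin> F"
    show "\<sim> x \<in> F"
    proof (rule ccontr)
      assume "\<sim> x \<notin> F"
      then obtain f g where fg: "f \<in> F" "g \<in> F" "f \<sqinter> x = \<zero>" "g \<sqinter> \<sim> x = \<zero>"
        using mz xF x compl_closed by metis
      have C: "f \<in> \<C>" "g \<in> \<C>" using fg FC by auto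
      have "f \<sqinter> g = (f \<sqinter> g) \<sqinter> (x \<squnion> \<sim> x)" using x C by (simp add: join_compl meet_one)
      also have "\<dots> = ((f \<sqinter> g) \<sqinter> x) \<squnion> ((f \<sqinter> g) \<sqinter> \<sim> x)" using x C by (simp add: meet_join_distrib)
      also have "(f \<sqinter> g) \<sqinter> x = g \<sqinter> (f \<sqinter> x)" using x C by (simp add: meet_assoc meet_left_commute)
      also have "(f \<sqinter> g) \<sqinter> \<sim> x = f \<sqinter> (g \<sqinter> \<sim> x)" using x C by (simp add: meet_assoc)
      finally have "f \<sqinter> g = \<zero>" using fg C by (simp add: meet_zero join_zero)
      then show False using FC fg by metis
    qed
  qed
  have meet: "a \<sqinter> b \<in> F \<longleftrightarrow> a \<in> F \<and> b \<in> F" if ab: "a \<in> \<C>" "b \<in> \<C>" for a b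
  proof
    assume "a \<sqinter> b \<in> F"
    then show "a \<in> F \<and> b \<in> F"
      using FC(5)[of "a \<sqinter> b" a] FC(5)[of "a \<sqinter> b" b] ab
      by (simp add: meet_assoc meet_commute meet_left_commute meet_left_idem meet_idem)
  qed (use FC in auto)
  have join: "a \<squnion> b \<in> F \<longleftrightarrow> a \<in> F \<or> b \<in> F" if ab: "a \<in> \<C>" "b \<in> \<C>" for a b
  proof
    have absorb: "x \<sqinter> (x \<squnion> y) = x" if "x \<in> \<C>" "y \<in> \<C>" for x y
      using join_meet_distrib[of x \<zero> y] join_zero meet_zero meet_commute[of \<zero> y] that zero_closed by metis
    assume "a \<in> F \<or> b \<in> F"
    then show "a \<squnion> b \<in> F"
      using FC(5)[of a "a \<squnion> b"] FC(5)[of b "a \<squnion> b"] ab absorb[of a b] absorb[of b a] join_commute[of a b]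
        join_closed by metis
  next
    assume j: "a \<squnion> b \<in> F"
    show "a \<in> F \<or> b \<in> F"
    proof (rule ccontr)
      assume "\<not> ?thesis"
      then have "\<sim> a \<in> F" "\<sim> b \<in> F" using compl ab by auto
      then have "\<sim> a \<sqinter> (\<sim> b \<sqinter> (a \<squnion> b)) \<in> F" using FC(2) j by metis
      moreover have "\<sim> b \<sqinter> (a \<squnion> b) = \<sim> b \<sqinter> a"
        using ab meet_join_distrib[of "\<sim> b" a b] meet_commute[of "\<sim> b" b] meet_compl[of b] join_zero
          meet_closed compl_closed by metis
      moreover have "\<sim> a \<sqinter> (\<sim> b \<sqinter> a) = \<sim> b \<sqinter> (a \<sqinter> \<sim> a)"
        using ab meet_commute[of "\<sim> b" a] meet_assoc[of "\<sim> a" a "\<sim> b"] meet_commute[of "\<sim> a" a]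
          meet_commute[of "a \<sqinter> \<sim> a" "\<sim> b"] compl_closed meet_closed by metis
      ultimately show False using ab FC(3) by (simp add: meet_compl meet_zero)
    qed
  qed
  have "valuation B (\<lambda>x. x \<in> F)"
    unfolding valuation_def using FC(3,4) compl meet join by simp
  then show ?thesis using cF by blast
qed

lemma valuation_simps [simp]:
  assumes "valuation B v"
  shows "v \<zero> \<longleftrightarrow> False" "v \<one> \<longleftrightarrow> True" "a \<in> \<C> \<Longrightarrow> v (\<sim> a) \<longleftrightarrow> \<not> v a"
    "a \<in> \<C> \<Longrightarrow> b \<in> \<C> \<Longrightarrow> v (a \<squnion> b) \<longleftrightarrow> v a \<or> v b"
    "a \<in> \<C> \<Longrightarrow> b \<in> \<C> \<Longrightarrow> v (a \<sqinter> b) \<longleftrightarrow> v a \<and> v b"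
  using assms by (auto simp: valuation_def)

text \<open>
  Valuations separate elements.  Hence an identity between Boolean terms holds as soon as it is a
  propositional tautology, which is how all Boolean computations below are carried out.
\<close>

lemma eq_iff_valuations:
  assumes ab: "a \<in> \<C>" "b \<in> \<C>"
  shows "a = b \<longleftrightarrow> (\<forall>v. valuation B v \<longrightarrow> (v a \<longleftrightarrow> v b))"
proof (intro iffI)
  assume r: "\<forall>v. valuation B v \<longrightarrow> (v a \<longleftrightarrow> v b)"
  have "x = x \<sqinter> y" if xy: "x \<in> \<C>" "y \<in> \<C>" and r: "\<forall>v. valuation B v \<longrightarrow> (v x \<longleftrightarrow> v y)" for x y
  proof -
    have "x \<sqinter> \<sim> y = \<zero>"
    proof (rule ccontr)
      assume "x \<sqinter> \<sim> y \<noteq> \<zero>"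
      then obtain v where v: "valuation B v" "v (x \<sqinter> \<sim> y)"
        using valuation_exists[of "x \<sqinter> \<sim> y"] xy by (meson closed)
      then have "v x" "\<not> v y" using xy by auto
      then show False using r v(1) by blast
    qed
    then show ?thesis using xy meet_join_distrib[of x y "\<sim> y"] by (simp add: join_compl meet_one join_zero)
  qed
  from this[of a b] this[of b a] show "a = b" using ab r meet_commute[of a b] by metis
qed auto

lemma valuation_eqI:
  "\<lbrakk>a \<in> \<C>; b \<in> \<C>; \<And>v. valuation B v \<Longrightarrow> v a \<longleftrightarrow> v b\<rbrakk> \<Longrightarrow> a = b"
  using eq_iff_valuations by blast

end

section \<open>Boolean subalgebras\<close>

text \<open>
  Dual modularity in \<open>Sub B\<close>, with joins and meets written as generated subalgebras and
  intersections.
\<close>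

definition sub_dual_modular :: "'b boolalg \<Rightarrow> 'b set \<Rightarrow> bool" where
  "sub_dual_modular B I \<longleftrightarrow> I \<in> Sub B \<and>
     (\<forall>Y\<in>Sub B. \<forall>Z\<in>Sub B. I \<subseteq> Z \<longrightarrow> gen B (I \<union> Y) \<inter> Z = gen B (I \<union> (Y \<inter> Z))) \<and>
     (\<forall>W\<in>Sub B. \<forall>Y\<in>Sub B. W \<subseteq> Y \<longrightarrow> gen B (W \<union> I) \<inter> Y = gen B (W \<union> (I \<inter> Y)))"

text \<open>
  A valuation choosing exactly one member expresses both that the members are pairwise disjoint and
  that their join is \<open>1\<close>.  The element \<open>0\<close> may be a member.
\<close>

definition partition_of_unity :: "'b boolalg \<Rightarrow> 'b set \<Rightarrow> bool" where
  "partition_of_unity B F \<longleftrightarrow> finite F \<and> F \<subseteq> ba_carrier B \<and>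
     (\<forall>v. valuation B v \<longrightarrow> (\<exists>!f. f \<in> F \<and> v f))"

text \<open>
  The joins of subsets of \<open>F\<close>; they are specified through their valuations in place of iterated
  binary joins.
\<close>

definition joins_of :: "'b boolalg \<Rightarrow> 'b set \<Rightarrow> 'b set" where
  "joins_of B F = {s \<in> ba_carrier B. \<exists>G\<subseteq>F. \<forall>v. valuation B v \<longrightarrow> (v s \<longleftrightarrow> (\<exists>f\<in>G. v f))}"

context boolalg
begin

lemma SubD:
  assumes "S \<in> Sub B"
  shows "S \<subseteq> \<C>" "\<zero> \<in> S" "\<one> \<in> S" "\<And>a. a \<in> S \<Longrightarrow> \<sim> a \<in> S"
    "\<And>a b. a \<in> S \<Longrightarrow> b \<in> S \<Longrightarrow> a \<squnion> b \<in> S" "\<And>a b. a \<in> S \<Longrightarrow> b \<in> S \<Longrightarrow> a \<sqinter> b \<in> S"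
    "\<And>a. a \<in> S \<Longrightarrow> a \<in> \<C>"
  using assms by (auto simp: Sub_def)

lemma SubI:
  assumes "S \<subseteq> \<C>" "\<zero> \<in> S" "\<And>a. a \<in> S \<Longrightarrow> \<sim> a \<in> S" "\<And>a b. a \<in> S \<Longrightarrow> b \<in> S \<Longrightarrow> a \<squnion> b \<in> S"
  shows "S \<in> Sub B"
proof -
  have "a \<sqinter> b \<in> S" if "a \<in> S" "b \<in> S" for a b
  proof -
    have "a \<in> \<C>" "b \<in> \<C>" using that assms by auto
    then have "a \<sqinter> b = \<sim> (\<sim> a \<squnion> \<sim> b)" by (simp add: eq_iff_valuations)
    then show ?thesis using assms that by simp
  qed
  moreover have "\<one> \<in> S" using assms(2,3) compl_zero by metis
  ultimately show ?thesis using assms by (auto simp: Sub_def)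
qed

lemma carrier_in_Sub: "\<C> \<in> Sub B" by (auto simp: Sub_def)

lemma Int_in_Sub: "S \<in> Sub B \<Longrightarrow> T \<in> Sub B \<Longrightarrow> S \<inter> T \<in> Sub B"
  by (auto simp: Sub_def)

lemma gen_in_Sub:
  assumes "G \<subseteq> \<C>"
  shows "gen B G \<in> Sub B"
proof -
  have "gen B G \<subseteq> \<C>" using assms carrier_in_Sub unfolding gen_def by blast
  then show ?thesis by (auto simp: Sub_def gen_def)
qed

lemma subset_gen: "G \<subseteq> gen B G"
  by (auto simp: gen_def)

lemma gen_least: "S \<in> Sub B \<Longrightarrow> G \<subseteq> S \<Longrightarrow> gen B G \<subseteq> S"
  by (auto simp: gen_def)

lemma gen_mono: "G \<subseteq> H \<Longrightarrow> gen B G \<subseteq> gen B H"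
  by (auto simp: gen_def)

lemma gen_Sub: "S \<in> Sub B \<Longrightarrow> gen B S = S"
  using gen_least subset_gen by blast

lemma four_in_Sub: "a \<in> \<C> \<Longrightarrow> four B a \<in> Sub B"
  using four_element_Sub by (simp add: four_def)

lemma four_zero: "four B \<zero> = {\<zero>, \<one>}"
  by (auto simp: four_def compl_zero)

lemma four_compl: "a \<in> \<C> \<Longrightarrow> four B (\<sim> a) = four B a"
  by (auto simp: four_def compl_compl)

lemma four_least: "S \<in> Sub B \<Longrightarrow> a \<in> S \<Longrightarrow> four B a \<subseteq> S"
  using SubD by (fastforce simp: four_def)

lemma mem_four: "a \<in> four B a" by (simp add: four_def)

lemma four_subset_iff: "S \<in> Sub B \<Longrightarrow> four B a \<subseteq> S \<longleftrightarrow> a \<in> S"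
  using four_least mem_four by blast

lemma four_eqD:
  assumes "four B a = four B b" "a \<in> \<C>" "b \<in> \<C>"
  shows "b = a \<or> b = \<sim> a"
proof -
  have "b \<in> four B a" "a \<in> four B b" using assms mem_four by auto
  then show ?thesis by (auto simp: four_def compl_zero compl_one compl_compl assms)
qed

lemma Sub_of_four:
  assumes "T \<in> Sub B" "T \<subseteq> four B a" "a \<in> \<C>"
  shows "T = {\<zero>, \<one>} \<or> T = four B a"
proof (cases "a \<in> T \<or> \<sim> a \<in> T")
  case True
  then have "a \<in> T" using SubD(4)[OF assms(1)] compl_compl[OF assms(3)] by metis
  then show ?thesis using assms four_least by blast
next
  case False
  then show ?thesis using assms SubD(2,3)[OF assms(1)] unfolding four_def by blast
qed

lemma psub_in_Sub: "a \<in> \<C> \<Longrightarrow> psub B a \<in> Sub B"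
  by (intro SubI) (auto simp: psub_def eq_iff_valuations)

lemma mem_psub_iff:
  assumes a: "a \<in> \<C>"
  shows "t \<in> psub B a \<longleftrightarrow> t \<in> \<C> \<and>
    ((\<forall>v. valuation B v \<longrightarrow> v t \<longrightarrow> v a) \<or> (\<forall>v. valuation B v \<longrightarrow> v t \<or> v a))"
  using a by (auto simp: psub_def eq_iff_valuations)

lemma psub_subset: "psub B a \<subseteq> \<C>"
  by (auto simp: psub_def)

lemma mem_psub: "a \<in> \<C> \<Longrightarrow> a \<in> psub B a" "a \<in> \<C> \<Longrightarrow> \<sim> a \<in> psub B a"
  by (auto simp: psub_def eq_iff_valuations)

lemma psub_zero: "psub B \<zero> = {\<zero>, \<one>}"
  by (auto simp: psub_def eq_iff_valuations)

lemma psub_one: "psub B \<one> = \<C>"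
  by (auto simp: psub_def eq_iff_valuations)

lemma psub_Int_psub_compl:
  assumes a: "a \<in> \<C>"
  shows "psub B a \<inter> psub B (\<sim> a) = four B a"
proof
  show "psub B a \<inter> psub B (\<sim> a) \<subseteq> four B a"
  proof
    fix t assume t: "t \<in> psub B a \<inter> psub B (\<sim> a)"
    then have tC: "t \<in> \<C>" by (auto simp: psub_def)
    have c: "v (\<sim> a) \<longleftrightarrow> \<not> v a" if "valuation B v" for v using that a by simp
    have "(\<forall>v. valuation B v \<longrightarrow> v t \<longrightarrow> v a) \<or> (\<forall>v. valuation B v \<longrightarrow> v t \<or> v a)"
      "(\<forall>v. valuation B v \<longrightarrow> v t \<longrightarrow> v (\<sim> a)) \<or> (\<forall>v. valuation B v \<longrightarrow> v t \<or> v (\<sim> a))"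
      using t a by (auto simp: mem_psub_iff)
    then consider "\<forall>v. valuation B v \<longrightarrow> \<not> v t" | "\<forall>v. valuation B v \<longrightarrow> (v t \<longleftrightarrow> v a)"
      | "\<forall>v. valuation B v \<longrightarrow> (v t \<longleftrightarrow> \<not> v a)" | "\<forall>v. valuation B v \<longrightarrow> v t"
      using c by metis
    then have "t = \<zero> \<or> t = \<one> \<or> t = a \<or> t = \<sim> a"
      by cases (use tC a in \<open>auto simp: eq_iff_valuations\<close>)
    then show "t \<in> four B a" by (auto simp: four_def)
  qed
  show "four B a \<subseteq> psub B a \<inter> psub B (\<sim> a)"
    using a by (auto simp: four_def psub_def eq_iff_valuations)
qed

lemma four_subset_psub: "a \<in> \<C> \<Longrightarrow> four B a \<subseteq> psub B a"
  using psub_Int_psub_compl by blast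

lemma psub_eq_four_imp_psub_compl:
  assumes a: "a \<in> \<C>" and e: "psub B a = four B a"
  shows "psub B (\<sim> a) = \<C>"
proof
  show "\<C> \<subseteq> psub B (\<sim> a)"
  proof
    fix t assume t: "t \<in> \<C>"
    then have "t \<sqinter> a \<in> psub B a" using a by (auto simp: psub_def eq_iff_valuations)
    then have "t \<sqinter> a \<in> {\<zero>, \<one>, a, \<sim> a}" using e by (simp add: four_def)
    then have "t \<sqinter> a = \<zero> \<or> t \<sqinter> a = a \<or> t \<sqinter> a = \<one> \<or> t \<sqinter> a = \<sim> a" by blast
    moreover have "t \<in> psub B (\<sim> a)" if "t \<sqinter> a = \<zero>"
      using that t a by (simp add: psub_def compl_compl)
    moreover have "t \<in> psub B (\<sim> a)" if "\<forall>v. valuation B v \<longrightarrow> v a \<longrightarrow> v t"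
      using that t a by (auto simp: mem_psub_iff)
    moreover have "t \<sqinter> a = \<zero>" if "t \<sqinter> a = \<sim> a"
    proof (rule valuation_eqI)
      show "v (t \<sqinter> a) \<longleftrightarrow> v \<zero>" if "valuation B v" for v
        using arg_cong[OF \<open>t \<sqinter> a = \<sim> a\<close>, of v] that t a by auto
    qed (use t a in auto)
    moreover have "v t" if "valuation B v" "v a" "t \<sqinter> a = a \<or> t \<sqinter> a = \<one>" for v
      using that t a valuation_simps(3,5)[OF that(1)] valuation_simps(2)[OF that(1)] by metis
    ultimately show "t \<in> psub B (\<sim> a)" by blast
  qed
qed (rule psub_subset)

definition sym_diff :: "'b \<Rightarrow> 'b \<Rightarrow> 'b" where "sym_diff s t = (s \<sqinter> \<sim> t) \<squnion> (\<sim> s \<sqinter> t)"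

lemma sym_diff_closed: "S \<in> Sub B \<Longrightarrow> s \<in> S \<Longrightarrow> t \<in> S \<Longrightarrow> sym_diff s t \<in> S"
  by (auto simp: sym_diff_def Sub_def)

lemma sym_diff_cancel: "s \<in> \<C> \<Longrightarrow> t \<in> \<C> \<Longrightarrow> sym_diff (sym_diff s t) t = s"
  "s \<in> \<C> \<Longrightarrow> t \<in> \<C> \<Longrightarrow> sym_diff s (sym_diff s t) = t"
  by (auto simp: sym_diff_def eq_iff_valuations)

text \<open>
  Modulo the ideal of elements below \<open>a\<close>, the subalgebra \<open>psub a\<close> reduces to \<open>{0, 1}\<close>.  So
  every element generated by \<open>psub a\<close> and \<open>Y\<close> agrees with an element of \<open>Y\<close> outside \<open>a\<close>, and the
  symmetric difference of the two lies below \<open>a\<close>.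
\<close>

lemma gen_psub_agrees:
  assumes a: "a \<in> \<C>" and Y: "Y \<in> Sub B" and t: "t \<in> gen B (psub B a \<union> Y)"
  shows "\<exists>y\<in>Y. sym_diff t y \<in> psub B a"
proof -
  define R where "R = {t \<in> \<C>. \<exists>y\<in>Y. t \<sqinter> \<sim> a = y \<sqinter> \<sim> a}"
  have YC: "\<And>y. y \<in> Y \<Longrightarrow> y \<in> \<C>" using SubD(7)[OF Y] .
  have "R \<in> Sub B"
  proof (intro SubI)
    show "R \<subseteq> \<C>" "\<zero> \<in> R" using SubD[OF Y] by (auto simp: R_def)
    show "\<sim> s \<in> R" if s: "s \<in> R" for s
    proof -
      obtain y where y: "y \<in> Y" "s \<sqinter> \<sim> a = y \<sqinter> \<sim> a" "s \<in> \<C>" using s by (auto simp: R_def)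
      have "v s \<longleftrightarrow> v y" if "valuation B v" "\<not> v a" for v
        using arg_cong[OF y(2), of v] that y(1,3) YC a by auto
      then have "\<sim> s \<sqinter> \<sim> a = \<sim> y \<sqinter> \<sim> a" using y YC a by (intro valuation_eqI) auto
      then show ?thesis using y SubD(4)[OF Y] by (auto simp: R_def)
    qed
    show "s \<squnion> t \<in> R" if st: "s \<in> R" "t \<in> R" for s t
    proof -
      obtain y z where y: "y \<in> Y" "s \<sqinter> \<sim> a = y \<sqinter> \<sim> a" "s \<in> \<C>" and z: "z \<in> Y" "t \<sqinter> \<sim> a = z \<sqinter> \<sim> a" "t \<in> \<C>"
        using st by (auto simp: R_def)
      have "(v s \<longleftrightarrow> v y) \<and> (v t \<longleftrightarrow> v z)" if "valuation B v" "\<not> v a" for v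
        using arg_cong[OF y(2), of v] arg_cong[OF z(2), of v] that y(1,3) z(1,3) YC a by auto
      then have "(s \<squnion> t) \<sqinter> \<sim> a = (y \<squnion> z) \<sqinter> \<sim> a" using y z YC a by (intro valuation_eqI) auto
      then show ?thesis using y z SubD(5)[OF Y] by (auto simp: R_def)
    qed
  qed
  moreover have "psub B a \<union> Y \<subseteq> R"
  proof
    fix s assume s: "s \<in> psub B a \<union> Y"
    show "s \<in> R"
    proof (cases "s \<in> Y")
      case True then show ?thesis using YC by (auto simp: R_def)
    next
      case False
      then have p: "s \<in> psub B a" using s by blast
      then have sC: "s \<in> \<C>" using psub_subset by blast
      have "(\<forall>v. valuation B v \<longrightarrow> v s \<longrightarrow> v a) \<or> (\<forall>v. valuation B v \<longrightarrow> v s \<or> v a)"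
        using p a by (simp add: mem_psub_iff)
      then have "s \<sqinter> \<sim> a = \<zero> \<sqinter> \<sim> a \<or> s \<sqinter> \<sim> a = \<one> \<sqinter> \<sim> a"
      proof
        assume "\<forall>v. valuation B v \<longrightarrow> v s \<longrightarrow> v a"
        then have "s \<sqinter> \<sim> a = \<zero> \<sqinter> \<sim> a" using sC a by (intro valuation_eqI) auto
        then show ?thesis ..
      next
        assume "\<forall>v. valuation B v \<longrightarrow> v s \<or> v a"
        then have "s \<sqinter> \<sim> a = \<one> \<sqinter> \<sim> a" using sC a by (intro valuation_eqI) auto
        then show ?thesis ..
      qed
      with sC show ?thesis using SubD(2,3)[OF Y] by (auto simp: R_def)
    qed
  qed
  ultimately have "t \<in> R" using t gen_least by blast
  then obtain y where y: "y \<in> Y" "t \<sqinter> \<sim> a = y \<sqinter> \<sim> a" "t \<in> \<C>" by (auto simp: R_def)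
  have "v t \<longleftrightarrow> v y" if "valuation B v" "\<not> v a" for v
    using arg_cong[OF y(2), of v] that y(1,3) YC a by auto
  then have "sym_diff t y \<sqinter> \<sim> a = \<zero>" using y YC a by (intro valuation_eqI) (auto simp: sym_diff_def)
  then show ?thesis using y YC by (auto simp: psub_def sym_diff_def)
qed

text \<open>
  Both modular laws follow from the decomposition above, because symmetric differences can be
  cancelled: if two of \<open>t\<close>, \<open>y\<close> and their symmetric difference lie in a subalgebra, so does the
  third.
\<close>

lemma psub_dual_modular:
  assumes a: "a \<in> \<C>"
  shows "sub_dual_modular B (psub B a)"
  unfolding sub_dual_modular_def
proof (intro conjI ballI impI)
  note aS = psub_in_Sub[OF a]
  show "psub B a \<in> Sub B" by (rule aS)
  { fix Y Z assume Y: "Y \<in> Sub B" and Z: "Z \<in> Sub B" and aZ: "psub B a \<subseteq> Z"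
    have sub: "psub B a \<union> (Y \<inter> Z) \<subseteq> \<C>" using SubD(1)[OF Y] psub_subset by blast
    note gS = gen_in_Sub[OF sub]
    show "gen B (psub B a \<union> Y) \<inter> Z = gen B (psub B a \<union> (Y \<inter> Z))"
    proof
      show "gen B (psub B a \<union> Y) \<inter> Z \<subseteq> gen B (psub B a \<union> (Y \<inter> Z))"
      proof
        fix t assume t: "t \<in> gen B (psub B a \<union> Y) \<inter> Z"
        then obtain y where y: "y \<in> Y" "sym_diff t y \<in> psub B a" using gen_psub_agrees[OF a Y] by blast
        have tC: "t \<in> \<C>" "y \<in> \<C>" using t y(1) SubD(1)[OF Z] SubD(1)[OF Y] by blast+
        have tZ: "t \<in> Z" "sym_diff t y \<in> Z" using t y(2) aZ by blast+
        have "sym_diff t (sym_diff t y) \<in> Z" by (rule sym_diff_closed[OF Z tZ])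
        then have "y \<in> gen B (psub B a \<union> (Y \<inter> Z))" "sym_diff t y \<in> gen B (psub B a \<union> (Y \<inter> Z))"
          using sym_diff_cancel(2)[OF tC] y subset_gen[of "psub B a \<union> (Y \<inter> Z)"] by auto
        then have "sym_diff (sym_diff t y) y \<in> gen B (psub B a \<union> (Y \<inter> Z))"
          by (rule sym_diff_closed[OF gS, rotated])
        then show "t \<in> gen B (psub B a \<union> (Y \<inter> Z))" using sym_diff_cancel tC by simp
      qed
      show "gen B (psub B a \<union> (Y \<inter> Z)) \<subseteq> gen B (psub B a \<union> Y) \<inter> Z"
        using aZ by (intro Int_greatest gen_mono gen_least[OF Z]) auto
    qed }
  { fix W Y assume W: "W \<in> Sub B" and Y: "Y \<in> Sub B" and WY: "W \<subseteq> Y"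
    have sub: "W \<union> (psub B a \<inter> Y) \<subseteq> \<C>" using SubD(1)[OF W] psub_subset by blast
    note gS = gen_in_Sub[OF sub]
    show "gen B (W \<union> psub B a) \<inter> Y = gen B (W \<union> (psub B a \<inter> Y))"
    proof
      show "gen B (W \<union> psub B a) \<inter> Y \<subseteq> gen B (W \<union> (psub B a \<inter> Y))"
      proof
        fix t assume t: "t \<in> gen B (W \<union> psub B a) \<inter> Y"
        then obtain w where w: "w \<in> W" "sym_diff t w \<in> psub B a"
          using gen_psub_agrees[OF a W] by (metis Int_iff Un_commute)
        have tC: "t \<in> \<C>" "w \<in> \<C>" using t w(1) SubD(1)[OF W] SubD(1)[OF Y] by blast+
        have "t \<in> Y" "w \<in> Y" using t w(1) WY by blast+
        then have "sym_diff t w \<in> Y" by (rule sym_diff_closed[OF Y])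
        then have "sym_diff (sym_diff t w) w \<in> gen B (W \<union> (psub B a \<inter> Y))"
          using sym_diff_closed[OF gS] w subset_gen[of "W \<union> (psub B a \<inter> Y)"] by blast
        then show "t \<in> gen B (W \<union> (psub B a \<inter> Y))" using sym_diff_cancel tC by simp
      qed
      show "gen B (W \<union> (psub B a \<inter> Y)) \<subseteq> gen B (W \<union> psub B a) \<inter> Y"
        using WY by (intro Int_greatest gen_mono gen_least[OF Y]) auto
    qed }
qed

text \<open>
  Up to complement, an element of \<open>psub a\<close> outside \<open>four a\<close> lies strictly between \<open>0\<close> and \<open>a\<close>.
\<close>

lemma psub_not_four:
  assumes a: "a \<in> \<C>" and ne: "psub B a \<noteq> four B a"
  shows "\<exists>b\<in>\<C>. b \<sqinter> a = b \<and> b \<noteq> \<zero> \<and> b \<noteq> a"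
proof -
  obtain t where t: "t \<in> psub B a" "t \<notin> four B a" using ne four_subset_psub[OF a] by blast
  have tC: "t \<in> \<C>" using t psub_subset by blast
  have nt: "t \<noteq> \<zero>" "t \<noteq> a" "\<sim> t \<noteq> \<zero>" "\<sim> t \<noteq> a"
    using t(2) compl_compl[OF tC] compl_zero by (auto simp: four_def)
  have "(\<forall>v. valuation B v \<longrightarrow> v t \<longrightarrow> v a) \<or> (\<forall>v. valuation B v \<longrightarrow> v t \<or> v a)"
    using t(1) a by (simp add: mem_psub_iff)
  then have "t \<sqinter> a = t \<or> \<sim> t \<sqinter> a = \<sim> t"
  proof
    assume "\<forall>v. valuation B v \<longrightarrow> v t \<longrightarrow> v a"
    then have "t \<sqinter> a = t" using tC a by (intro valuation_eqI) auto
    then show ?thesis ..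
  next
    assume "\<forall>v. valuation B v \<longrightarrow> v t \<or> v a"
    then have "\<sim> t \<sqinter> a = \<sim> t" using tC a by (intro valuation_eqI) auto
    then show ?thesis ..
  qed
  then show ?thesis using nt tC compl_closed by metis
qed

text \<open>
  If \<open>0 < b < a\<close> and \<open>0 < c < a'\<close>, the modular law fails for \<open>x = four a\<close> with
  \<open>Y = four (b \<squnion> c)\<close> and \<open>Z = psub a\<close>: the subalgebras \<open>Y\<close> and \<open>Z\<close> meet in \<open>{0, 1}\<close>, but
  \<open>b = (b \<squnion> c) \<sqinter> a\<close> lies in \<open>Z\<close> and is generated by \<open>four a\<close> and \<open>Y\<close>.
\<close>

lemma dual_modular_four:
  assumes a: "a \<in> \<C>" and dm: "sub_dual_modular B (four B a)"
  shows "psub B a = four B a \<or> psub B (\<sim> a) = four B a"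
proof (rule ccontr)
  assume "\<not> ?thesis"
  then have ne: "psub B a \<noteq> four B a" "psub B (\<sim> a) \<noteq> four B (\<sim> a)" using four_compl a by auto
  obtain b c where b: "b \<in> \<C>" "b \<sqinter> a = b" "b \<noteq> \<zero>" "b \<noteq> a"
    and c: "c \<in> \<C>" "c \<sqinter> \<sim> a = c" "c \<noteq> \<zero>" "c \<noteq> \<sim> a"
    using psub_not_four[OF a ne(1)] psub_not_four[OF _ ne(2)] a by auto
  let ?d = "b \<squnion> c"
  have ba: "v b \<longrightarrow> v a" "v c \<longrightarrow> \<not> v a" if "valuation B v" for v
    using arg_cong[OF b(2), of v] arg_cong[OF c(2), of v] that a b(1) c(1) by auto
  have d: "?d \<in> \<C>" using b c by simp
  have dS: "four B ?d \<in> Sub B" using four_in_Sub[OF d] .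
  have "?d \<notin> psub B a"
  proof
    assume "?d \<in> psub B a"
    then consider "\<forall>v. valuation B v \<longrightarrow> v ?d \<longrightarrow> v a" | "\<forall>v. valuation B v \<longrightarrow> v ?d \<or> v a"
      using a by (auto simp: mem_psub_iff)
    then show False
    proof cases
      case 1
      then have "\<not> v c" if "valuation B v" for v using that ba[OF that] b c by auto
      then have "c = \<zero>" using c by (intro valuation_eqI) auto
      then show False using c by simp
    next
      case 2
      then have "v c \<longleftrightarrow> v (\<sim> a)" if "valuation B v" for v using that ba[OF that] a b c by auto
      then have "c = \<sim> a" using a c by (intro valuation_eqI) auto
      then show False using c by simp
    qed
  qed
  then have "four B ?d \<inter> psub B a \<noteq> four B ?d" using mem_four by blast
  then have "four B ?d \<inter> psub B a = {\<zero>, \<one>}"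
    using Sub_of_four[OF Int_in_Sub[OF dS psub_in_Sub[OF a]] _ d] by blast
  then have "gen B (four B a \<union> (four B ?d \<inter> psub B a)) = gen B (four B a)"
    by (simp add: four_def insert_absorb)
  also have "\<dots> = four B a" using gen_Sub four_in_Sub a by blast
  finally have e: "gen B (four B a \<union> four B ?d) \<inter> psub B a = four B a"
    using dm dS psub_in_Sub[OF a] four_subset_psub[OF a] unfolding sub_dual_modular_def by auto
  have G: "gen B (four B a \<union> four B ?d) \<in> Sub B"
    using gen_in_Sub[of "four B a \<union> four B ?d"] SubD(1)[OF dS] SubD(1)[OF four_in_Sub[OF a]] by auto
  have "?d \<sqinter> a \<in> gen B (four B a \<union> four B ?d)"
    using SubD(6)[OF G] subset_gen[of "four B a \<union> four B ?d"] mem_four by blast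
  moreover have "?d \<sqinter> a = b" using a b(1) c(1) ba by (intro valuation_eqI) auto
  moreover have "b \<in> psub B a" using a b(1) ba by (auto simp: mem_psub_iff)
  ultimately have "b \<in> four B a" using e by auto
  then have "b = \<one> \<or> b = \<sim> a" using b by (auto simp: four_def)
  then have "\<forall>v. valuation B v \<longrightarrow> v a" using ba(1) a by (metis valuation_simps(2,3))
  then have "\<sim> a = \<zero>" using a by (intro valuation_eqI) auto
  then show False using c meet_zero[OF c(1)] by simp
qed

text \<open>
  Since \<open>Y\<close> covers \<open>four a\<close>, its intersections with \<open>psub a\<close> and \<open>psub a'\<close> are each
  \<open>four a\<close> or \<open>Y\<close>.  They are not both \<open>four a\<close>, because every element is the join of its parts below
  \<open>a\<close> and \<open>a'\<close>.  So \<open>Y\<close> is contained in one of the two proper subalgebras, and equals it as \<open>Y\<close>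
  is covered by the whole algebra.
\<close>

lemma Sub_between_four:
  assumes a: "a \<in> \<C>" and Y: "Y \<in> Sub B" and sub: "four B a \<subset> Y" "Y \<subset> \<C>"
    and ne: "psub B a \<noteq> four B a" "psub B (\<sim> a) \<noteq> four B a"
    and short: "\<And>Y Z. Y \<in> Sub B \<Longrightarrow> Z \<in> Sub B \<Longrightarrow> four B a \<subset> Y \<Longrightarrow> Y \<subset> Z \<Longrightarrow> Z \<subset> \<C> \<Longrightarrow> False"
  shows "Y = psub B a \<or> Y = psub B (\<sim> a)"
proof -
  have ca: "\<sim> a \<in> \<C>" using a by simp
  have ne2: "psub B a \<noteq> \<C>" "psub B (\<sim> a) \<noteq> \<C>"
    using ne psub_Int_psub_compl[OF a] psub_subset by blast+
  have cover: "Y \<inter> psub B b = four B a \<or> Y \<inter> psub B b = Y" if b: "b = a \<or> b = \<sim> a" for b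
  proof (rule ccontr)
    have "Y \<inter> psub B b \<in> Sub B" using b psub_in_Sub a ca Int_in_Sub Y by blast
    moreover assume "\<not> ?thesis"
    moreover have "four B a \<subseteq> Y \<inter> psub B b"
      using b sub four_subset_psub[OF a] four_subset_psub[OF ca] four_compl[OF a] by auto
    ultimately show False using short[OF _ Y] sub by blast
  qed
  have "Y \<inter> psub B a = Y \<or> Y \<inter> psub B (\<sim> a) = Y"
  proof (rule ccontr)
    assume "\<not> ?thesis"
    then have e: "Y \<inter> psub B a = four B a" "Y \<inter> psub B (\<sim> a) = four B a" using cover by blast+
    have "t \<in> four B a" if t: "t \<in> Y" for t
    proof -
      have tC: "t \<in> \<C>" using t SubD(7)[OF Y] by simp
      have aY: "a \<in> Y" "\<sim> a \<in> Y" using sub mem_four SubD(4)[OF Y] by blast+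
      have "t \<sqinter> a \<in> Y" "t \<sqinter> \<sim> a \<in> Y" using SubD(6)[OF Y] t aY by auto
      moreover have "t \<sqinter> a \<in> psub B a" "t \<sqinter> \<sim> a \<in> psub B (\<sim> a)"
        using tC a by (auto simp: psub_def eq_iff_valuations)
      ultimately have "t \<sqinter> a \<in> four B a" "t \<sqinter> \<sim> a \<in> four B a" using e by auto
      then have "(t \<sqinter> a) \<squnion> (t \<sqinter> \<sim> a) \<in> four B a" using SubD(5)[OF four_in_Sub[OF a]] by blast
      moreover have "(t \<sqinter> a) \<squnion> (t \<sqinter> \<sim> a) = t" using tC a by (auto simp: eq_iff_valuations)
      ultimately show ?thesis by simp
    qed
    then show False using sub by blast
  qed
  then show ?thesis
    using short[OF Y psub_in_Sub[OF a]] short[OF Y psub_in_Sub[OF ca]] sub ne2 psub_subset by blast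
qed

lemma joins_of_in_Sub:
  assumes F: "partition_of_unity B F"
  shows "joins_of B F \<in> Sub B"
proof (intro SubI)
  show "joins_of B F \<subseteq> \<C>" by (auto simp: joins_of_def)
  show "\<zero> \<in> joins_of B F" by (auto simp: joins_of_def intro: exI[of _ "{}"])
  show "\<sim> s \<in> joins_of B F" if s: "s \<in> joins_of B F" for s
  proof -
    obtain G where G: "G \<subseteq> F" "\<forall>v. valuation B v \<longrightarrow> (v s \<longleftrightarrow> (\<exists>f\<in>G. v f))" "s \<in> \<C>"
      using s by (auto simp: joins_of_def)
    have "v (\<sim> s) \<longleftrightarrow> (\<exists>f\<in>F - G. v f)" if v: "valuation B v" for v
    proof -
      have "\<exists>!f. f \<in> F \<and> v f" using F v by (auto simp: partition_of_unity_def)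
      then have "(\<exists>f\<in>F - G. v f) \<longleftrightarrow> \<not> (\<exists>f\<in>G. v f)" using G(1) by blast
      then show ?thesis using G v by simp
    qed
    then show ?thesis using G(3) by (auto simp: joins_of_def intro!: exI[of _ "F - G"])
  qed
  show "s \<squnion> t \<in> joins_of B F" if st: "s \<in> joins_of B F" "t \<in> joins_of B F" for s t
  proof -
    obtain G H where G: "G \<subseteq> F" "\<forall>v. valuation B v \<longrightarrow> (v s \<longleftrightarrow> (\<exists>f\<in>G. v f))" "s \<in> \<C>"
      and H: "H \<subseteq> F" "\<forall>v. valuation B v \<longrightarrow> (v t \<longleftrightarrow> (\<exists>f\<in>H. v f))" "t \<in> \<C>"
      using st by (auto simp: joins_of_def)
    have "\<forall>v. valuation B v \<longrightarrow> (v (s \<squnion> t) \<longleftrightarrow> (\<exists>f\<in>G \<union> H. v f))" using G H by auto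
    then show ?thesis using G H unfolding joins_of_def by (intro CollectI conjI exI[of _ "G \<union> H"]) auto
  qed
qed

lemma mem_joins_of: "F \<subseteq> \<C> \<Longrightarrow> f \<in> F \<Longrightarrow> f \<in> joins_of B F"
  by (auto simp: joins_of_def intro!: exI[of _ "{f}"])

text \<open>
  Every member of \<open>joins_of B F\<close> is reached from \<open>0\<close> by successive orthogonal joins with members of
  \<open>F\<close>.  Hence sets closed only under orthogonal sums can be shown to contain it.
\<close>

lemma joins_of_induct [consumes 2, case_names zero join]:
  assumes F: "partition_of_unity B F" and s: "s \<in> joins_of B F"
    and zero: "P \<zero>" and join: "\<And>f s. f \<in> F \<Longrightarrow> s \<in> \<C> \<Longrightarrow> P s \<Longrightarrow> f \<sqinter> s = \<zero> \<Longrightarrow> P (f \<squnion> s)"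
  shows "P s"
proof -
  have FC: "finite F" "F \<subseteq> \<C>" and ex1: "\<And>v. valuation B v \<Longrightarrow> \<exists>!f. f \<in> F \<and> v f"
    using F by (auto simp: partition_of_unity_def)
  have *: "\<exists>s\<in>\<C>. P s \<and> (\<forall>v. valuation B v \<longrightarrow> (v s \<longleftrightarrow> (\<exists>f\<in>G. v f)))"
    if "finite G" "G \<subseteq> F" for G
    using that
  proof (induction G rule: finite_induct)
    case empty
    then show ?case using zero by (intro bexI[of _ \<zero>]) auto
  next
    case (insert f G)
    then obtain s where s: "s \<in> \<C>" "P s" "\<forall>v. valuation B v \<longrightarrow> (v s \<longleftrightarrow> (\<exists>f\<in>G. v f))" by auto
    have f: "f \<in> F" "f \<in> \<C>" using insert FC by auto
    have "\<not> (v f \<and> v s)" if v: "valuation B v" for v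
      using ex1[OF v] s(3) v insert.hyps(2) insert.prems by blast
    then have "f \<sqinter> s = \<zero>" using f s by (auto simp: eq_iff_valuations)
    then show ?case using join[OF f(1) s(1,2)] s f by (intro bexI[of _ "f \<squnion> s"]) auto
  qed
  obtain G where G: "G \<subseteq> F" "\<forall>v. valuation B v \<longrightarrow> (v s \<longleftrightarrow> (\<exists>f\<in>G. v f))" "s \<in> \<C>"
    using s by (auto simp: joins_of_def)
  obtain s' where s': "s' \<in> \<C>" "P s'" "\<forall>v. valuation B v \<longrightarrow> (v s' \<longleftrightarrow> (\<exists>f\<in>G. v f))"
    using *[OF finite_subset[OF G(1) FC(1)] G(1)] by blast
  have "s = s'" using G s' by (auto simp: eq_iff_valuations)
  then show ?thesis using s' by simp
qed

lemma card_joins_of: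
  assumes F: "finite F"
  shows "finite (joins_of B F)" "card (joins_of B F) \<le> 2 ^ card F"
proof -
  define h where "h G = (THE s. s \<in> \<C> \<and> (\<forall>v. valuation B v \<longrightarrow> (v s \<longleftrightarrow> (\<exists>f\<in>G. v f))))" for G
  have "joins_of B F \<subseteq> h ` Pow F"
  proof
    fix s assume "s \<in> joins_of B F"
    then obtain G where G: "G \<subseteq> F" "\<forall>v. valuation B v \<longrightarrow> (v s \<longleftrightarrow> (\<exists>f\<in>G. v f))" "s \<in> \<C>"
      by (auto simp: joins_of_def)
    then have "h G = s" unfolding h_def by (intro the_equality) (auto simp: eq_iff_valuations)
    then show "s \<in> h ` Pow F" using G by blast
  qed
  moreover have "finite (h ` Pow F)" using F by simp
  moreover have "card (h ` Pow F) \<le> 2 ^ card F" using card_image_le[of "Pow F" h] F by (simp add: card_Pow)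
  ultimately show "finite (joins_of B F)" "card (joins_of B F) \<le> 2 ^ card F"
    using finite_subset card_mono le_trans by metis+
qed

text \<open>
  The translate of \<open>S\<close> by some \<open>t \<notin> S\<close> under symmetric difference is disjoint from \<open>S\<close>, as for
  cosets of a subgroup.
\<close>

lemma card_Sub_less:
  assumes S: "S \<in> Sub B" and T: "T \<in> Sub B" "S \<subset> T" "finite T"
  shows "2 * card S \<le> card T"
proof -
  obtain t where t: "t \<in> T" "t \<notin> S" using T by blast
  have fin: "finite S" using T finite_subset by blast
  have C: "\<And>s. s \<in> S \<Longrightarrow> s \<in> \<C>" "t \<in> \<C>" using SubD(7)[OF S] SubD(7)[OF T(1)] t by auto
  have "inj_on (sym_diff t) S"
    using C sym_diff_cancel(2) by (intro inj_on_inverseI[of _ "sym_diff t"]) auto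
  then have c: "card (sym_diff t ` S) = card S" by (rule card_image)
  have "S \<inter> sym_diff t ` S = {}"
  proof (rule ccontr)
    assume "S \<inter> sym_diff t ` S \<noteq> {}"
    then obtain s where s: "s \<in> S" "sym_diff t s \<in> S" by blast
    then have "sym_diff (sym_diff t s) s \<in> S" using sym_diff_closed[OF S] by blast
    then show False using t s C sym_diff_cancel by simp
  qed
  then have "card (S \<union> sym_diff t ` S) = 2 * card S" using c fin by (simp add: card_Un_disjoint)
  moreover have "S \<union> sym_diff t ` S \<subseteq> T" using T t sym_diff_closed[OF T(1)] by blast
  ultimately show ?thesis using card_mono[OF T(3)] by metis
qed

end

section \<open>Height\<close>

lemma height_le_iff:
  "height X x \<le> enat n \<longleftrightarrow>
     (\<forall>C\<subseteq>down_in X x. Complete_Partial_Order.chain (\<le>) C \<longrightarrow> finite C \<longrightarrow> card C \<le> Suc n)"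
proof -
  have "height X x \<le> enat n \<longleftrightarrow> (\<forall>m C. C \<subseteq> down_in X x \<and> Complete_Partial_Order.chain (\<le>) C
      \<and> finite C \<and> card C = Suc m \<longrightarrow> m \<le> n)"
  proof (intro iffI allI impI)
    fix m C assume "height X x \<le> enat n" and C: "C \<subseteq> down_in X x \<and> Complete_Partial_Order.chain (\<le>) C
      \<and> finite C \<and> card C = Suc m"
    moreover from C have "enat m \<le> height X x" unfolding height_def by (intro Sup_upper) blast
    ultimately show "m \<le> n" by (metis enat_ord_simps(1) order.trans)
  next
    assume "\<forall>m C. C \<subseteq> down_in X x \<and> Complete_Partial_Order.chain (\<le>) C
      \<and> finite C \<and> card C = Suc m \<longrightarrow> m \<le> n"
    then have "m \<le> n" if "C \<subseteq> down_in X x" "Complete_Partial_Order.chain (\<le>) C" "finite C" "card C = Suc m"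
      for m C using that by blast
    then show "height X x \<le> enat n" unfolding height_def by (intro Sup_least) auto
  qed
  also have "\<dots> \<longleftrightarrow> (\<forall>C\<subseteq>down_in X x. Complete_Partial_Order.chain (\<le>) C \<longrightarrow> finite C \<longrightarrow> card C \<le> Suc n)"
  proof (intro iffI allI impI; (elim conjE)?)
    fix C assume r: "\<forall>m C. C \<subseteq> down_in X x \<and> Complete_Partial_Order.chain (\<le>) C
      \<and> finite C \<and> card C = Suc m \<longrightarrow> m \<le> n"
      and C: "C \<subseteq> down_in X x" "Complete_Partial_Order.chain (\<le>) C" "finite C"
    show "card C \<le> Suc n"
    proof (cases "card C")
      case (Suc m)
      then have "m \<le> n" using r C by blast
      then show ?thesis using Suc by simp
    qed simp
  next
    fix m C assume "\<forall>C\<subseteq>down_in X x. Complete_Partial_Order.chain (\<le>) C \<longrightarrow> finite C \<longrightarrow> card C \<le> Suc n"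
      and "C \<subseteq> down_in X x" "Complete_Partial_Order.chain (\<le>) C" "finite C" "card C = Suc m"
    then have "card C \<le> Suc n" by blast
    then show "m \<le> n" using \<open>card C = Suc m\<close> by simp
  qed
  finally show ?thesis .
qed

lemma height_le_three_iff:
  "height X x \<le> 3 \<longleftrightarrow>
     (\<forall>C\<subseteq>down_in X x. Complete_Partial_Order.chain (\<le>) C \<longrightarrow> finite C \<longrightarrow> card C \<le> 4)"
  using height_le_iff[of X x 3] by (simp add: numeral_eq_enat)

lemma height_le_three_no_chain:
  assumes h: "height X x \<le> 3" and "{a, b, c, d, e} \<subseteq> down_in X x"
    and lt: "a < b" "b < c" "c < d" "d < e"
  shows False
proof -
  have all: "a < b" "a < c" "a < d" "a < e" "b < c" "b < d" "b < e" "c < d" "c < e" "d < e"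
    using lt by auto
  then have "a \<noteq> b" "a \<noteq> c" "a \<noteq> d" "a \<noteq> e" "b \<noteq> c" "b \<noteq> d" "b \<noteq> e" "c \<noteq> d" "c \<noteq> e" "d \<noteq> e"
    by auto
  then have "card {a, b, c, d, e} = 5" by simp
  moreover have "Complete_Partial_Order.chain (\<le>) {a, b, c, d, e}"
    unfolding chain_def using all by (auto intro: less_imp_le)
  moreover have "finite {a, b, c, d, e}" by simp
  ultimately have "(5::nat) \<le> 4" using h assms(2) unfolding height_le_three_iff by metis
  then show False by simp
qed

lemma height_iso:
  assumes bij: "bij_betw f (down_in X x) (down_in Y y)"
    and ord: "\<And>a b. a \<in> down_in X x \<Longrightarrow> b \<in> down_in X x \<Longrightarrow> a \<le> b \<longleftrightarrow> f a \<le> f b"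
  shows "height X x = height Y y"
proof -
  have inj: "inj_on f (down_in X x)" and im: "f ` down_in X x = down_in Y y"
    using bij by (auto simp: bij_betw_def)

  have "(\<exists>C. C \<subseteq> down_in X x \<and> Complete_Partial_Order.chain (\<le>) C \<and> finite C \<and> card C = Suc n)
     \<longleftrightarrow> (\<exists>C. C \<subseteq> down_in Y y \<and> Complete_Partial_Order.chain (\<le>) C \<and> finite C \<and> card C = Suc n)" for n
  proof (intro iffI; elim exE conjE)
    fix C assume C: "C \<subseteq> down_in X x" "Complete_Partial_Order.chain (\<le>) C" "finite C" "card C = Suc n"
    have "f a \<le> f b \<or> f b \<le> f a" if "a \<in> C" "b \<in> C" for a b
      using chainD[OF C(2) that] ord[of a b] ord[of b a] that C(1) by blast
    then have "Complete_Partial_Order.chain (\<le>) (f ` C)" by (auto simp: chain_def)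
    moreover have "card (f ` C) = Suc n" using C inj by (metis card_image inj_on_subset)
    ultimately show "\<exists>C. C \<subseteq> down_in Y y \<and> Complete_Partial_Order.chain (\<le>) C \<and> finite C \<and> card C = Suc n"
      using C im by (intro exI[of _ "f ` C"]) auto
  next
    fix C assume C: "C \<subseteq> down_in Y y" "Complete_Partial_Order.chain (\<le>) C" "finite C" "card C = Suc n"
    define D where "D = {a \<in> down_in X x. f a \<in> C}"
    have fD: "f ` D = C" using C(1) im by (auto simp: D_def)
    have iD: "inj_on f D" using inj by (rule inj_on_subset) (auto simp: D_def)
    have "a \<le> b \<or> b \<le> a" if "a \<in> D" "b \<in> D" for a b
      using chainD[OF C(2), of "f a" "f b"] ord[of a b] ord[of b a] that by (simp add: D_def)
    then have "Complete_Partial_Order.chain (\<le>) D" by (simp add: chain_def)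
    moreover have "finite D" using C(3) fD iD finite_imageD by metis
    moreover have "card D = Suc n" using C(4) fD iD card_image by metis
    ultimately show "\<exists>C. C \<subseteq> down_in X x \<and> Complete_Partial_Order.chain (\<le>) C \<and> finite C \<and> card C = Suc n"
      by (intro exI[of _ D]) (auto simp: D_def)
  qed
  then show ?thesis unfolding height_def by simp
qed

lemma height_mono:
  assumes "x \<le> y"
  shows "height X x \<le> height X y"
proof -
  have "down_in X x \<subseteq> down_in X y" using assms by (auto simp: down_in_def)
  then show ?thesis unfolding height_def by (intro Sup_subset_mono) blast
qed

section \<open>Principal pairs\<close>

lemma is_lub_unique: "is_lub X S u \<Longrightarrow> is_lub X S v \<Longrightarrow> u = v"
  by (auto simp: is_lub_def intro: order.antisym)

lemma is_glb_unique: "is_glb X S u \<Longrightarrow> is_glb X S v \<Longrightarrow> u = v"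
  by (auto simp: is_glb_def intro: order.antisym)

lemma is_least_unique: "is_least X b \<Longrightarrow> is_least X c \<Longrightarrow> b = c"
  by (auto simp: is_least_def intro: order.antisym)

lemma join_in_eq: "is_lub X {x, y} u \<Longrightarrow> join_in X x y = u"
  unfolding join_in_def using is_lub_unique by blast

lemma meet_in_eq: "is_glb X {x, y} u \<Longrightarrow> meet_in X x y = u"
  unfolding meet_in_def using is_glb_unique by blast

lemma bot_of_eq: "is_least X b \<Longrightarrow> bot_of X = b"
  unfolding bot_of_def using is_least_unique by blast

text \<open>
  A chart identifies a poset \<open>L\<close> with \<open>Sub B\<close>.  It serves both for the intervals
  \<open>\<down>w\<close> of an orthodomain and for the Boolean subalgebras below a given one.
\<close>

locale boolean_chart = boolalg B for B :: "'b boolalg" +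
  fixes L :: "'x::order set" and g :: "'x \<Rightarrow> 'b set"
  assumes bij: "bij_betw g L (Sub B)"
    and le_iff: "x \<in> L \<Longrightarrow> y \<in> L \<Longrightarrow> x \<le> y \<longleftrightarrow> g x \<subseteq> g y"
begin

abbreviation pt :: "'b set \<Rightarrow> 'x" where "pt \<equiv> inv_into L g"

lemma g_Sub: "x \<in> L \<Longrightarrow> g x \<in> Sub B"
  using bij bij_betwE by blast

lemma pt_in: "S \<in> Sub B \<Longrightarrow> pt S \<in> L"
  using bij by (auto simp: bij_betw_def inv_into_into)

lemma g_pt: "S \<in> Sub B \<Longrightarrow> g (pt S) = S"
  using bij by (auto simp: bij_betw_def f_inv_into_f)

lemma pt_g: "x \<in> L \<Longrightarrow> pt (g x) = x"
  using bij by (auto simp: bij_betw_def inv_into_f_f)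

lemma g_eq_iff: "x \<in> L \<Longrightarrow> y \<in> L \<Longrightarrow> g x = g y \<longleftrightarrow> x = y"
  using bij by (auto simp: bij_betw_def inj_on_def)

lemma less_iff: "x \<in> L \<Longrightarrow> y \<in> L \<Longrightarrow> x < y \<longleftrightarrow> g x \<subset> g y"
  using le_iff[of x y] le_iff[of y x] by (auto simp: less_le_not_le)

lemma is_glb_iff:
  assumes "x \<in> L" "y \<in> L"
  shows "is_glb L {x, y} u \<longleftrightarrow> u \<in> L \<and> g u = g x \<inter> g y"
proof -
  have S: "g x \<inter> g y \<in> Sub B" using assms g_Sub Int_in_Sub by blast
  have u: "is_glb L {x, y} (pt (g x \<inter> g y))"
    unfolding is_glb_def using assms pt_in[OF S] by (auto simp: le_iff g_pt[OF S])
  show ?thesis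
  proof
    assume "is_glb L {x, y} u"
    then have "u = pt (g x \<inter> g y)" using u is_glb_unique by blast
    then show "u \<in> L \<and> g u = g x \<inter> g y" using pt_in[OF S] g_pt[OF S] by simp
  next
    assume "u \<in> L \<and> g u = g x \<inter> g y"
    then have "u = pt (g x \<inter> g y)" using pt_g by metis
    then show "is_glb L {x, y} u" using u by simp
  qed
qed

lemma is_lub_iff:
  assumes "x \<in> L" "y \<in> L"
  shows "is_lub L {x, y} u \<longleftrightarrow> u \<in> L \<and> g u = gen B (g x \<union> g y)"
proof -
  have "g x \<union> g y \<subseteq> \<C>" using assms g_Sub SubD(1) by blast
  note S = gen_in_Sub[OF this]
  have u: "is_lub L {x, y} (pt (gen B (g x \<union> g y)))"
    unfolding is_lub_def
  proof (intro conjI ballI impI)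
    show "pt (gen B (g x \<union> g y)) \<in> L" using pt_in[OF S] .
    show "s \<le> pt (gen B (g x \<union> g y))" if "s \<in> {x, y}" for s
      using that assms pt_in[OF S] subset_gen[of "g x \<union> g y"] by (auto simp: le_iff g_pt[OF S])
    show "pt (gen B (g x \<union> g y)) \<le> v" if "v \<in> L" "\<forall>s\<in>{x, y}. s \<le> v" for v
      using that assms pt_in[OF S] gen_least[OF g_Sub[OF that(1)]] by (simp add: le_iff g_pt[OF S])
  qed
  show ?thesis
  proof
    assume "is_lub L {x, y} u"
    then have "u = pt (gen B (g x \<union> g y))" using u is_lub_unique by blast
    then show "u \<in> L \<and> g u = gen B (g x \<union> g y)" using pt_in[OF S] g_pt[OF S] by simp
  next
    assume "u \<in> L \<and> g u = gen B (g x \<union> g y)"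
    then have "u = pt (gen B (g x \<union> g y))" using pt_g by metis
    then show "is_lub L {x, y} u" using u by simp
  qed
qed

lemma meet_in:
  assumes "x \<in> L" "y \<in> L"
  shows "meet_in L x y \<in> L" "g (meet_in L x y) = g x \<inter> g y"
proof -
  have S: "g x \<inter> g y \<in> Sub B" using assms g_Sub Int_in_Sub by blast
  have "is_glb L {x, y} (pt (g x \<inter> g y))" using is_glb_iff[OF assms] pt_in[OF S] g_pt[OF S] by simp
  then have "is_glb L {x, y} (meet_in L x y)" using meet_in_eq by metis
  then show "meet_in L x y \<in> L" "g (meet_in L x y) = g x \<inter> g y" using is_glb_iff[OF assms] by auto
qed

lemma join_in:
  assumes "x \<in> L" "y \<in> L"
  shows "join_in L x y \<in> L" "g (join_in L x y) = gen B (g x \<union> g y)"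
proof -
  have "g x \<union> g y \<subseteq> \<C>" using assms g_Sub SubD(1) by blast
  note S = gen_in_Sub[OF this]
  have "is_lub L {x, y} (pt (gen B (g x \<union> g y)))" using is_lub_iff[OF assms] pt_in[OF S] g_pt[OF S] by simp
  then have "is_lub L {x, y} (join_in L x y)" using join_in_eq by metis
  then show "join_in L x y \<in> L" "g (join_in L x y) = gen B (g x \<union> g y)" using is_lub_iff[OF assms] by auto
qed

lemma dual_modular_iff: "dual_modular L x \<longleftrightarrow> x \<in> L \<and> sub_dual_modular B (g x)"
proof (cases "x \<in> L")
  case True
  have 1: "meet_in L (join_in L x y) z = join_in L x (meet_in L y z) \<longleftrightarrow>
      gen B (g x \<union> g y) \<inter> g z = gen B (g x \<union> (g y \<inter> g z))" if "y \<in> L" "z \<in> L" for y z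
    using True that by (subst g_eq_iff[symmetric]) (simp_all add: meet_in join_in)
  have 2: "meet_in L (join_in L w x) y = join_in L w (meet_in L x y) \<longleftrightarrow>
      gen B (g w \<union> g x) \<inter> g y = gen B (g w \<union> (g x \<inter> g y))" if "w \<in> L" "y \<in> L" for w y
    using True that by (subst g_eq_iff[symmetric]) (simp_all add: meet_in join_in)
  have im: "Sub B = g ` L" using bij by (auto simp: bij_betw_def)
  show ?thesis using True
    unfolding dual_modular_def sub_dual_modular_def im by (simp add: 1 2 le_iff)
qed (simp add: dual_modular_def)

lemma is_greatest_iff: "is_greatest L x \<longleftrightarrow> x \<in> L \<and> g x = \<C>"
proof
  assume x: "is_greatest L x"
  then have "g x \<in> Sub B" "\<C> \<subseteq> g x"
    using g_Sub pt_in[OF carrier_in_Sub] g_pt[OF carrier_in_Sub] le_iff[OF pt_in[OF carrier_in_Sub]]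
    by (auto simp: is_greatest_def)
  then show "x \<in> L \<and> g x = \<C>" using x SubD(1) by (auto simp: is_greatest_def)
next
  assume "x \<in> L \<and> g x = \<C>"
  then show "is_greatest L x" using le_iff g_Sub SubD(1) by (auto simp: is_greatest_def)
qed

lemma bottom_in_Sub: "{\<zero>, \<one>} \<in> Sub B"
  using four_in_Sub[OF zero_closed] by (simp add: four_zero)

lemma bottom_least: "S \<in> Sub B \<Longrightarrow> {\<zero>, \<one>} \<subseteq> S"
  using SubD(2,3) by auto

lemma is_least_iff: "is_least L x \<longleftrightarrow> x \<in> L \<and> g x = {\<zero>, \<one>}"
proof
  assume x: "is_least L x"
  then have "g x \<subseteq> {\<zero>, \<one>}"
    using pt_in[OF bottom_in_Sub] g_pt[OF bottom_in_Sub] le_iff[of x] by (auto simp: is_least_def)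
  then show "x \<in> L \<and> g x = {\<zero>, \<one>}"
    using x bottom_least[OF g_Sub[of x]] by (auto simp: is_least_def)
next
  assume "x \<in> L \<and> g x = {\<zero>, \<one>}"
  then show "is_least L x" using le_iff g_Sub bottom_least by (auto simp: is_least_def)
qed

lemma basic_iff: "basic L x \<longleftrightarrow> x \<in> L \<and> (\<exists>a\<in>\<C>. g x = four B a)"
proof
  assume "basic L x"
  then consider "is_least L x" | b where "is_least L b" "covers L b x"
    by (auto simp: basic_def is_atom_def)
  then show "x \<in> L \<and> (\<exists>a\<in>\<C>. g x = four B a)"
  proof cases
    case 1
    then have "x \<in> L \<and> g x = four B \<zero>" by (simp add: is_least_iff four_zero)
    then show ?thesis using zero_closed by blast
  next
    case 2
    then have x: "x \<in> L" "b \<in> L" "g b = {\<zero>, \<one>}" and lt: "b < x" and cov: "\<And>y. y \<in> L \<Longrightarrow> b < y \<Longrightarrow> \<not> y < x"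
      by (auto simp: covers_def is_least_iff)
    have "{\<zero>, \<one>} \<subset> g x" using lt x less_iff by metis
    then obtain a where a: "a \<in> g x" "a \<notin> {\<zero>, \<one>}" by blast
    have aC: "a \<in> \<C>" using a x g_Sub SubD(7) by blast
    have S: "four B a \<in> Sub B" using four_in_Sub aC by blast
    have "four B a \<subseteq> g x" using four_least[OF g_Sub[OF x(1)] a(1)] .
    moreover have "{\<zero>, \<one>} \<subset> four B a" using a by (auto simp: four_def)
    then have "b < pt (four B a)" using less_iff pt_in[OF S] g_pt[OF S] x by metis
    then have "\<not> four B a \<subset> g x" using cov[OF pt_in[OF S]] less_iff[OF pt_in[OF S] x(1)] g_pt[OF S] by metis
    ultimately show ?thesis using x aC by blast
  qed
next
  assume r: "x \<in> L \<and> (\<exists>a\<in>\<C>. g x = four B a)"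
  then obtain a where x: "x \<in> L" "a \<in> \<C>" "g x = four B a" by blast
  define b where "b = pt {\<zero>, \<one>}"
  have b: "b \<in> L" "g b = {\<zero>, \<one>}" "is_least L b"
    using pt_in[OF bottom_in_Sub] g_pt[OF bottom_in_Sub] by (auto simp: b_def is_least_iff)
  show "basic L x"
  proof (cases "is_least L x")
    case False
    then have "b < x" using b(3) x(1) is_least_def[of L b] b(3) by (metis order.not_eq_order_implies_strict)
    moreover have "\<not> (b < y \<and> y < x)" if y: "y \<in> L" for y
      using Sub_of_four[OF g_Sub[OF y] _ x(2)] x b y by (auto simp: less_iff)
    ultimately have "covers L b x" using b x by (auto simp: covers_def)
    then show ?thesis using b by (auto simp: basic_def is_atom_def)
  qed (simp add: basic_def)
qed

text \<open>
  If \<open>psub a = four a\<close> then \<open>psub a'\<close> is the whole algebra, which is one of the two degenerate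
  kinds of principal pair, and symmetrically.  Otherwise \<open>four a\<close> is not dual modular, and the pair
  is of the third kind because every element is the join of its parts below \<open>a\<close> and \<open>a'\<close>.
\<close>

lemma principal_pair_forI:
  assumes a: "a \<in> \<C>" and L: "x \<in> L" "y \<in> L" "z \<in> L"
    and g: "g x = four B a" "g y = psub B a" "g z = psub B (\<sim> a)"
  shows "principal_pair_for L x (y, z)"
proof -
  have ca: "\<sim> a \<in> \<C>" using a by simp
  have bx: "basic L x" using basic_iff a L g by blast
  have dm: "dual_modular L y" "dual_modular L z"
    using dual_modular_iff L g psub_dual_modular[OF a] psub_dual_modular[OF ca] by auto
  have m: "meet_in L y z = x"
    using g_eq_iff[OF meet_in(1)[OF L(2,3)] L(1)] meet_in(2)[OF L(2,3)] g psub_Int_psub_compl[OF a] by simp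
  have "is_greatest L y \<and> basic L z \<or> is_greatest L z \<and> basic L y \<or>
      is_greatest L (join_in L y z) \<and> basic L (meet_in L y z) \<and> \<not> dual_modular L (meet_in L y z)"
  proof (cases "psub B a = four B a \<or> psub B (\<sim> a) = four B a")
    case True
    then show ?thesis
    proof
      assume "psub B a = four B a"
      then have "is_greatest L z" "y = x"
        using psub_eq_four_imp_psub_compl[OF a] is_greatest_iff L g g_eq_iff[OF L(2,1)] by auto
      then show ?thesis using bx by auto
    next
      assume "psub B (\<sim> a) = four B a"
      then have "is_greatest L y" "z = x"
        using psub_eq_four_imp_psub_compl[OF ca] is_greatest_iff L g g_eq_iff[OF L(3,1)] four_compl[OF a]
        compl_compl[OF a] by auto
      then show ?thesis using bx by auto
    qed
  next
    case False
    then have "\<not> dual_modular L x" using dual_modular_iff g dual_modular_four[OF a] by auto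
    moreover have "\<C> \<subseteq> gen B (psub B a \<union> psub B (\<sim> a))"
    proof
      fix t assume t: "t \<in> \<C>"
      have G: "gen B (psub B a \<union> psub B (\<sim> a)) \<in> Sub B" by (rule gen_in_Sub) (use psub_subset in blast)
      have "t \<sqinter> a \<in> psub B a" "t \<sqinter> \<sim> a \<in> psub B (\<sim> a)" using t a by (auto simp: mem_psub_iff)
      then have "(t \<sqinter> a) \<squnion> (t \<sqinter> \<sim> a) \<in> gen B (psub B a \<union> psub B (\<sim> a))"
        using SubD(5)[OF G] subset_gen by blast
      moreover have "(t \<sqinter> a) \<squnion> (t \<sqinter> \<sim> a) = t" using t a by (intro valuation_eqI) auto
      ultimately show "t \<in> gen B (psub B a \<union> psub B (\<sim> a))" by simp
    qed
    then have "is_greatest L (join_in L y z)"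
      using is_greatest_iff join_in[OF L(2,3)] g SubD(1)[OF g_Sub[OF join_in(1)[OF L(2,3)]]] by auto
    ultimately show ?thesis using m bx by simp
  qed
  then show ?thesis using bx dm m by (simp add: principal_pair_for_def principal_pair_def)
qed

lemma bottom_principal_pair:
  assumes b: "is_least L b" and t: "is_greatest L t"
  shows "principal_pair_for L b (b, t)" "principal_pair_for L b (t, b)"
proof -
  have L: "b \<in> L" "t \<in> L" and g: "g b = {\<zero>, \<one>}" "g t = \<C>" using b t by (auto simp: is_least_iff is_greatest_iff)
  show "principal_pair_for L b (b, t)"
    using L g by (intro principal_pair_forI[of \<zero>]) (auto simp: four_zero psub_zero psub_one compl_zero)
  show "principal_pair_for L b (t, b)"
    using L g by (intro principal_pair_forI[of \<one>]) (auto simp: four_def psub_zero psub_one compl_one)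
qed

end

locale short_chart = boolean_chart +
  assumes no_chain: "\<lbrakk>S0 \<in> Sub B; S1 \<in> Sub B; S2 \<in> Sub B; S3 \<in> Sub B; S4 \<in> Sub B;
      S0 \<subset> S1; S1 \<subset> S2; S2 \<subset> S3; S3 \<subset> S4\<rbrakk> \<Longrightarrow> False"
begin

text \<open>
  The common basic element is \<open>four a\<close> for some \<open>a\<close>.  For a pair of the third kind, both
  components lie strictly between \<open>four a\<close> and the top; as \<open>{0, 1}\<close> lies strictly below \<open>four a\<close> and chains have
  at most four elements, the only candidates are \<open>psub a\<close> and \<open>psub a'\<close>.
\<close>

lemma principal_pair_forD:
  assumes pp: "principal_pair_for L x (y, z)"
  shows "\<exists>a\<in>\<C>. x \<in> L \<and> y \<in> L \<and> z \<in> L \<and> g x = four B a \<and> g y = psub B a \<and> g z = psub B (\<sim> a)"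
proof -
  have dm: "dual_modular L y" "dual_modular L z" and m: "meet_in L y z = x"
    and bx: "basic L x"
    and cases: "is_greatest L y \<and> basic L z \<or> is_greatest L z \<and> basic L y \<or>
      is_greatest L (join_in L y z) \<and> \<not> dual_modular L x"
    using pp by (auto simp: principal_pair_for_def principal_pair_def)
  have L: "y \<in> L" "z \<in> L" "x \<in> L" using dm bx by (auto simp: dual_modular_iff basic_iff)
  have gx: "g x = g y \<inter> g z" using meet_in(2)[OF L(1,2)] m by simp
  obtain a where a: "a \<in> \<C>" "g x = four B a" using bx basic_iff by blast
  have ca: "\<sim> a \<in> \<C>" using a by simp
  have "(g y = psub B a \<and> g z = psub B (\<sim> a)) \<or> (g y = psub B (\<sim> a) \<and> g z = psub B a)"
  proof (cases "dual_modular L x")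
    case True
    then have yz: "g y = \<C> \<and> g z = g x \<or> g z = \<C> \<and> g y = g x"
      using cases gx is_greatest_iff SubD(1)[OF g_Sub[OF L(1)]] SubD(1)[OF g_Sub[OF L(2)]] by auto
    have "psub B a = four B a \<or> psub B (\<sim> a) = four B a"
      using True dual_modular_iff a dual_modular_four by auto
    then show ?thesis
      using yz a psub_eq_four_imp_psub_compl[OF a(1)] psub_eq_four_imp_psub_compl[OF ca]
        four_compl compl_compl by auto
  next
    case False
    have ne: "psub B a \<noteq> four B a" "psub B (\<sim> a) \<noteq> four B a"
      using False dual_modular_iff L a psub_dual_modular[OF a(1)] psub_dual_modular[OF ca] by auto
    have nx: "g y \<noteq> four B a" "g z \<noteq> four B a"
      using False dm a g_eq_iff L by metis+
    have proper: "g y \<noteq> \<C>" "g z \<noteq> \<C>"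
      using gx a nx SubD(1)[OF g_Sub[OF L(1)]] SubD(1)[OF g_Sub[OF L(2)]] by auto
    have a0: "{\<zero>, \<one>} \<subset> four B a"
    proof -
      have "four B a \<noteq> {\<zero>, \<one>}"
      proof
        assume e: "four B a = {\<zero>, \<one>}"
        then have "a = \<zero> \<or> a = \<one>" using mem_four[of a] by auto
        then show False
        proof
          assume "a = \<zero>"
          then show False using ne(1) e by (simp add: psub_zero)
        next
          assume "a = \<one>"
          then show False using ne(2) e by (simp add: psub_zero compl_one)
        qed
      qed
      then show ?thesis by (auto simp: four_def)
    qed
    have short: "False" if "Y \<in> Sub B" "Z \<in> Sub B" "four B a \<subset> Y" "Y \<subset> Z" "Z \<subset> \<C>" for Y Z
      using no_chain[OF bottom_in_Sub four_in_Sub[OF a(1)] that(1,2) carrier_in_Sub a0 that(3-5)] .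
    have "g w = psub B a \<or> g w = psub B (\<sim> a)" if "w = y \<or> w = z" for w
    proof (rule Sub_between_four[OF a(1) _ _ _ ne short])
      show "g w \<in> Sub B" using that L g_Sub by auto
      show "four B a \<subset> g w" using that gx a(2) nx by blast
      show "g w \<subset> \<C>" using that proper SubD(1)[OF g_Sub[OF L(1)]] SubD(1)[OF g_Sub[OF L(2)]] by blast
    qed
    moreover have "g y \<noteq> g z" using gx nx(1) a(2) by blast
    ultimately show ?thesis by metis
  qed
  then show ?thesis
  proof
    assume "g y = psub B (\<sim> a) \<and> g z = psub B a"
    then show ?thesis using L a ca by (intro bexI[of _ "\<sim> a"]) (simp_all add: four_compl compl_compl)
  qed (use L a in blast)
qed

end

section \<open>Boolean subalgebras of an orthoalgebra\<close>

text \<open>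
  A Boolean algebra on \<open>S\<close> whose orthogonal joins are the sums of \<open>A\<close>.  The Boolean subalgebras of an
  orthoalgebra are the sets that carry one (\<open>BSub_iff\<close>).
\<close>

definition boolean_structure :: "'a orthoalg \<Rightarrow> 'a set \<Rightarrow> 'a boolalg \<Rightarrow> bool" where
  "boolean_structure A S B \<longleftrightarrow> boolalg B \<and> ba_carrier B = S \<and>
     ba_zero B = oa_zero A \<and> ba_one B = oa_one A \<and> (\<forall>a\<in>S. ba_compl B a = oa_compl A a) \<and>
     (\<forall>a\<in>S. \<forall>b\<in>S. oa_plus A a b = (if ba_meet B a b = ba_zero B then Some (ba_join B a b) else None))"

text \<open>
  This is \<open>psub B a\<close> for every Boolean structure \<open>B\<close> on \<open>S\<close>.  Since it refers to the orthoalgebra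
  only, different subalgebras can be compared; \<open>oa_four\<close> does the same for \<open>four B a\<close>.
\<close>

definition oa_psub :: "'a orthoalg \<Rightarrow> 'a set \<Rightarrow> 'a \<Rightarrow> 'a set" where
  "oa_psub A S a = {t \<in> S. oa_plus A t (oa_compl A a) \<noteq> None
                         \<or> oa_plus A (oa_compl A t) (oa_compl A a) \<noteq> None}"

definition oa_four :: "'a orthoalg \<Rightarrow> 'a \<Rightarrow> 'a set" where
  "oa_four A a = {oa_zero A, oa_one A, a, oa_compl A a}"

text \<open>
  Boolean subalgebras are produced in this way: as images of a Boolean algebra under an injective map
  that turns orthogonal joins into sums and other pairs into pairs without a sum.
\<close>

lemma boolean_structure_transport:
  assumes C: "boolalg C" and h: "inj_on h (ba_carrier C)"
    and h01: "h (ba_zero C) = oa_zero A" "h (ba_one C) = oa_one A"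
    and hc: "\<And>c. c \<in> ba_carrier C \<Longrightarrow> h (ba_compl C c) = oa_compl A (h c)"
    and hp: "\<And>c d. c \<in> ba_carrier C \<Longrightarrow> d \<in> ba_carrier C \<Longrightarrow> oa_plus A (h c) (h d) =
        (if ba_meet C c d = ba_zero C then Some (h (ba_join C c d)) else None)"
  shows "boolean_structure A (h ` ba_carrier C) (transport_boolalg h C)"
proof -
  interpret C: boolalg C by (rule C)
  have inv: "inv_into (ba_carrier C) h (h x) = x" if "x \<in> ba_carrier C" for x
    using h that by simp
  have "h (ba_meet C c d) = h (ba_zero C) \<longleftrightarrow> ba_meet C c d = ba_zero C"
    if "c \<in> ba_carrier C" "d \<in> ba_carrier C" for c d
    using h that by (simp add: inj_on_eq_iff)
  then show ?thesis
    unfolding boolean_structure_def using C.transport(1)[OF h]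
    by (auto simp: transport_boolalg_def Let_def inv h01 hc hp)
qed

context orthoalgebra
begin

lemma plus_assocD:
  assumes "a \<in> oa_carrier A" "b \<in> oa_carrier A" "c \<in> oa_carrier A"
    and "oa_plus A a b = Some s" "oa_plus A s c = Some r"
  shows "\<exists>t\<in>oa_carrier A. oa_plus A b c = Some t \<and> oa_plus A a t = Some r"
proof -
  have "Option.bind (oa_plus A b c) (\<lambda>t. oa_plus A a t) = Some r"
    using plus_assoc[OF assms(1-3)] assms(4,5) by simp
  then obtain t where "oa_plus A b c = Some t" "oa_plus A a t = Some r"
    by (auto simp: bind_eq_Some_conv)
  then show ?thesis using plus_closed assms by blast
qed

lemma plus_assocD':
  assumes "a \<in> oa_carrier A" "b \<in> oa_carrier A" "c \<in> oa_carrier A"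
    and "oa_plus A b c = Some t" "oa_plus A a t = Some r"
  shows "\<exists>s\<in>oa_carrier A. oa_plus A a b = Some s \<and> oa_plus A s c = Some r"
proof -
  have "Option.bind (oa_plus A a b) (\<lambda>s. oa_plus A s c) = Some r"
    using plus_assoc[OF assms(1-3)] assms(4,5) by simp
  then obtain t where "oa_plus A a b = Some t" "oa_plus A t c = Some r"
    by (auto simp: bind_eq_Some_conv)
  then show ?thesis using plus_closed assms by blast
qed

lemma plus_compl: "a \<in> oa_carrier A \<Longrightarrow> oa_plus A a (oa_compl A a) = Some (oa_one A)"
  using plus_eq_one_iff compl_closed by blast

lemma compl_compl: "a \<in> oa_carrier A \<Longrightarrow> oa_compl A (oa_compl A a) = a"
  using plus_compl plus_commute plus_eq_one_iff compl_closed by metis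

text \<open>
  Since \<open>1 = 1 \<oplus> 1' = (1 \<oplus> 1') \<oplus> 1'\<close>, associativity makes \<open>1' \<oplus> 1'\<close> defined.
\<close>

lemma compl_one: "oa_compl A (oa_one A) = oa_zero A"
proof -
  let ?z = "oa_compl A (oa_one A)"
  have z: "?z \<in> oa_carrier A" using one_closed compl_closed by blast
  have p: "oa_plus A (oa_one A) ?z = Some (oa_one A)" using plus_compl one_closed by blast
  obtain t where "oa_plus A ?z ?z = Some t" using plus_assocD[OF one_closed z z p p] by blast
  then show ?thesis using plus_self_defined_iff[OF z] by simp
qed

lemma compl_zero: "oa_compl A (oa_zero A) = oa_one A"
  using compl_one compl_compl one_closed by metis

lemma plus_zero:
  assumes a: "a \<in> oa_carrier A"
  shows "oa_plus A a (oa_zero A) = Some a"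
proof -
  let ?b = "oa_compl A a"
  have b: "?b \<in> oa_carrier A" using compl_closed a by blast
  have p: "oa_plus A ?b a = Some (oa_one A)" using plus_compl[OF b] compl_compl[OF a] by simp
  have "oa_plus A (oa_one A) (oa_zero A) = Some (oa_one A)" using plus_compl[OF one_closed] compl_one by simp
  then obtain t where t: "t \<in> oa_carrier A" "oa_plus A a (oa_zero A) = Some t" "oa_plus A ?b t = Some (oa_one A)"
    using plus_assocD[OF b a zero_closed p] by blast
  then show ?thesis using plus_eq_one_iff[OF b t(1)] compl_compl[OF a] by simp
qed

lemma plus_one_defined:
  assumes a: "a \<in> oa_carrier A" and p: "oa_plus A a (oa_one A) = Some s"
  shows "a = oa_zero A"
proof -
  obtain s where "oa_plus A a a = Some s"
    using plus_assocD'[OF a a compl_closed[OF a] plus_compl[OF a] p] by blast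
  then show ?thesis using plus_self_defined_iff[OF a] by simp
qed

lemma plus_interchange:
  assumes C: "a \<in> oa_carrier A" "b \<in> oa_carrier A" "c \<in> oa_carrier A" "d \<in> oa_carrier A"
    and p: "oa_plus A a b = Some s" "oa_plus A c d = Some t" "oa_plus A s t = Some r"
  shows "\<exists>u\<in>oa_carrier A. \<exists>v\<in>oa_carrier A. oa_plus A a c = Some u \<and> oa_plus A b d = Some v \<and> oa_plus A u v = Some r"
proof -
  have st: "s \<in> oa_carrier A" "t \<in> oa_carrier A" using plus_closed C p by blast+
  obtain x where x: "x \<in> oa_carrier A" "oa_plus A b t = Some x" "oa_plus A a x = Some r"
    using plus_assocD[OF C(1,2) st(2) p(1,3)] by blast
  have "oa_plus A d c = Some t" using p plus_commute C by metis
  then obtain v where v: "v \<in> oa_carrier A" "oa_plus A b d = Some v" "oa_plus A v c = Some x"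
    using plus_assocD'[OF C(2,4,3) _ x(2)] by blast
  have "oa_plus A c v = Some x" using v plus_commute C by metis
  then obtain u where "u \<in> oa_carrier A" "oa_plus A a c = Some u" "oa_plus A u v = Some r"
    using plus_assocD'[OF C(1,3) v(1) _ x(3)] by blast
  then show ?thesis using v by blast
qed

lemma subalgebra_orthoalgebra:
  assumes S: "oa_subalgebra A S"
  shows "orthoalgebra (A\<lparr>oa_carrier := S\<rparr>)"
proof -
  have C: "\<And>a. a \<in> S \<Longrightarrow> a \<in> oa_carrier A"
    and pl: "\<And>a b c. a \<in> S \<Longrightarrow> b \<in> S \<Longrightarrow> oa_plus A a b = Some c \<Longrightarrow> c \<in> S"
    and cl: "oa_zero A \<in> S" "oa_one A \<in> S" "\<And>a. a \<in> S \<Longrightarrow> oa_compl A a \<in> S"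
    using S unfolding oa_subalgebra_def by blast+
  show ?thesis
  proof
    fix a b c
    show "\<lbrakk>a \<in> oa_carrier (A\<lparr>oa_carrier := S\<rparr>); b \<in> oa_carrier (A\<lparr>oa_carrier := S\<rparr>); c \<in> oa_carrier (A\<lparr>oa_carrier := S\<rparr>)\<rbrakk>
      \<Longrightarrow> Option.bind (oa_plus (A\<lparr>oa_carrier := S\<rparr>) a b) (\<lambda>s. oa_plus (A\<lparr>oa_carrier := S\<rparr>) s c)
        = Option.bind (oa_plus (A\<lparr>oa_carrier := S\<rparr>) b c) (\<lambda>t. oa_plus (A\<lparr>oa_carrier := S\<rparr>) a t)"
      using plus_assoc C by simp
    show "\<lbrakk>a \<in> oa_carrier (A\<lparr>oa_carrier := S\<rparr>); b \<in> oa_carrier (A\<lparr>oa_carrier := S\<rparr>)\<rbrakk>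
      \<Longrightarrow> oa_plus (A\<lparr>oa_carrier := S\<rparr>) a b = oa_plus (A\<lparr>oa_carrier := S\<rparr>) b a"
      using plus_commute C by simp
    show "\<lbrakk>a \<in> oa_carrier (A\<lparr>oa_carrier := S\<rparr>); b \<in> oa_carrier (A\<lparr>oa_carrier := S\<rparr>)\<rbrakk>
      \<Longrightarrow> oa_plus (A\<lparr>oa_carrier := S\<rparr>) a b = Some (oa_one (A\<lparr>oa_carrier := S\<rparr>))
        \<longleftrightarrow> b = oa_compl (A\<lparr>oa_carrier := S\<rparr>) a"
      using plus_eq_one_iff C by simp
    show "a \<in> oa_carrier (A\<lparr>oa_carrier := S\<rparr>)
      \<Longrightarrow> oa_plus (A\<lparr>oa_carrier := S\<rparr>) a a \<noteq> None \<longleftrightarrow> a = oa_zero (A\<lparr>oa_carrier := S\<rparr>)"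
      using plus_self_defined_iff C by simp
    show "\<lbrakk>a \<in> oa_carrier (A\<lparr>oa_carrier := S\<rparr>); b \<in> oa_carrier (A\<lparr>oa_carrier := S\<rparr>);
        oa_plus (A\<lparr>oa_carrier := S\<rparr>) a b = Some c\<rbrakk> \<Longrightarrow> c \<in> oa_carrier (A\<lparr>oa_carrier := S\<rparr>)"
      using pl[of a b c] by simp
  qed (use cl in simp_all)
qed

lemma BSub_iff: "S \<in> BSub A \<longleftrightarrow> S \<subseteq> oa_carrier A \<and> (\<exists>B. boolean_structure A S B)"
proof
  assume "S \<in> BSub A"
  then have "oa_subalgebra A S" "boolean_orthoalgebra (A\<lparr>oa_carrier := S\<rparr>)" by (auto simp: BSub_def)
  then obtain B where "boolalg B" "ba_carrier B = oa_carrier (A\<lparr>oa_carrier := S\<rparr>)"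
    "ba_zero B = oa_zero (A\<lparr>oa_carrier := S\<rparr>)" "ba_one B = oa_one (A\<lparr>oa_carrier := S\<rparr>)"
    "\<forall>a\<in>oa_carrier (A\<lparr>oa_carrier := S\<rparr>). ba_compl B a = oa_compl (A\<lparr>oa_carrier := S\<rparr>) a"
    "\<forall>a\<in>oa_carrier (A\<lparr>oa_carrier := S\<rparr>). \<forall>b\<in>oa_carrier (A\<lparr>oa_carrier := S\<rparr>).
       oa_plus (A\<lparr>oa_carrier := S\<rparr>) a b = (if ba_meet B a b = ba_zero B then Some (ba_join B a b) else None)"
    unfolding boolean_orthoalgebra_def by blast
  then have "boolean_structure A S B"
    unfolding boolean_structure_def by simp
  moreover have "S \<subseteq> oa_carrier A" using \<open>oa_subalgebra A S\<close> by (simp add: oa_subalgebra_def)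
  ultimately show "S \<subseteq> oa_carrier A \<and> (\<exists>B. boolean_structure A S B)" by blast
next
  assume "S \<subseteq> oa_carrier A \<and> (\<exists>B. boolean_structure A S B)"
  then obtain B where S: "S \<subseteq> oa_carrier A" and B: "boolean_structure A S B" by blast
  have bB: "boolalg B" using B by (simp add: boolean_structure_def)
  interpret B: boolalg B by (rule bB)
  have c: "ba_carrier B = S" "ba_zero B = oa_zero A" "ba_one B = oa_one A"
    "\<And>a. a \<in> S \<Longrightarrow> ba_compl B a = oa_compl A a"
    "\<And>a b. a \<in> S \<Longrightarrow> b \<in> S \<Longrightarrow> oa_plus A a b = (if ba_meet B a b = ba_zero B then Some (ba_join B a b) else None)"
    using B unfolding boolean_structure_def by blast+
  have "d \<in> S" if "a \<in> S" "b \<in> S" "oa_plus A a b = Some d" for a b d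
    using B.join_closed[of a b] c(1) c(5)[of a b] that by (simp split: if_splits)
  moreover have "oa_compl A a \<in> S" if "a \<in> S" for a using B.compl_closed[of a] c(1,4) that by simp
  moreover have "oa_zero A \<in> S" "oa_one A \<in> S" using B.zero_closed B.one_closed c by auto
  ultimately have "oa_subalgebra A S" using S unfolding oa_subalgebra_def by blast
  moreover from this have "boolean_orthoalgebra (A\<lparr>oa_carrier := S\<rparr>)"
    unfolding boolean_orthoalgebra_def using subalgebra_orthoalgebra bB c
    by (intro conjI exI[of _ B]) simp_all
  ultimately show "S \<in> BSub A" by (simp add: BSub_def)
qed

lemma obtain_structure:
  assumes "S \<in> BSub A"
  obtains B where "boolean_structure A S B"
  using assms BSub_iff by blast

lemma BSub_closed:
  assumes "S \<in> BSub A"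
  shows "S \<subseteq> oa_carrier A" "oa_zero A \<in> S" "oa_one A \<in> S" "\<And>a. a \<in> S \<Longrightarrow> oa_compl A a \<in> S"
    "\<And>a b c. a \<in> S \<Longrightarrow> b \<in> S \<Longrightarrow> oa_plus A a b = Some c \<Longrightarrow> c \<in> S" "\<And>a. a \<in> S \<Longrightarrow> a \<in> oa_carrier A"
  using assms unfolding BSub_def oa_subalgebra_def by blast+

end

lemma boolean_structureD:
  assumes "boolean_structure A S B"
  shows "boolalg B" "ba_carrier B = S" "ba_zero B = oa_zero A" "ba_one B = oa_one A"
    "\<And>a. a \<in> S \<Longrightarrow> ba_compl B a = oa_compl A a"
    "\<And>a b. a \<in> S \<Longrightarrow> b \<in> S \<Longrightarrow> oa_plus A a b = (if ba_meet B a b = ba_zero B then Some (ba_join B a b) else None)"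
  using assms unfolding boolean_structure_def by blast+

lemma (in boolalg) Sub_boolalg:
  assumes T: "T \<in> Sub B"
  shows "boolalg (B\<lparr>ba_carrier := T\<rparr>)"
proof -
  note C = SubD(7)[OF T]
  show ?thesis
    by unfold_locales (simp_all add: SubD(2-6)[OF T], (rule valuation_eqI; auto simp: C)+)
qed

lemma boolean_structure_Sub:
  assumes B: "boolean_structure A S B" and T: "T \<in> Sub B"
  shows "boolean_structure A T (B\<lparr>ba_carrier := T\<rparr>)"
proof -
  interpret B: boolalg B using boolean_structureD(1)[OF B] .
  have "T \<subseteq> S" using B.SubD(1)[OF T] boolean_structureD(2)[OF B] by simp
  then show ?thesis
    using B B.Sub_boolalg[OF T] unfolding boolean_structure_def by (simp add: subset_iff)
qed

text \<open>
  In \<open>T\<close>, the elements \<open>u = a \<sqinter> b'\<close>, \<open>c = a \<sqinter> b\<close> and \<open>e = b \<sqinter> c'\<close> satisfy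
  \<open>u \<oplus> c = a\<close>, \<open>c \<oplus> e = b\<close> and \<open>u \<oplus> b = a \<squnion> b\<close>.  These sums are computed in \<open>A\<close>, so they are
  orthogonal joins in \<open>S\<close> as well, which determines \<open>a \<squnion> b\<close> there.
\<close>

lemma boolean_structure_join_unique:
  assumes B: "boolean_structure A S B" and D: "boolean_structure A T D" and TS: "T \<subseteq> S"
    and ab: "a \<in> T" "b \<in> T"
  shows "ba_join B a b = ba_join D a b"
proof -
  interpret B: boolalg B using boolean_structureD(1)[OF B] .
  interpret D: boolalg D using boolean_structureD(1)[OF D] .
  note b = boolean_structureD[OF B] and d = boolean_structureD[OF D]
  have ab': "a \<in> ba_carrier D" "b \<in> ba_carrier D" using ab d by auto
  define u c e where "u = ba_meet D a (ba_compl D b)" and "c = ba_meet D a b"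
    and "e = ba_meet D b (ba_compl D c)"
  have uce: "u \<in> T" "c \<in> T" "e \<in> T" using ab' d(2) by (auto simp: u_def c_def e_def)
  have uS: "u \<in> S" "c \<in> S" "e \<in> S" and bS: "b \<in> S" using uce ab TS by blast+
  have "oa_plus A u b = Some (ba_join D a b)"
  proof -
    have "ba_meet D u b = ba_zero D" "ba_join D u b = ba_join D a b"
      unfolding u_def using ab' by (intro D.valuation_eqI; auto)+
    then show ?thesis using d(6)[OF uce(1) ab(2)] by simp
  qed
  then have ub: "ba_join B u b = ba_join D a b"
    using b(6)[OF uS(1) bS] by (simp split: if_splits)
  have "oa_plus A u c = Some a"
  proof -
    have "ba_meet D u c = ba_zero D" "ba_join D u c = a"
      unfolding u_def c_def using ab' by (intro D.valuation_eqI; auto)+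
    then show ?thesis using d(6)[OF uce(1,2)] by simp
  qed
  then have uc: "ba_join B u c = a"
    using b(6)[OF uS(1,2)] by (simp split: if_splits)
  have "oa_plus A c e = Some b"
  proof -
    have "ba_meet D c e = ba_zero D" "ba_join D c e = b"
      unfolding c_def e_def using ab' by (intro D.valuation_eqI; auto)+
    then show ?thesis using d(6)[OF uce(2,3)] by simp
  qed
  then have ce: "ba_join B c e = b"
    using b(6)[OF uS(2,3)] by (simp split: if_splits)
  have C: "u \<in> ba_carrier B" "c \<in> ba_carrier B" "e \<in> ba_carrier B" using uce TS b(2) by auto
  have "ba_join B a b = ba_join B u b"
    unfolding uc[symmetric] ce[symmetric] using C by (intro B.valuation_eqI) auto
  then show ?thesis using ub by simp
qed

context orthoalgebra
begin

text \<open>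
  The Boolean subalgebras below \<open>S\<close> are the subalgebras of the Boolean algebra \<open>S\<close>: compatibility of the
  joins turns closure under sums into closure under joins.
\<close>

lemma down_BSub_eq_Sub:
  assumes S: "S \<in> BSub A" and B: "boolean_structure A S B"
  shows "down_in (BSub A) S = Sub B"
proof (intro subset_antisym subsetI)
  interpret B: boolalg B using boolean_structureD(1)[OF B] .
  note b = boolean_structureD[OF B]
  fix T assume "T \<in> down_in (BSub A) S"
  then have T: "T \<in> BSub A" "T \<subseteq> S" by (auto simp: down_in_def)
  obtain D where D: "boolean_structure A T D" using obtain_structure T by blast
  interpret D: boolalg D using boolean_structureD(1)[OF D] .
  note d = boolean_structureD[OF D]
  show "T \<in> Sub B"
  proof (rule B.SubI)
    show "ba_join B a c \<in> T" if "a \<in> T" "c \<in> T" for a c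
      using boolean_structure_join_unique[OF B D T(2) that] D.join_closed that d(2) by auto
    show "ba_compl B a \<in> T" if "a \<in> T" for a
      using b(5)[of a] BSub_closed(4)[OF T(1)] that T by auto
  qed (use b BSub_closed(2)[OF T(1)] T in auto)
next
  interpret B: boolalg B using boolean_structureD(1)[OF B] .
  note b = boolean_structureD[OF B]
  fix T assume T: "T \<in> Sub B"
  have "T \<subseteq> S" using B.SubD(1)[OF T] b(2) by simp
  then show "T \<in> down_in (BSub A) S"
    using boolean_structure_Sub[OF B T] BSub_iff BSub_closed(1)[OF S] by (auto simp: down_in_def)
qed

lemma psub_eq_oa_psub:
  assumes B: "boolean_structure A S B" and a: "a \<in> S"
  shows "psub B a = oa_psub A S a"
proof -
  interpret B: boolalg B using boolean_structureD(1)[OF B] .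
  note b = boolean_structureD[OF B]
  have "oa_compl A t \<in> S" if "t \<in> S" for t using B.compl_closed b that by metis
  then show ?thesis unfolding psub_def oa_psub_def using a b by (auto split: if_splits)
qed

lemma four_eq_oa_four:
  assumes B: "boolean_structure A S B" and a: "a \<in> S"
  shows "four B a = oa_four A a"
  using boolean_structureD[OF B] a by (simp add: four_def oa_four_def)

lemma zero_ne_one_of_two:
  assumes S: "S \<in> BSub A" and ne: "a \<in> S" "b \<in> S" "a \<noteq> b"
  shows "oa_zero A \<noteq> oa_one A"
proof
  assume "oa_zero A = oa_one A"
  then have "t = oa_zero A" if "t \<in> S" for t
    using plus_one_defined[of t t] plus_zero[of t] BSub_closed(6)[OF S that] by simp
  then show False using ne by metis
qed

text \<open>
  Along a chain of at least two subalgebras the cardinality starts with at least \<open>2\<close> and at least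
  doubles at each step.
\<close>

lemma card_le_16_height:
  assumes S: "S \<in> BSub A" and fin: "finite S" "card S \<le> 16"
  shows "height (BSub A) S \<le> 3"
proof -
  obtain B where B: "boolean_structure A S B" using obtain_structure S by blast
  interpret B: boolalg B using boolean_structureD(1)[OF B] .
  note b = boolean_structureD[OF B]
  have *: "2 ^ card C \<le> card M"
    if "finite C" "M \<in> C" "C \<subseteq> Sub B" "Complete_Partial_Order.chain (\<le>) C" "\<forall>T\<in>C. T \<subseteq> M"
      "oa_zero A \<noteq> oa_one A" for C M
    using that
  proof (induction "card C" arbitrary: C M)
    case 0 then show ?case by auto
  next
    case (Suc n)
    have finM: "finite M" using Suc.prems B.SubD(1) b(2) fin(1) finite_subset by (metis subsetD)
    show ?case
    proof (cases "C - {M} = {}")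
      case True
      then have "C = {M}" using Suc.prems by auto
      moreover have "{oa_zero A, oa_one A} \<subseteq> M" using B.SubD(2,3)[of M] Suc.prems b by auto
      then have "card {oa_zero A, oa_one A} \<le> card M" using finM card_mono by blast
      ultimately show ?thesis using Suc.prems by simp
    next
      case False
      obtain N where N: "N \<in> C - {M}" "\<forall>T\<in>C - {M}. N \<subseteq> T \<longrightarrow> N = T"
        using finite_has_maximal[OF _ False] Suc.prems by blast
      have top: "\<forall>T\<in>C - {M}. T \<subseteq> N"
        using N Suc.prems(4) by (metis DiffD1 chainD)
      have "2 ^ card (C - {M}) \<le> card N"
      proof (rule Suc.hyps(1))
        show "n = card (C - {M})" using Suc.hyps(2) Suc.prems by simp
        show "Complete_Partial_Order.chain (\<le>) (C - {M})"
          using Suc.prems(4) by (auto simp: chain_def)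
        show "finite (C - {M})" "C - {M} \<subseteq> Sub B" "oa_zero A \<noteq> oa_one A"
          using Suc.prems by blast+
      qed (use N(1) top in blast)+
      moreover have "2 * card N \<le> card M"
      proof (rule B.card_Sub_less[OF _ _ _ finM])
        show "N \<in> Sub B" "M \<in> Sub B" using N(1) Suc.prems(2,3) by blast+
        show "N \<subset> M" using N(1) Suc.prems(5) by blast
      qed
      ultimately have "2 * 2 ^ card (C - {M}) \<le> card M" by linarith
      moreover have "card C = Suc (card (C - {M}))" using card.remove[OF Suc.prems(1,2)] by simp
      ultimately show ?thesis by simp
    qed
  qed
  show ?thesis
    unfolding height_le_three_iff
  proof (intro allI impI)
    fix C assume C: "C \<subseteq> down_in (BSub A) S" "Complete_Partial_Order.chain (\<le>) C" "finite C"
    show "card C \<le> 4"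
    proof (cases "card C \<le> 1")
      case False
      then obtain T U where TU: "T \<in> C" "U \<in> C" "T \<noteq> U"
        using C(3) card_le_Suc0_iff_eq by (metis One_nat_def)
      obtain M where M: "M \<in> C" "\<forall>T\<in>C. M \<subseteq> T \<longrightarrow> M = T"
        using finite_has_maximal[of C] C TU by blast
      have top: "\<forall>T\<in>C. T \<subseteq> M" using M C(2) by (metis chainD)
      have sub: "C \<subseteq> Sub B" using C(1) down_BSub_eq_Sub[OF S B] by simp
      have "oa_zero A \<noteq> oa_one A"
      proof -
        obtain t where "t \<in> T \<and> t \<notin> U \<or> t \<in> U \<and> t \<notin> T" using TU by blast
        moreover have "oa_zero A \<in> T" "oa_zero A \<in> U" "T \<subseteq> S" "U \<subseteq> S"
          using TU sub B.SubD(1,2) b by auto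
        ultimately show ?thesis using zero_ne_one_of_two[OF S, of t "oa_zero A"] by blast
      qed
      then have "2 ^ card C \<le> card M" using *[OF C(3) M(1) sub C(2) top] by blast
      also have "M \<subseteq> S" using M sub B.SubD(1) b by auto
      then have "card M \<le> 2 ^ 4" using fin card_mono[of S M] by simp
      finally show ?thesis using power_le_imp_le_exp[of 2 "card C" 4] by simp
    qed simp
  qed
qed

end

section \<open>Amalgamating two Boolean subalgebras along an element\<close>

definition interval_boolalg :: "'b boolalg \<Rightarrow> 'b \<Rightarrow> 'b boolalg" where
  "interval_boolalg B e = \<lparr>ba_carrier = {t \<in> ba_carrier B. ba_meet B t e = t},
     ba_join = ba_join B, ba_meet = ba_meet B, ba_compl = (\<lambda>t. ba_meet B e (ba_compl B t)),
     ba_zero = ba_zero B, ba_one = e\<rparr>"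

definition product_boolalg :: "'b boolalg \<Rightarrow> 'c boolalg \<Rightarrow> ('b \<times> 'c) boolalg" where
  "product_boolalg B D = \<lparr>ba_carrier = ba_carrier B \<times> ba_carrier D,
     ba_join = (\<lambda>p q. (ba_join B (fst p) (fst q), ba_join D (snd p) (snd q))),
     ba_meet = (\<lambda>p q. (ba_meet B (fst p) (fst q), ba_meet D (snd p) (snd q))),
     ba_compl = (\<lambda>p. (ba_compl B (fst p), ba_compl D (snd p))),
     ba_zero = (ba_zero B, ba_zero D), ba_one = (ba_one B, ba_one D)\<rparr>"

lemma (in boolalg) boolalg_interval:
  assumes e: "e \<in> \<C>"
  shows "boolalg (interval_boolalg B e)"
proof -
  have le: "v e" if "t \<in> \<C>" "t \<sqinter> e = t" "valuation B v" "v t" for t v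
    using that e valuation_simps(5)[of v t e] by metis
  have cl: "(s \<squnion> t) \<sqinter> e = s \<squnion> t" "(s \<sqinter> t) \<sqinter> e = s \<sqinter> t" "(e \<sqinter> \<sim> t) \<sqinter> e = e \<sqinter> \<sim> t" "\<zero> \<sqinter> e = \<zero>" "e \<sqinter> e = e"
    if "s \<in> \<C> \<and> s \<sqinter> e = s" "t \<in> \<C> \<and> t \<sqinter> e = t" for s t
    by (rule valuation_eqI; use that e le in auto)+
  have jc: "t \<squnion> (e \<sqinter> \<sim> t) = e" if "t \<in> \<C> \<and> t \<sqinter> e = t" for t
    by (rule valuation_eqI; use that e le in auto)
  show ?thesis
    by unfold_locales
      (simp_all add: interval_boolalg_def e cl jc, (rule valuation_eqI; simp add: e; blast)+)
qed

lemma boolalg_product: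
  assumes "boolalg B" "boolalg D"
  shows "boolalg (product_boolalg B D)"
proof -
  interpret B: boolalg B by fact
  interpret D: boolalg D by fact
  show ?thesis
    by unfold_locales
      (simp_all add: product_boolalg_def mem_Times_iff,
       ((rule prod_eqI | rule conjI | rule B.valuation_eqI | rule D.valuation_eqI); auto)+)
qed

text \<open>
  Choose \<open>t\<close> outside \<open>four a\<close>.  The elements whose part below \<open>a'\<close> is \<open>0\<close>, \<open>t \<sqinter> a'\<close>,
  \<open>t' \<sqinter> a'\<close> or \<open>a'\<close> form a subalgebra strictly above \<open>four a\<close>, hence everything; so these four
  are the only elements below \<open>a'\<close>.
\<close>

lemma (in boolalg) card_below_compl_of_cover:
  assumes a: "a \<in> \<C>" and ne: "\<C> \<noteq> four B a"
    and cover: "\<And>T. T \<in> Sub B \<Longrightarrow> four B a \<subset> T \<Longrightarrow> T \<subset> \<C> \<Longrightarrow> False"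
  shows "finite {s \<in> \<C>. s \<sqinter> a = \<zero>}" "card {s \<in> \<C>. s \<sqinter> a = \<zero>} \<le> 4"
proof -
  have sub: "four B a \<subseteq> \<C>" using SubD(1)[OF four_in_Sub[OF a]] .
  obtain t where t: "t \<in> \<C>" "t \<notin> four B a" using ne sub by blast
  define R where "R = {\<zero>, t \<sqinter> \<sim> a, \<sim> t \<sqinter> \<sim> a, \<sim> a}"
  have RC: "R \<subseteq> \<C>" using a t by (auto simp: R_def)
  have Rj: "r \<squnion> s \<in> R" if "r \<in> R" "s \<in> R" for r s
  proof -
    have "(\<sim> t \<sqinter> \<sim> a) \<squnion> (t \<sqinter> \<sim> a) = \<sim> a" "(t \<sqinter> \<sim> a) \<squnion> (\<sim> t \<sqinter> \<sim> a) = \<sim> a"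
      "(t \<sqinter> \<sim> a) \<squnion> \<sim> a = \<sim> a" "\<sim> a \<squnion> (t \<sqinter> \<sim> a) = \<sim> a"
      "(\<sim> t \<sqinter> \<sim> a) \<squnion> \<sim> a = \<sim> a" "\<sim> a \<squnion> (\<sim> t \<sqinter> \<sim> a) = \<sim> a"
      "\<zero> \<squnion> r = r" "\<zero> \<squnion> s = s" "r \<squnion> r = r" "r \<squnion> \<zero> = r"
      using a t that RC by (intro valuation_eqI; auto)+
    then show ?thesis using that unfolding R_def by (elim insertE emptyE) simp_all
  qed
  have Rc: "\<sim> r \<sqinter> \<sim> a \<in> R" if "r \<in> R" for r
  proof -
    have "\<sim> \<zero> \<sqinter> \<sim> a = \<sim> a" "\<sim> (t \<sqinter> \<sim> a) \<sqinter> \<sim> a = \<sim> t \<sqinter> \<sim> a"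
      "\<sim> (\<sim> t \<sqinter> \<sim> a) \<sqinter> \<sim> a = t \<sqinter> \<sim> a" "\<sim> (\<sim> a) \<sqinter> \<sim> a = \<zero>"
      using a t by (intro valuation_eqI; auto)+
    then show ?thesis using that unfolding R_def by (elim insertE emptyE) simp_all
  qed
  define K where "K = {s \<in> \<C>. s \<sqinter> \<sim> a \<in> R}"
  have "K \<in> Sub B"
  proof (rule SubI)
    show "K \<subseteq> \<C>" by (auto simp: K_def)
    have "\<zero> \<sqinter> \<sim> a = \<zero>" using a by (intro valuation_eqI) auto
    then show "\<zero> \<in> K" by (simp add: K_def R_def)
    show "\<sim> s \<in> K" if "s \<in> K" for s
    proof -
      have "\<sim> s \<sqinter> \<sim> a = \<sim> (s \<sqinter> \<sim> a) \<sqinter> \<sim> a" using that a by (intro valuation_eqI) (auto simp: K_def)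
      then show ?thesis using Rc[of "s \<sqinter> \<sim> a"] that by (simp add: K_def)
    qed
    show "r \<squnion> s \<in> K" if "r \<in> K" "s \<in> K" for r s
    proof -
      have "(r \<squnion> s) \<sqinter> \<sim> a = (r \<sqinter> \<sim> a) \<squnion> (s \<sqinter> \<sim> a)"
        using that a by (intro valuation_eqI) (auto simp: K_def)
      then show ?thesis using Rj[of "r \<sqinter> \<sim> a" "s \<sqinter> \<sim> a"] that by (simp add: K_def)
    qed
  qed
  moreover have "a \<sqinter> \<sim> a = \<zero>" using a by (intro valuation_eqI) auto
  then have "a \<in> K" using a by (simp add: K_def R_def)
  moreover have "t \<in> K" using t by (simp add: K_def R_def)
  ultimately have "K = \<C>" using cover[of K] four_least t SubD(1) by blast
  moreover have "s \<sqinter> \<sim> a = s" if "s \<in> \<C>" "s \<sqinter> a = \<zero>" for s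
  proof (rule valuation_eqI)
    fix v assume "valuation B v"
    then show "v (s \<sqinter> \<sim> a) = v s" using arg_cong[OF that(2), of v] a that(1) by auto
  qed (use that a in auto)
  ultimately have "s \<in> R" if "s \<in> \<C>" "s \<sqinter> a = \<zero>" for s
    using that unfolding K_def by (metis (mono_tags, lifting) mem_Collect_eq)
  then have "{s \<in> \<C>. s \<sqinter> a = \<zero>} \<subseteq> R" by blast
  moreover have "finite R" "card R \<le> 4" by (auto simp: R_def card_insert_if)
  ultimately show "finite {s \<in> \<C>. s \<sqinter> a = \<zero>}" "card {s \<in> \<C>. s \<sqinter> a = \<zero>} \<le> 4"
    using finite_subset card_mono le_trans by metis+
qed

lemma (in boolalg) eq_four_of_psub:
  assumes a: "a \<in> \<C>" and S: "S \<in> Sub B" "a \<in> S"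
    and p: "S \<inter> psub B a \<subseteq> four B a" "S \<inter> psub B (\<sim> a) \<subseteq> four B a"
  shows "S = four B a"
proof
  show "four B a \<subseteq> S" using four_least S by blast
  show "S \<subseteq> four B a"
  proof
    fix t assume t: "t \<in> S"
    have tC: "t \<in> \<C>" using t SubD(1)[OF S(1)] by blast
    have "t \<sqinter> a \<in> S \<inter> psub B a" "t \<sqinter> \<sim> a \<in> S \<inter> psub B (\<sim> a)"
      using t tC a SubD(4,6)[OF S(1)] S(2) by (auto simp: mem_psub_iff)
    then have "(t \<sqinter> a) \<squnion> (t \<sqinter> \<sim> a) \<in> four B a" using p SubD(5)[OF four_in_Sub[OF a]] by blast
    moreover have "(t \<sqinter> a) \<squnion> (t \<sqinter> \<sim> a) = t" using a tC by (intro valuation_eqI) auto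
    ultimately show "t \<in> four B a" by simp
  qed
qed

context orthoalgebra
begin

text \<open>
  The sums of an element of \<open>S\<close> below \<open>a'\<close> and an element of \<open>R\<close> below \<open>a\<close>.
\<close>

definition amalgam :: "'a set \<Rightarrow> 'a set \<Rightarrow> 'a \<Rightarrow> 'a set" where
  "amalgam S R a = {m. \<exists>s\<in>S. \<exists>t\<in>R. oa_plus A s a \<noteq> None \<and> oa_plus A t (oa_compl A a) \<noteq> None
      \<and> oa_plus A s t = Some m}"

text \<open>
  Because \<open>a' \<oplus> a = 1\<close>, every such sum exists, and the sums are in bijection with the product of the
  intervals \<open>[0, a']\<close> of \<open>S\<close> and \<open>[0, a]\<close> of \<open>R\<close>.  By the interchange law a sum of two of them is
  defined exactly when the sums of the components are, so the product Boolean algebra is transported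
  to \<open>A\<close>.
\<close>

lemma amalgam_in_BSub:
  assumes S: "S \<in> BSub A" "a \<in> S" and R: "R \<in> BSub A" "a \<in> R"
  shows "amalgam S R a \<in> BSub A"
proof -
  obtain BS where BS: "boolean_structure A S BS" using obtain_structure S by blast
  obtain BR where BR: "boolean_structure A R BR" using obtain_structure R by blast
  interpret S: boolalg BS using boolean_structureD(1)[OF BS] .
  interpret R: boolalg BR using boolean_structureD(1)[OF BR] .
  note bs = boolean_structureD[OF BS] and br = boolean_structureD[OF BR]
  define a' where "a' = oa_compl A a"
  have aA: "a \<in> oa_carrier A" using BSub_closed(6)[OF S] .
  have aC: "a \<in> ba_carrier BS" "a' \<in> ba_carrier BS" "a \<in> ba_carrier BR" "a' \<in> ba_carrier BR"
    using S R bs(2) br(2) BSub_closed(4)[OF S(1)] BSub_closed(4)[OF R(1)] by (auto simp: a'_def)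
  have a'S: "a' = ba_compl BS a" "a' = ba_compl BR a" using bs(5) br(5) S R by (simp_all add: a'_def)
  let ?P = "interval_boolalg BS a'" and ?Q = "interval_boolalg BR a"
  define C where "C = product_boolalg ?P ?Q"
  have "boolalg C" unfolding C_def by (intro boolalg_product S.boolalg_interval R.boolalg_interval aC)
  interpret C: boolalg C by fact
  define h where "h p = the (oa_plus A (fst p) (snd p))" for p
  have P: "ba_carrier ?P = {s \<in> S. oa_plus A s a \<noteq> None}"
  proof -
    have "ba_meet BS s a' = s \<longleftrightarrow> ba_meet BS s a = ba_zero BS" if "s \<in> ba_carrier BS" for s
    proof
      assume e: "ba_meet BS s a' = s"
      have "v s \<longrightarrow> \<not> v a" if "valuation BS v" for v
        using arg_cong[OF e, of v] that aC(1) \<open>s \<in> ba_carrier BS\<close> unfolding a'S(1) by auto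
      then show "ba_meet BS s a = ba_zero BS"
        using that aC(1) by (intro S.valuation_eqI) auto
    next
      assume e: "ba_meet BS s a = ba_zero BS"
      have "v s \<longrightarrow> \<not> v a" if "valuation BS v" for v
        using arg_cong[OF e, of v] that aC(1) \<open>s \<in> ba_carrier BS\<close> by auto
      then show "ba_meet BS s a' = s"
        using that aC(1) unfolding a'S(1) by (intro S.valuation_eqI) auto
    qed
    moreover have "oa_plus A s a \<noteq> None \<longleftrightarrow> ba_meet BS s a = ba_zero BS" if "s \<in> S" for s
      using bs(6)[OF that S(2)] by simp
    ultimately show ?thesis unfolding interval_boolalg_def by (simp add: bs(2)) blast
  qed
  have Q: "ba_carrier ?Q = {t \<in> R. oa_plus A t a' \<noteq> None}"
  proof -
    have "ba_meet BR s a = s \<longleftrightarrow> ba_meet BR s a' = ba_zero BR" if "s \<in> ba_carrier BR" for s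
    proof
      assume e: "ba_meet BR s a = s"
      have "v s \<longrightarrow> v a" if "valuation BR v" for v
        using arg_cong[OF e, of v] that aC(3) \<open>s \<in> ba_carrier BR\<close> by auto
      then show "ba_meet BR s a' = ba_zero BR"
        using that aC(3) unfolding a'S(2) by (intro R.valuation_eqI) auto
    next
      assume e: "ba_meet BR s a' = ba_zero BR"
      have "v s \<longrightarrow> v a" if "valuation BR v" for v
        using arg_cong[OF e, of v] that aC(3) \<open>s \<in> ba_carrier BR\<close> unfolding a'S(2) by auto
      then show "ba_meet BR s a = s"
        using that aC(3) by (intro R.valuation_eqI) auto
    qed
    moreover have "oa_plus A s a' \<noteq> None \<longleftrightarrow> ba_meet BR s a' = ba_zero BR" if "s \<in> R" for s
      using br(6)[OF that] aC(4) br(2) by simp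
    ultimately show ?thesis unfolding interval_boolalg_def by (simp add: br(2)) blast
  qed
  have carC: "ba_carrier C = ba_carrier ?P \<times> ba_carrier ?Q" by (simp add: C_def product_boolalg_def)
  have inA: "fst p \<in> oa_carrier A" "snd p \<in> oa_carrier A" if "p \<in> ba_carrier C" for p
    using that BSub_closed(6)[OF S(1)] BSub_closed(6)[OF R(1)] by (auto simp: carC P Q)
  interpret P: boolalg ?P by (intro S.boolalg_interval aC)
  interpret Q: boolalg ?Q by (intro R.boolalg_interval aC)
  have Pplus: "oa_plus A s t = (if ba_meet ?P s t = oa_zero A then Some (ba_join ?P s t) else None)"
    if "s \<in> ba_carrier ?P" "t \<in> ba_carrier ?P" for s t
    using that bs(3) bs(6) by (simp add: P) (simp add: interval_boolalg_def)
  have Qplus: "oa_plus A s t = (if ba_meet ?Q s t = oa_zero A then Some (ba_join ?Q s t) else None)"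
    if "s \<in> ba_carrier ?Q" "t \<in> ba_carrier ?Q" for s t
    using that br(3) br(6) by (simp add: Q) (simp add: interval_boolalg_def)
  have P0: "ba_zero ?P = oa_zero A" "ba_one ?P = a'" "ba_zero ?Q = oa_zero A" "ba_one ?Q = a"
    using bs br by (simp_all add: interval_boolalg_def)
  have a'a: "oa_plus A a' a = Some (oa_one A)"
    using plus_compl[OF aA] plus_commute[OF aA] compl_closed[OF aA] by (simp add: a'_def)
  have key: "oa_plus A (fst p) (snd p) = Some (h p)" "h p \<in> oa_carrier A"
    "h (ba_compl C p) = oa_compl A (h p)" if p: "p \<in> ba_carrier C" for p
  proof -
    let ?q = "ba_compl C p"
    have q: "?q \<in> ba_carrier C" using p by simp
    have pq: "fst p \<in> ba_carrier ?P" "snd p \<in> ba_carrier ?Q" "fst ?q = ba_compl ?P (fst p)"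
      "snd ?q = ba_compl ?Q (snd p)" using p by (auto simp: carC C_def product_boolalg_def)
    have "oa_plus A (fst p) (fst ?q) = Some a'"
      using Pplus[of "fst p" "fst ?q"] pq P0 P.join_compl P.meet_compl by simp
    moreover have "oa_plus A (snd p) (snd ?q) = Some a"
      using Qplus[of "snd p" "snd ?q"] pq P0 Q.join_compl Q.meet_compl by simp
    ultimately obtain u v where uv: "u \<in> oa_carrier A" "v \<in> oa_carrier A"
      "oa_plus A (fst p) (snd p) = Some u" "oa_plus A (fst ?q) (snd ?q) = Some v"
      "oa_plus A u v = Some (oa_one A)"
      using plus_interchange[OF inA(1)[OF p] inA(1)[OF q] inA(2)[OF p] inA(2)[OF q] _ _ a'a] by blast
    then have "h p = u" "h ?q = v" by (simp_all add: h_def)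
    then show "oa_plus A (fst p) (snd p) = Some (h p)" "h p \<in> oa_carrier A" "h ?q = oa_compl A (h p)"
      using uv plus_eq_one_iff by auto
  qed
  have plus: "oa_plus A (h p) (h q) = (if ba_meet C p q = ba_zero C then Some (h (ba_join C p q)) else None)"
    if p: "p \<in> ba_carrier C" and q: "q \<in> ba_carrier C" for p q
  proof -
    have pq: "fst p \<in> ba_carrier ?P" "snd p \<in> ba_carrier ?Q" "fst q \<in> ba_carrier ?P" "snd q \<in> ba_carrier ?Q"
      using p q by (auto simp: carC)
    have z: "ba_meet C p q = ba_zero C \<longleftrightarrow>
      ba_meet ?P (fst p) (fst q) = oa_zero A \<and> ba_meet ?Q (snd p) (snd q) = oa_zero A"
      by (simp add: C_def product_boolalg_def P0)
    show ?thesis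
    proof (cases "ba_meet C p q = ba_zero C")
      case True
      have j: "ba_join C p q \<in> ba_carrier C" using p q by simp
      have 1: "oa_plus A (fst p) (fst q) = Some (fst (ba_join C p q))"
        using Pplus[OF pq(1,3)] True z by (simp add: C_def product_boolalg_def)
      have 2: "oa_plus A (snd p) (snd q) = Some (snd (ba_join C p q))"
        using Qplus[OF pq(2,4)] True z by (simp add: C_def product_boolalg_def)
      have "oa_plus A (h p) (h q) = Some (h (ba_join C p q))"
        using plus_interchange[OF inA(1)[OF p] inA(1)[OF q] inA(2)[OF p] inA(2)[OF q] 1 2 key(1)[OF j]]
          key(1)[OF p] key(1)[OF q] by auto
      then show ?thesis using True by simp
    next
      case False
      have "oa_plus A (h p) (h q) = None"
      proof (rule ccontr)
        assume "oa_plus A (h p) (h q) \<noteq> None"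
        then obtain r where r: "oa_plus A (h p) (h q) = Some r" by blast
        obtain u v where "oa_plus A (fst p) (fst q) = Some u" "oa_plus A (snd p) (snd q) = Some v"
          using plus_interchange[OF inA(1)[OF p] inA(2)[OF p] inA(1)[OF q] inA(2)[OF q] key(1)[OF p] key(1)[OF q] r]
          by blast
        then show False using Pplus[OF pq(1,3)] Qplus[OF pq(2,4)] False z by (simp split: if_splits)
      qed
      then show ?thesis using False by simp
    qed
  qed
  have "inj_on h (ba_carrier C)"
  proof (rule inj_onI)
    fix p q assume p: "p \<in> ba_carrier C" and q: "q \<in> ba_carrier C" and e: "h p = h q"
    have le: "ba_meet C x (ba_compl C y) = ba_zero C"
      if "x \<in> ba_carrier C" "y \<in> ba_carrier C" "h x = h y" for x y
    proof -
      have "oa_plus A (h x) (h (ba_compl C y)) = Some (oa_one A)"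
        using that key(2,3)[OF that(2)] plus_compl by simp
      then show ?thesis using plus[OF that(1) C.compl_closed[OF that(2)]] by (simp split: if_splits)
    qed
    show "p = q"
    proof (rule C.valuation_eqI[OF p q])
      fix v assume v: "valuation C v"
      show "v p = v q" using arg_cong[OF le[OF p q e], of v] arg_cong[OF le[OF q p e[symmetric]], of v] v p q
        by auto
    qed
  qed
  moreover have "h (ba_zero C) = oa_zero A" "h (ba_one C) = oa_one A"
    using plus_zero[OF zero_closed] a'a by (simp_all add: h_def C_def product_boolalg_def P0)
  ultimately have "boolean_structure A (h ` ba_carrier C) (transport_boolalg h C)"
    using boolean_structure_transport[OF \<open>boolalg C\<close>, of h A] key(3) plus by blast
  moreover have "amalgam S R a = h ` ba_carrier C"
  proof -
    have "amalgam S R a = {m. \<exists>p\<in>ba_carrier C. oa_plus A (fst p) (snd p) = Some m}"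
      unfolding amalgam_def carC P Q a'_def[symmetric] by auto
    also have "\<dots> = h ` ba_carrier C" using key(1) by force
    finally show ?thesis .
  qed
  ultimately show ?thesis using BSub_iff key(2) by auto
qed

lemma amalgam_least:
  assumes N: "N \<in> BSub A" "S \<subseteq> N" "R \<subseteq> N"
  shows "amalgam S R a \<subseteq> N"
proof
  fix m assume "m \<in> amalgam S R a"
  then obtain s t where "s \<in> S" "t \<in> R" "oa_plus A s t = Some m" unfolding amalgam_def by blast
  then show "m \<in> N" using BSub_closed(5)[OF N(1), of s t m] N(2,3) by blast
qed

lemma four_compl_eq: "a \<in> oa_carrier A \<Longrightarrow> oa_four A (oa_compl A a) = oa_four A a"
  by (auto simp: oa_four_def compl_compl)

lemma amalgam_commute:
  assumes S: "S \<in> BSub A" "a \<in> S" and R: "R \<in> BSub A" "a \<in> R"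
  shows "amalgam R S (oa_compl A a) = amalgam S R a"
proof -
  have "oa_plus A s t = oa_plus A t s" if "s \<in> S" "t \<in> R" for s t
    using that plus_commute BSub_closed(6)[OF S(1)] BSub_closed(6)[OF R(1)] by blast
  moreover have "oa_compl A (oa_compl A a) = a" using compl_compl BSub_closed(6)[OF S] by blast
  ultimately show ?thesis by (fastforce simp: amalgam_def)
qed

text \<open>
  An element of \<open>S\<close> is the sum of its parts below \<open>a'\<close> and \<open>a\<close>; the second part is in
  \<open>psub a\<close>, hence in \<open>four a\<close>, hence in \<open>R\<close>.
\<close>

lemma subset_amalgam:
  assumes S: "S \<in> BSub A" "a \<in> S" and R: "R \<in> BSub A" "a \<in> R"
    and p: "oa_psub A S a \<subseteq> oa_four A a"
  shows "S \<subseteq> amalgam S R a"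
proof
  obtain B where B: "boolean_structure A S B" using obtain_structure S by blast
  interpret B: boolalg B using boolean_structureD(1)[OF B] .
  note b = boolean_structureD[OF B]
  have aC: "a \<in> ba_carrier B" using S b by simp
  fix t assume t: "t \<in> S"
  define r s where "r = ba_meet B t a" and "s = ba_meet B t (ba_compl B a)"
  have tC: "t \<in> ba_carrier B" using t b by simp
  have rs: "r \<in> ba_carrier B" "s \<in> ba_carrier B" using tC aC by (auto simp: r_def s_def)
  have "r \<in> psub B a" using tC aC by (auto simp: r_def B.mem_psub_iff)
  then have "r \<in> oa_four A a" using p psub_eq_oa_psub[OF B S(2)] by auto
  then have rR: "r \<in> R" using BSub_closed(2,3,4)[OF R(1)] R(2) by (auto simp: oa_four_def)
  have "ba_meet B s a = ba_zero B" "ba_meet B r (ba_compl B a) = ba_zero B" "ba_meet B s r = ba_zero B"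
    "ba_join B s r = t"
    unfolding r_def s_def using tC aC by (intro B.valuation_eqI; auto)+
  then have "oa_plus A s a \<noteq> None" "oa_plus A r (oa_compl A a) \<noteq> None" "oa_plus A s r = Some t"
    using b(6)[of s a] b(6)[of r "oa_compl A a"] b(6)[of s r] b(5)[OF S(2)] rs aC B.compl_closed[OF aC] b(2)
    by simp_all
  then show "t \<in> amalgam S R a" using rs b(2) rR unfolding amalgam_def by blast
qed

lemma card_amalgam:
  assumes S: "S \<in> BSub A" "a \<in> S" and R: "R \<in> BSub A" "a \<in> R"
    and fS: "finite {s \<in> S. oa_plus A s a \<noteq> None}" "card {s \<in> S. oa_plus A s a \<noteq> None} \<le> 4"
    and fR: "finite {s \<in> R. oa_plus A s (oa_compl A a) \<noteq> None}"
      "card {s \<in> R. oa_plus A s (oa_compl A a) \<noteq> None} \<le> 4"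
  shows "finite (amalgam S R a)" "card (amalgam S R a) \<le> 16"
proof -
  let ?P = "{s \<in> S. oa_plus A s a \<noteq> None}" and ?Q = "{s \<in> R. oa_plus A s (oa_compl A a) \<noteq> None}"
  have sub: "amalgam S R a \<subseteq> (\<lambda>(s, t). the (oa_plus A s t)) ` (?P \<times> ?Q)"
    by (force simp: amalgam_def)
  have "card (?P \<times> ?Q) \<le> 4 * 4" unfolding card_cartesian_product using fS fR by (intro mult_mono) auto
  then have "card ((\<lambda>(s, t). the (oa_plus A s t)) ` (?P \<times> ?Q)) \<le> 16"
    using card_image_le[of "?P \<times> ?Q" "\<lambda>(s, t). the (oa_plus A s t)"] fS fR by simp
  moreover have "finite ((\<lambda>(s, t). the (oa_plus A s t)) ` (?P \<times> ?Q))" using fS fR by simp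
  ultimately show "finite (amalgam S R a)" "card (amalgam S R a) \<le> 16"
    using finite_subset[OF sub] card_mono[OF _ sub] by auto
qed

lemma card_perp_of_cover:
  assumes S: "S \<in> BSub A" "a \<in> S" and ne: "S \<noteq> oa_four A a"
    and cover: "\<And>T. T \<in> BSub A \<Longrightarrow> oa_four A a \<subset> T \<Longrightarrow> T \<subset> S \<Longrightarrow> False"
  shows "finite {s \<in> S. oa_plus A s a \<noteq> None}" "card {s \<in> S. oa_plus A s a \<noteq> None} \<le> 4"
proof -
  obtain B where B: "boolean_structure A S B" using obtain_structure S by blast
  interpret B: boolalg B using boolean_structureD(1)[OF B] .
  note b = boolean_structureD[OF B]
  have aC: "a \<in> ba_carrier B" using S b by simp
  have e: "{s \<in> S. oa_plus A s a \<noteq> None} = {s \<in> ba_carrier B. ba_meet B s a = ba_zero B}"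
  proof -
    have "oa_plus A s a \<noteq> None \<longleftrightarrow> ba_meet B s a = ba_zero B" if "s \<in> S" for s
      using b(6)[OF that S(2)] by simp
    then show ?thesis unfolding b(2) by blast
  qed
  have *: "False" if "T \<in> Sub B" "four B a \<subset> T" "T \<subset> ba_carrier B" for T
    using that cover[of T] down_BSub_eq_Sub[OF S(1) B] four_eq_oa_four[OF B S(2)] b(2)
    by (auto simp: down_in_def)
  show "finite {s \<in> S. oa_plus A s a \<noteq> None}" "card {s \<in> S. oa_plus A s a \<noteq> None} \<le> 4"
    unfolding e using B.card_below_compl_of_cover[OF aC _ *] ne four_eq_oa_four[OF B S(2)] b(2) by auto
qed

lemma card_BSub_less:
  assumes S: "S \<in> BSub A" and T: "T \<in> BSub A" "S \<subset> T" "finite T"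
  shows "2 * card S \<le> card T"
proof -
  obtain B where B: "boolean_structure A T B" using obtain_structure T by blast
  interpret B: boolalg B using boolean_structureD(1)[OF B] .
  have "S \<in> Sub B" "T \<in> Sub B" using down_BSub_eq_Sub[OF T(1) B] S T by (auto simp: down_in_def)
  then show ?thesis using B.card_Sub_less T by blast
qed

lemma card_four:
  assumes a: "a \<in> oa_carrier A" "a \<noteq> oa_zero A" "a \<noteq> oa_one A"
  shows "card (oa_four A a) = 4"
proof -
  have "a \<noteq> oa_compl A a" using plus_compl[OF a(1)] plus_self_defined_iff[OF a(1)] a by auto
  moreover have "oa_zero A \<noteq> oa_one A" using plus_zero[OF a(1)] plus_one_defined[OF a(1)] a by metis
  moreover have "oa_compl A a \<noteq> oa_zero A" "oa_compl A a \<noteq> oa_one A"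
    using compl_compl[OF a(1)] compl_zero compl_one a by metis+
  ultimately show ?thesis using a by (simp add: oa_four_def)
qed

text \<open>
  Inside \<open>S\<close>, the traces of \<open>R\<close> on \<open>psub a\<close> and on \<open>psub a'\<close> would both be trivial.
\<close>

lemma amalgam_ne:
  assumes S: "S \<in> BSub A" "a \<in> S" and R: "R \<in> BSub A" "a \<in> R" "R \<noteq> oa_four A a"
    and p: "oa_psub A S a = oa_four A a" "oa_psub A R (oa_compl A a) = oa_four A a"
  shows "\<not> R \<subseteq> S"
proof
  assume RS: "R \<subseteq> S"
  obtain B where B: "boolean_structure A S B" using obtain_structure S by blast
  interpret B: boolalg B using boolean_structureD(1)[OF B] .
  note b = boolean_structureD[OF B]
  have aC: "a \<in> ba_carrier B" using S b by simp
  have c: "ba_compl B a = oa_compl A a" using b(5) S by simp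
  have RB: "R \<in> Sub B" using down_BSub_eq_Sub[OF S(1) B] RS R by (auto simp: down_in_def)
  have "R \<inter> psub B a \<subseteq> four B a" using p(1) psub_eq_oa_psub[OF B S(2)] four_eq_oa_four[OF B S(2)] by auto
  moreover have "R \<inter> psub B (ba_compl B a) \<subseteq> four B a"
    using p(2) RS psub_eq_oa_psub[OF B BSub_closed(4)[OF S]] four_eq_oa_four[OF B S(2)] unfolding c
    by (auto simp: oa_psub_def)
  ultimately have "R = four B a" using B.eq_four_of_psub[OF aC RB R(2)] by blast
  then show False using R(3) four_eq_oa_four[OF B S(2)] by simp
qed

text \<open>
  The hypotheses exclude \<open>a = 0\<close> and \<open>a = 1\<close>, so \<open>four a\<close> has four elements and \<open>S\<close>
  has at least eight.  The amalgam has at most sixteen, which leaves no room for a subalgebra strictly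
  between \<open>S\<close> and the amalgam.
\<close>

lemma amalgam_cover:
  assumes S: "S \<in> BSub A" "a \<in> S" "S \<noteq> oa_four A a" and R: "R \<in> BSub A" "a \<in> R" "R \<noteq> oa_four A a"
    and p: "oa_psub A S a = oa_four A a" "oa_psub A R (oa_compl A a) = oa_four A a"
    and cS: "\<And>T. T \<in> BSub A \<Longrightarrow> oa_four A a \<subset> T \<Longrightarrow> T \<subset> S \<Longrightarrow> False"
    and cR: "\<And>T. T \<in> BSub A \<Longrightarrow> oa_four A a \<subset> T \<Longrightarrow> T \<subset> R \<Longrightarrow> False"
  shows "finite (amalgam S R a)" "card (amalgam S R a) \<le> 16"
    "S \<subset> amalgam S R a"
    "\<And>N. N \<in> BSub A \<Longrightarrow> S \<subset> N \<Longrightarrow> N \<subset> amalgam S R a \<Longrightarrow> False"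
proof -
  have aA: "a \<in> oa_carrier A" using BSub_closed(6)[OF S(1,2)] .
  have f': "oa_four A (oa_compl A a) = oa_four A a" using four_compl_eq aA by blast
  have a'R: "oa_compl A a \<in> R" using BSub_closed(4)[OF R(1,2)] .
  have a'S: "oa_compl A a \<in> S" using BSub_closed(4)[OF S(1,2)] .
  have M: "amalgam S R a \<in> BSub A" using amalgam_in_BSub S R by blast
  have PS: "finite {s \<in> S. oa_plus A s a \<noteq> None}" "card {s \<in> S. oa_plus A s a \<noteq> None} \<le> 4"
    using card_perp_of_cover[OF S] cS by blast+
  have neR: "R \<noteq> oa_four A (oa_compl A a)" using R(3) f' by simp
  have cR': "\<And>T. T \<in> BSub A \<Longrightarrow> oa_four A (oa_compl A a) \<subset> T \<Longrightarrow> T \<subset> R \<Longrightarrow> False"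
    unfolding f' by (rule cR)
  have PR: "finite {s \<in> R. oa_plus A s (oa_compl A a) \<noteq> None}"
      "card {s \<in> R. oa_plus A s (oa_compl A a) \<noteq> None} \<le> 4"
    using card_perp_of_cover[OF R(1) a'R neR] cR' by blast+
  show fin: "finite (amalgam S R a)" and card: "card (amalgam S R a) \<le> 16"
    using card_amalgam[OF S(1,2) R(1,2) PS PR] by blast+
  have SM: "S \<subseteq> amalgam S R a" using subset_amalgam[OF S(1,2) R(1,2)] p(1) by blast
  have "R \<subseteq> amalgam R S (oa_compl A a)"
    using subset_amalgam[OF R(1) a'R S(1) a'S] p(2) f' by simp
  then have RM: "R \<subseteq> amalgam S R a" using amalgam_commute[OF S(1,2) R(1,2)] by simp
  show ss: "S \<subset> amalgam S R a" using SM RM amalgam_ne[OF S(1,2) R p] by blast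
  fix N assume N: "N \<in> BSub A" "S \<subset> N" "N \<subset> amalgam S R a"
  have "a \<noteq> oa_zero A"
  proof
    assume z: "a = oa_zero A"
    have "t \<in> oa_psub A R (oa_compl A a)" if "t \<in> R" for t
      using plus_zero[OF BSub_closed(6)[OF R(1) that]] that
      by (simp add: oa_psub_def z compl_zero compl_one)
    then have "R \<subseteq> oa_four A a" using p by auto
    moreover have "oa_four A a \<subseteq> R" using BSub_closed(2-4)[OF R(1)] R(2) by (auto simp: oa_four_def)
    ultimately show False using R(3) by blast
  qed
  moreover have "a \<noteq> oa_one A"
  proof
    assume z: "a = oa_one A"
    have "t \<in> oa_psub A S a" if "t \<in> S" for t
      using plus_zero[OF BSub_closed(6)[OF S(1) that]] that by (simp add: oa_psub_def z compl_one)
    then have "S \<subseteq> oa_four A a" using p by auto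
    moreover have "oa_four A a \<subseteq> S" using BSub_closed(2-4)[OF S(1)] S(2) by (auto simp: oa_four_def)
    ultimately show False using S(3) by blast
  qed
  ultimately have c4: "card (oa_four A a) = 4" using card_four aA by blast
  obtain B where B: "boolean_structure A S B" using obtain_structure S by blast
  interpret B: boolalg B using boolean_structureD(1)[OF B] .
  have "four B a \<in> Sub B" using B.four_in_Sub S boolean_structureD[OF B] by blast
  then have "oa_four A a \<in> BSub A" "oa_four A a \<subseteq> S"
    using down_BSub_eq_Sub[OF S(1) B] four_eq_oa_four[OF B S(2)] by (auto simp: down_in_def)
  then have "2 * card (oa_four A a) \<le> card S"
    using card_BSub_less[OF _ S(1)] S(3) finite_subset[OF SM fin] by blast
  moreover have "2 * card S \<le> card N" using card_BSub_less[OF S(1) N(1,2)] N finite_subset fin by blast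
  moreover have "2 * card N \<le> card (amalgam S R a)" using card_BSub_less[OF N(1) M N(3) fin] .
  ultimately show False using c4 card by linarith
qed

end

section \<open>Directions of the poset of Boolean subalgebras of height at most three\<close>

lemma is_least_down_iff:
  assumes "is_least X b" "w \<in> X"
  shows "is_least (down_in X w) c \<longleftrightarrow> c = b"
proof -
  have "is_least (down_in X w) b" using assms by (auto simp: is_least_def down_in_def)
  then show ?thesis using is_least_unique by blast
qed

lemma covers_down_iff: "x \<in> down_in X w \<Longrightarrow> covers (down_in X w) y x \<longleftrightarrow> covers X y x"
  unfolding covers_def down_in_def by (auto dest: order.strict_trans1 less_imp_le intro: order.trans)

lemma basic_down_iff:
  assumes b: "is_least X b" and w: "w \<in> X" and x: "x \<in> down_in X w"
  shows "basic (down_in X w) x \<longleftrightarrow> basic X x"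
proof -
  have "is_least X c \<longleftrightarrow> c = b" for c using b is_least_unique by blast
  then show ?thesis
    unfolding basic_def is_atom_def is_least_down_iff[OF b w] covers_down_iff[OF x] by simp
qed

lemma is_glb_down:
  assumes "y \<in> down_in X w" "v \<in> X" "is_glb (down_in X w) {y, v'} u" "v' = v"
  shows "is_glb X {y, v} u"
  unfolding is_glb_def
proof (intro conjI ballI impI)
  show "u \<in> X" "\<And>s. s \<in> {y, v} \<Longrightarrow> u \<le> s" using assms by (auto simp: is_glb_def down_in_def)
  fix t assume t: "t \<in> X" "\<forall>s\<in>{y, v}. t \<le> s"
  then have "t \<in> down_in X w" using assms(1) by (auto simp: down_in_def)
  then show "t \<le> u" using assms t by (auto simp: is_glb_def)
qed

text \<open>
  Meets in \<open>X\<close> of elements with a common upper bound \<open>w\<close> are the meets of the lattice \<open>\<down>w\<close>.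
\<close>

lemma meet_in_down:
  assumes "boolean_chart B (down_in X w) g" "y \<in> down_in X w" "v \<in> down_in X w"
  shows "meet_in X y v = meet_in (down_in X w) y v"
proof -
  interpret boolean_chart B "down_in X w" g by fact
  have "is_glb (down_in X w) {y, v} (meet_in (down_in X w) y v)"
    using is_glb_iff[OF assms(2,3)] meet_in[OF assms(2,3)] by simp
  then show ?thesis using is_glb_down assms meet_in_eq by (metis (no_types, lifting) down_in_def mem_Collect_eq)
qed

lemma star_down_closed: "S \<in> star Y \<Longrightarrow> T \<in> Y \<Longrightarrow> T \<le> S \<Longrightarrow> T \<in> star Y"
  using height_mono[of T S Y] by (auto simp: star_def)

text \<open>
  A poset isomorphic to \<open>star (BSub A)\<close>.  Directions are built directly on \<open>X\<close>, through \<open>f\<close>.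
\<close>

locale oa_model = orthoalgebra A for A :: "'a orthoalg" +
  fixes X :: "'x::order set" and f :: "'x \<Rightarrow> 'a set"
  assumes f_bij: "bij_betw f X (star (BSub A))"
    and f_le: "x \<in> X \<Longrightarrow> y \<in> X \<Longrightarrow> x \<le> y \<longleftrightarrow> f x \<subseteq> f y"
begin

abbreviation fi :: "'a set \<Rightarrow> 'x" where "fi \<equiv> inv_into X f"

lemma f_star: "x \<in> X \<Longrightarrow> f x \<in> star (BSub A)"
  using f_bij bij_betwE by blast

lemma f_BSub: "x \<in> X \<Longrightarrow> f x \<in> BSub A"
  using f_star by (auto simp: star_def)

lemma fi_in: "S \<in> star (BSub A) \<Longrightarrow> fi S \<in> X"
  using f_bij by (auto simp: bij_betw_def inv_into_into)

lemma f_fi: "S \<in> star (BSub A) \<Longrightarrow> f (fi S) = S"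
  using f_bij by (auto simp: bij_betw_def f_inv_into_f)

lemma f_less: "x \<in> X \<Longrightarrow> y \<in> X \<Longrightarrow> x < y \<longleftrightarrow> f x \<subset> f y"
  using f_le[of x y] f_le[of y x] by (auto simp: less_le_not_le)

lemma sub_star: "x \<in> X \<Longrightarrow> T \<in> BSub A \<Longrightarrow> T \<subseteq> f x \<Longrightarrow> T \<in> star (BSub A)"
  using star_down_closed f_star by blast

lemma bij_down:
  assumes w: "w \<in> X"
  shows "bij_betw f (down_in X w) (down_in (BSub A) (f w))"
proof (rule bij_betw_imageI)
  show "inj_on f (down_in X w)" using f_bij by (auto simp: bij_betw_def inj_on_def down_in_def)
  show "f ` down_in X w = down_in (BSub A) (f w)"
  proof (intro subset_antisym subsetI)
    fix S assume "S \<in> f ` down_in X w"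
    then show "S \<in> down_in (BSub A) (f w)" using f_BSub f_le w by (auto simp: down_in_def)
  next
    fix S assume S: "S \<in> down_in (BSub A) (f w)"
    then have "S \<in> star (BSub A)" using sub_star[OF w] by (auto simp: down_in_def)
    then have "fi S \<in> down_in X w" "f (fi S) = S"
      using fi_in f_fi f_le w S by (auto simp: down_in_def)
    then show "S \<in> f ` down_in X w" by force
  qed
qed

lemma chart:
  assumes w: "w \<in> X" and B: "boolean_structure A (f w) B"
  shows "boolean_chart B (down_in X w) f"
proof -
  interpret B: boolalg B using boolean_structureD(1)[OF B] .
  show ?thesis
  proof
    show "bij_betw f (down_in X w) (Sub B)" using bij_down[OF w] down_BSub_eq_Sub[OF f_BSub[OF w] B] by simp
  qed (use f_le in \<open>simp add: down_in_def\<close>)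
qed

lemma short_X: "short X"
proof -
  have "height X x \<le> 3" if x: "x \<in> X" for x
  proof -
    have "height X x = height (BSub A) (f x)"
      using height_iso[OF bij_down[OF x]] f_le by (simp add: down_in_def)
    then show ?thesis using f_star[OF x] by (simp add: star_def)
  qed
  then show ?thesis by (auto simp: short_def star_def)
qed

lemma bottom_BSub:
  assumes x: "x \<in> X"
  shows "{oa_zero A, oa_one A} \<in> BSub A"
proof -
  obtain B where B: "boolean_structure A (f x) B" using obtain_structure f_BSub[OF x] by blast
  interpret boolean_chart B "down_in X x" f by (rule chart[OF x B])
  have "{oa_zero A, oa_one A} \<in> down_in (BSub A) (f x)"
    using bottom_in_Sub down_BSub_eq_Sub[OF f_BSub[OF x] B] boolean_structureD(3,4)[OF B] by simp
  then show ?thesis by (simp add: down_in_def)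
qed

lemma least_X:
  assumes x: "x \<in> X"
  shows "is_least X (fi {oa_zero A, oa_one A})"
proof -
  have S: "{oa_zero A, oa_one A} \<in> star (BSub A)"
    using sub_star[OF x bottom_BSub[OF x]] BSub_closed(2,3)[OF f_BSub[OF x]] by simp
  show ?thesis
    unfolding is_least_def using fi_in[OF S] f_le f_fi[OF S] BSub_closed(2,3)[OF f_BSub] by simp
qed

lemma basic_X_iff: "basic X x \<longleftrightarrow> x \<in> X \<and> (\<exists>a\<in>f x. f x = oa_four A a)"
proof (cases "x \<in> X")
  case x: True
  obtain B where B: "boolean_structure A (f x) B" using obtain_structure f_BSub[OF x] by blast
  interpret boolean_chart B "down_in X x" f by (rule chart[OF x B])
  have xd: "x \<in> down_in X x" using x by (simp add: down_in_def)
  have "basic X x \<longleftrightarrow> (\<exists>a\<in>f x. f x = four B a)"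
    using basic_down_iff[OF least_X[OF x] x xd] basic_iff[of x] xd boolean_structureD(2)[OF B] by simp
  also have "\<dots> \<longleftrightarrow> (\<exists>a\<in>f x. f x = oa_four A a)" using four_eq_oa_four[OF B] by auto
  finally show ?thesis using x by simp
next
  case False
  then show ?thesis by (auto simp: basic_def is_atom_def is_least_def covers_def)
qed

text \<open>
  The direction that orients every Boolean subalgebra \<open>S\<close> of height at most \<open>3\<close> containing \<open>a\<close> by the pair
  \<open>(psub a, psub a')\<close> of \<open>S\<close>.
\<close>

definition dir_of :: "'a \<Rightarrow> 'x dir" where
  "dir_of a = (\<lambda>w. if w \<in> X \<and> a \<in> f w
     then Some (fi (oa_psub A (f w) a), fi (oa_psub A (f w) (oa_compl A a))) else None)"

lemma psub_star:
  assumes w: "w \<in> X" and a: "a \<in> f w"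
  shows "oa_psub A (f w) a \<in> star (BSub A)"
proof -
  obtain B where B: "boolean_structure A (f w) B" using obtain_structure f_BSub[OF w] by blast
  interpret boolean_chart B "down_in X w" f by (rule chart[OF w B])
  have "psub B a \<in> Sub B" using psub_in_Sub a boolean_structureD[OF B] by simp
  then have "oa_psub A (f w) a \<in> down_in (BSub A) (f w)"
    using down_BSub_eq_Sub[OF f_BSub[OF w] B] psub_eq_oa_psub[OF B a] by simp
  then show ?thesis using sub_star[OF w] by (simp add: down_in_def)
qed

lemma dir_of_principal:
  assumes w: "w \<in> X" and a: "a \<in> f w" and x: "x \<in> X" "f x = oa_four A a"
  shows "principal_pair_for (down_in X w) x
    (fi (oa_psub A (f w) a), fi (oa_psub A (f w) (oa_compl A a)))"
proof -
  obtain B where B: "boolean_structure A (f w) B" using obtain_structure f_BSub[OF w] by blast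
  interpret boolean_chart B "down_in X w" f by (rule chart[OF w B])
  note b = boolean_structureD[OF B]
  have a': "oa_compl A a \<in> f w" using BSub_closed(4)[OF f_BSub[OF w] a] .
  have aC: "a \<in> ba_carrier B" using a b by simp
  have fx: "f x \<subseteq> f w" using x BSub_closed(2,3)[OF f_BSub[OF w]] a a' by (auto simp: oa_four_def)
  have sub: "oa_psub A (f w) t \<subseteq> f w" for t by (auto simp: oa_psub_def)
  show ?thesis
  proof (rule principal_pair_forI[OF aC])
    show "x \<in> down_in X w" using x w fx f_le by (simp add: down_in_def)
    show "fi (oa_psub A (f w) a) \<in> down_in X w" "fi (oa_psub A (f w) (oa_compl A a)) \<in> down_in X w"
      using psub_star[OF w a] psub_star[OF w a'] fi_in f_fi f_le w sub by (auto simp: down_in_def)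
    show "f x = four B a" using x four_eq_oa_four[OF B a] by simp
    show "f (fi (oa_psub A (f w) a)) = psub B a" using psub_star[OF w a] f_fi psub_eq_oa_psub[OF B a] by simp
    show "f (fi (oa_psub A (f w) (oa_compl A a))) = psub B (ba_compl B a)"
      using psub_star[OF w a'] f_fi psub_eq_oa_psub[OF B a'] b(5)[OF a] by simp
  qed
qed

lemma meet_psub:
  assumes y: "y \<in> X" and z: "z \<in> X" and yz: "y \<le> z" and a: "a \<in> f y"
  shows "meet_in X y (fi (oa_psub A (f z) a)) = fi (oa_psub A (f y) a)"
proof -
  have fyz: "f y \<subseteq> f z" using f_le y z yz by simp
  have az: "a \<in> f z" using a fyz by blast
  note Sy = psub_star[OF y a] and Sz = psub_star[OF z az]
  have "is_glb X {y, fi (oa_psub A (f z) a)} (fi (oa_psub A (f y) a))"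
    unfolding is_glb_def
  proof (intro conjI ballI impI)
    show "fi (oa_psub A (f y) a) \<in> X" using fi_in[OF Sy] .
    show "fi (oa_psub A (f y) a) \<le> s" if "s \<in> {y, fi (oa_psub A (f z) a)}" for s
      using that y fi_in[OF Sy] fi_in[OF Sz] fyz by (auto simp: f_le f_fi[OF Sy] f_fi[OF Sz]) (auto simp: oa_psub_def)
    fix v assume v: "v \<in> X" "\<forall>s\<in>{y, fi (oa_psub A (f z) a)}. v \<le> s"
    then have "f v \<subseteq> f y" "f v \<subseteq> oa_psub A (f z) a"
      using y fi_in[OF Sz] by (auto simp: f_le f_fi[OF Sz])
    then have "f v \<subseteq> oa_psub A (f y) a" unfolding oa_psub_def by blast
    then show "v \<le> fi (oa_psub A (f y) a)"
      using v(1) fi_in[OF Sy] by (simp add: f_le f_fi[OF Sy])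
  qed
  then show ?thesis by (rule meet_in_eq)
qed

text \<open>
  Condition (3) for directions.  Here \<open>a\<close> is an atom of \<open>f y\<close> and \<open>a'\<close> is an atom of \<open>f z\<close>, and
  the required join is the amalgam of these two subalgebras along \<open>a\<close>.
\<close>

lemma dir_of_amalgam:
  assumes x: "x \<in> X" "a \<in> f x" "f x = oa_four A a" and y: "y \<in> X" "x < y" and z: "z \<in> X" "x < z"
    and cy: "covers X x y" and cz: "covers X x z"
    and py: "oa_psub A (f y) a = oa_four A a" and pz: "oa_psub A (f z) (oa_compl A a) = oa_four A a"
  shows "\<exists>u. is_lub X {y, z} u \<and> covers X y u \<and> covers X z u"
proof -
  have ay: "a \<in> f y" and az: "a \<in> f z" using x y z f_less by blast+
  have aA: "a \<in> oa_carrier A" using BSub_closed(6)[OF f_BSub[OF x(1)] x(2)] .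
  note a'y = BSub_closed(4)[OF f_BSub[OF y(1)] ay] and a'z = BSub_closed(4)[OF f_BSub[OF z(1)] az]
  have ne: "f y \<noteq> oa_four A a" "f z \<noteq> oa_four A a" using x y z f_less by blast+
  have cov: "False" if "covers X x w" "T \<in> BSub A" "oa_four A a \<subset> T" "T \<subset> f w" for T w
  proof -
    have w: "w \<in> X" using that by (simp add: covers_def)
    have T: "T \<in> star (BSub A)" using sub_star[OF w that(2)] that by blast
    have "x < fi T" "fi T < w" using that x w fi_in[OF T] f_fi[OF T] f_less by auto
    then show False using that(1) fi_in[OF T] by (auto simp: covers_def)
  qed
  let ?M = "amalgam (f y) (f z) a"
  have f4: "oa_four A (oa_compl A a) = oa_four A a" using four_compl_eq aA by simp
  have M': "amalgam (f z) (f y) (oa_compl A a) = ?M"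
    using amalgam_commute[OF f_BSub[OF y(1)] ay f_BSub[OF z(1)] az] .
  have 1: "finite ?M" "card ?M \<le> 16" "f y \<subset> ?M" "\<And>N. N \<in> BSub A \<Longrightarrow> f y \<subset> N \<Longrightarrow> N \<subset> ?M \<Longrightarrow> False"
    using amalgam_cover[OF f_BSub[OF y(1)] ay ne(1) f_BSub[OF z(1)] az ne(2) py pz]
      cov[OF cy] cov[OF cz] by blast+
  have 2: "f z \<subset> ?M" "\<And>N. N \<in> BSub A \<Longrightarrow> f z \<subset> N \<Longrightarrow> N \<subset> ?M \<Longrightarrow> False"
    using amalgam_cover(3,4)[OF f_BSub[OF z(1)] a'z _ f_BSub[OF y(1)] a'y, unfolded f4 M' compl_compl[OF aA]]
      ne py pz cov[OF cy] cov[OF cz] by blast+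
  have MB: "?M \<in> BSub A" using amalgam_in_BSub[OF f_BSub[OF y(1)] ay f_BSub[OF z(1)] az] .
  then have M: "?M \<in> star (BSub A)" using card_le_16_height[OF MB 1(1,2)] by (simp add: star_def)
  define u where "u = fi ?M"
  have u: "u \<in> X" "f u = ?M" using fi_in[OF M] f_fi[OF M] by (auto simp: u_def)
  have "is_lub X {y, z} u"
    unfolding is_lub_def
  proof (intro conjI ballI impI)
    show "u \<in> X" by fact
    show "s \<le> u" if "s \<in> {y, z}" for s using that y z u 1(3) 2(1) by (auto simp: f_le)
    show "u \<le> v" if "v \<in> X" "\<forall>s\<in>{y, z}. s \<le> v" for v
      using that y z u amalgam_least[OF f_BSub[OF that(1)], of "f y" "f z" a] by (simp add: f_le)
  qed
  moreover have "covers X y u"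
    using y u 1(3,4) f_BSub unfolding covers_def by (simp add: f_less) blast
  moreover have "covers X z u"
    using z u 2 f_BSub unfolding covers_def by (simp add: f_less) blast
  ultimately show ?thesis by blast
qed

lemma dir_of_direction:
  assumes x: "x \<in> X" "a \<in> f x" "f x = oa_four A a"
  shows "is_direction X x (dir_of a)"
proof -
  have up: "w \<in> up_in X x \<longleftrightarrow> w \<in> X \<and> a \<in> f w" for w
  proof (cases "w \<in> X")
    case True
    have "f x \<subseteq> f w \<longleftrightarrow> a \<in> f w"
      using x BSub_closed(2,3,4)[OF f_BSub[OF True]] by (auto simp: oa_four_def)
    then show ?thesis using True x f_le by (simp add: up_in_def)
  qed (simp add: up_in_def)
  have a'in: "oa_compl A a \<in> f w" if "w \<in> X" "a \<in> f w" for w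
    using BSub_closed(4)[OF f_BSub[OF that(1)] that(2)] .
  show ?thesis
    unfolding is_direction_def
  proof (intro conjI ballI allI impI; (elim conjE)?)
    show "basic X x" using basic_X_iff x by blast
    show "dom (dir_of a) = up_in X x" using up by (auto simp: dir_of_def dom_def split: if_splits)
    show "principal_pair_for (down_in X w) x p" if "w \<in> up_in X x" "dir_of a w = Some p" for w p
      using that dir_of_principal[of w a x] x up by (auto simp: dir_of_def)
    show "dir_of a y = Some (meet_in X y v, meet_in X y w)"
      if "y \<in> up_in X x" "z \<in> up_in X x" "y \<le> z" "dir_of a z = Some (v, w)" for y z v w
    proof -
      have yz: "y \<in> X" "a \<in> f y" "z \<in> X" "a \<in> f z" using that(1,2) up by blast+
      then have "v = fi (oa_psub A (f z) a)" "w = fi (oa_psub A (f z) (oa_compl A a))"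
        using that(4) by (auto simp: dir_of_def)
      then show ?thesis
        using meet_psub[OF yz(1,3) that(3) yz(2)] meet_psub[OF yz(1,3) that(3) a'in[OF yz(1,2)]] yz
        by (simp add: dir_of_def)
    qed
    show "\<exists>u. is_lub X {y, z} u \<and> covers X y u \<and> covers X z u"
      if "y \<in> up_in X x" "z \<in> up_in X x" and c: "covers X x y" "covers X x z"
        and d: "dir_of a y = Some (x, y)" "dir_of a z = Some (z, x)" for y z
    proof -
      have yz: "y \<in> X" "a \<in> f y" "z \<in> X" "a \<in> f z" using that(1,2) up by blast+
      then have e: "fi (oa_psub A (f y) a) = x" "fi (oa_psub A (f z) (oa_compl A a)) = x"
        using d by (auto simp: dir_of_def)
      have "oa_psub A (f y) a = oa_four A a" "oa_psub A (f z) (oa_compl A a) = oa_four A a"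
        using f_fi[OF psub_star[OF yz(1,2)]] f_fi[OF psub_star[OF yz(3) a'in[OF yz(3,4)]]] e x(3) by auto
      then show ?thesis using dir_of_amalgam[OF x yz(1) _ yz(3) _ c] c by (auto simp: covers_def)
    qed
  qed
qed

text \<open>
  A four-element subalgebra \<open>{0, 1, a, a'}\<close> is not a block, so it lies strictly inside some Boolean
  subalgebra.  Together with one more element \<open>c\<close> of the latter, \<open>a\<close> generates a subalgebra with at
  most sixteen elements, namely the joins of the four elements \<open>a \<sqinter> c\<close>, \<open>a \<sqinter> c'\<close>,
  \<open>a' \<sqinter> c\<close>, \<open>a' \<sqinter> c'\<close>; this one is still in the star.
\<close>

lemma proper_X:
  assumes proper: "oa_proper A"
  shows "od_proper X"
  unfolding od_proper_def
proof
  assume "\<exists>x. is_maximal X x \<and> basic X x"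
  then obtain x where max: "is_maximal X x" and "basic X x" by blast
  then obtain a where x: "x \<in> X" "a \<in> f x" "f x = oa_four A a" using basic_X_iff by blast
  have "finite (f x)" "card (f x) \<le> 4" unfolding x(3) oa_four_def by (auto simp: card_insert_if)
  then have "\<not> is_block A (f x)" using proper by (auto simp: oa_proper_def)
  then obtain S where S: "S \<in> BSub A" "f x \<subset> S"
    using f_BSub[OF x(1)] by (auto simp: is_block_def is_maximal_def)
  then obtain c where c: "c \<in> S" "c \<notin> f x" by blast
  obtain B where B: "boolean_structure A S B" using obtain_structure S by blast
  interpret B: boolalg B using boolean_structureD(1)[OF B] .
  note b = boolean_structureD[OF B]
  have C: "a \<in> ba_carrier B" "c \<in> ba_carrier B" using S x c b by auto
  define F where "F = {ba_meet B a c, ba_meet B a (ba_compl B c), ba_meet B (ba_compl B a) c,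
     ba_meet B (ba_compl B a) (ba_compl B c)}"
  have part: "partition_of_unity B F"
    unfolding partition_of_unity_def
  proof (intro conjI allI impI)
    show "finite F" "F \<subseteq> ba_carrier B" using C by (auto simp: F_def)
    fix v assume v: "valuation B v"
    show "\<exists>!f. f \<in> F \<and> v f"
    proof -
      have "\<exists>f\<in>F. v f" unfolding F_def using v C by simp blast
      moreover have "\<forall>f\<in>F. \<forall>g\<in>F. v f \<longrightarrow> v g \<longrightarrow> f = g" unfolding F_def using v C by simp
      ultimately show ?thesis by blast
    qed
  qed
  define T where "T = joins_of B F"
  have TS: "T \<in> Sub B" using B.joins_of_in_Sub[OF part] by (simp add: T_def)
  have FT: "F \<subseteq> T" using B.mem_joins_of part by (auto simp: T_def partition_of_unity_def)
  have "card F \<le> 4" "finite F" by (auto simp: F_def card_insert_if)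
  then have "finite T" "card T \<le> 16"
    using B.card_joins_of[of F] power_increasing[of "card F" 4 "2::nat"] by (auto simp: T_def)
  moreover have TB: "T \<in> BSub A" using down_BSub_eq_Sub[OF S(1) B] TS by (auto simp: down_in_def)
  ultimately have T: "T \<in> star (BSub A)" using card_le_16_height by (simp add: star_def)
  have "ba_join B (ba_meet B a c) (ba_meet B a (ba_compl B c)) \<in> T"
    "ba_join B (ba_meet B a c) (ba_meet B (ba_compl B a) c) \<in> T"
    using B.SubD(5)[OF TS] FT by (auto simp: F_def)
  moreover have "ba_join B (ba_meet B a c) (ba_meet B a (ba_compl B c)) = a"
    "ba_join B (ba_meet B a c) (ba_meet B (ba_compl B a) c) = c"
    using C by (intro B.valuation_eqI; auto)+
  ultimately have ac: "a \<in> T" "c \<in> T" by simp_all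
  then have "f x \<subseteq> T" using x(3) BSub_closed(2-4)[OF TB] by (auto simp: oa_four_def)
  then have "x \<le> fi T" using f_le[OF x(1) fi_in[OF T]] f_fi[OF T] by simp
  then have "fi T = x" using max fi_in[OF T] by (simp add: is_maximal_def)
  then show False using f_fi[OF T] ac c by auto
qed

end

lemma short_enough_directions_of_iso:
  assumes A: "orthoalgebra A" and proper: "oa_proper A" and iso: "poset_iso X (star (BSub A))"
  shows "short X \<and> enough_directions X"
proof -
  obtain f where f: "bij_betw f X (star (BSub A))" "\<forall>x\<in>X. \<forall>y\<in>X. x \<le> y \<longleftrightarrow> f x \<le> f y"
    using iso by (auto simp: poset_iso_def)
  interpret orthoalgebra A by (rule A)
  interpret oa_model A X f by unfold_locales (use f in auto)
  show ?thesis
    unfolding enough_directions_def using short_X proper_X[OF proper] dir_of_direction basic_X_iff by blast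
qed

section \<open>Three orthogonal elements\<close>

lemma (in boolalg) joins_of_least:
  assumes F: "partition_of_unity B F" and S: "S \<in> Sub B" "F \<subseteq> S"
  shows "joins_of B F \<subseteq> S"
proof
  fix s assume "s \<in> joins_of B F"
  from F this show "s \<in> S"
    by (induction rule: joins_of_induct) (use S SubD(2,5)[OF S(1)] in blast)+
qed

text \<open>
  Three nonzero, pairwise disjoint elements with join \<open>1\<close>: the atoms of an eight-element
  subalgebra.
\<close>

definition three_parts :: "'b boolalg \<Rightarrow> 'b \<Rightarrow> 'b \<Rightarrow> 'b \<Rightarrow> bool" where
  "three_parts B a b c \<longleftrightarrow> {a, b, c} \<subseteq> ba_carrier B \<and> ba_zero B \<notin> {a, b, c} \<and>
     (\<forall>v. valuation B v \<longrightarrow> (v a \<and> \<not> v b \<and> \<not> v c) \<or> (\<not> v a \<and> v b \<and> \<not> v c) \<or> (\<not> v a \<and> \<not> v b \<and> v c))"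

context boolalg
begin

lemma three_partsI:
  assumes "a \<in> \<C>" "b \<in> \<C>" "a \<sqinter> b = \<zero>" "a \<noteq> \<zero>" "b \<noteq> \<zero>" "a \<squnion> b \<noteq> \<one>"
  shows "three_parts B a b (\<sim> (a \<squnion> b))"
proof -
  have "\<sim> (a \<squnion> b) \<noteq> \<zero>" using assms compl_compl[of "a \<squnion> b"] compl_zero by auto
  moreover have "\<not> (v a \<and> v b)" if "valuation B v" for v
    using arg_cong[OF assms(3), of v] that assms(1,2) by auto
  ultimately show ?thesis using assms unfolding three_parts_def by auto
qed

lemma three_parts_rotate: "three_parts B a b c \<Longrightarrow> three_parts B b a c" "three_parts B a b c \<Longrightarrow> three_parts B c b a"
  unfolding three_parts_def by (simp_all add: insert_commute) blast+

lemma three_parts_partition: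
  assumes "three_parts B a b c"
  shows "partition_of_unity B {a, b, c}"
  unfolding partition_of_unity_def
proof (intro conjI allI impI)
  show "finite {a, b, c}" "{a, b, c} \<subseteq> \<C>" using assms by (auto simp: three_parts_def)
  fix v assume "valuation B v"
  then have "(v a \<and> \<not> v b \<and> \<not> v c) \<or> (\<not> v a \<and> v b \<and> \<not> v c) \<or> (\<not> v a \<and> \<not> v b \<and> v c)"
    using assms by (simp add: three_parts_def)
  then show "\<exists>!f. f \<in> {a, b, c} \<and> v f" by (elim disjE) auto
qed

lemma three_parts_compl:
  assumes t: "three_parts B a b c"
  shows "\<sim> c = a \<squnion> b" "\<sim> a = b \<squnion> c"
proof -
  have C: "a \<in> \<C>" "b \<in> \<C>" "c \<in> \<C>" using t by (auto simp: three_parts_def)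
  have v: "(v a \<and> \<not> v b \<and> \<not> v c) \<or> (\<not> v a \<and> v b \<and> \<not> v c) \<or> (\<not> v a \<and> \<not> v b \<and> v c)" if "valuation B v" for v
    using t that by (simp add: three_parts_def)
  show "\<sim> c = a \<squnion> b" "\<sim> a = b \<squnion> c"
    by (rule valuation_eqI; use C v in auto)+
qed

lemma joins_of_three:
  assumes t: "three_parts B a b c" and s: "s \<in> joins_of B {a, b, c}"
  shows "s \<in> {\<zero>, \<one>, a, b, c, \<sim> a, \<sim> b, \<sim> c}"
proof -
  have C: "a \<in> \<C>" "b \<in> \<C>" "c \<in> \<C>" using t by (auto simp: three_parts_def)
  have v: "(v a \<and> \<not> v b \<and> \<not> v c) \<or> (\<not> v a \<and> v b \<and> \<not> v c) \<or> (\<not> v a \<and> \<not> v b \<and> v c)" if "valuation B v" for v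
    using t that by (simp add: three_parts_def)
  obtain G where G: "G \<subseteq> {a, b, c}" "\<And>v. valuation B v \<Longrightarrow> v s \<longleftrightarrow> (\<exists>f\<in>G. v f)" "s \<in> \<C>"
    using s by (auto simp: joins_of_def)
  have e: "v s \<longleftrightarrow> a \<in> G \<and> v a \<or> b \<in> G \<and> v b \<or> c \<in> G \<and> v c" if "valuation B v" for v
    using G(1) G(2)[OF that] by blast
  consider "a \<notin> G" "b \<notin> G" "c \<notin> G" | "a \<in> G" "b \<notin> G" "c \<notin> G" | "a \<notin> G" "b \<in> G" "c \<notin> G"
    | "a \<notin> G" "b \<notin> G" "c \<in> G" | "a \<in> G" "b \<in> G" "c \<notin> G" | "a \<in> G" "b \<notin> G" "c \<in> G"
    | "a \<notin> G" "b \<in> G" "c \<in> G" | "a \<in> G" "b \<in> G" "c \<in> G" by blast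
  then show ?thesis
  proof cases
    case 1 then have "s = \<zero>" using e C G(3) by (intro valuation_eqI) auto
    then show ?thesis by simp
  next
    case 2 then have "s = a" using e C G(3) by (intro valuation_eqI) auto
    then show ?thesis by simp
  next
    case 3 then have "s = b" using e C G(3) by (intro valuation_eqI) auto
    then show ?thesis by simp
  next
    case 4 then have "s = c" using e C G(3) by (intro valuation_eqI) auto
    then show ?thesis by simp
  next
    case 5
    have "s = \<sim> c"
    proof (rule valuation_eqI)
      show "v s = v (\<sim> c)" if "valuation B v" for v using e[OF that] v[OF that] 5 C that by auto
    qed (use C G in auto)
    then show ?thesis by simp
  next
    case 6
    have "s = \<sim> b"
    proof (rule valuation_eqI)
      show "v s = v (\<sim> b)" if "valuation B v" for v using e[OF that] v[OF that] 6 C that by auto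
    qed (use C G in auto)
    then show ?thesis by simp
  next
    case 7
    have "s = \<sim> a"
    proof (rule valuation_eqI)
      show "v s = v (\<sim> a)" if "valuation B v" for v using e[OF that] v[OF that] 7 C that by auto
    qed (use C G in auto)
    then show ?thesis by simp
  next
    case 8
    have "s = \<one>"
    proof (rule valuation_eqI)
      show "v s = v \<one>" if "valuation B v" for v using e[OF that] v[OF that] 8 C that by auto
    qed (use C G in auto)
    then show ?thesis by simp
  qed
qed

text \<open>
  An element of the eight-element subalgebra outside \<open>four a\<close> is \<open>b\<close>, \<open>c\<close> or a complement of
  these, and with \<open>a\<close> it generates both \<open>b\<close> and \<open>c\<close>.
\<close>

lemma three_parts_four_cover:
  assumes t: "three_parts B a b c" and S: "S \<in> Sub B" "four B a \<subseteq> S" "S \<subseteq> joins_of B {a, b, c}"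
  shows "S = four B a \<or> S = joins_of B {a, b, c}"
proof (cases "b \<in> S \<or> c \<in> S")
  case True
  have aS: "a \<in> S" using S mem_four by blast
  have "\<sim> b = a \<squnion> c" "\<sim> c = a \<squnion> b"
    using three_parts_compl[OF t] three_parts_compl[OF three_parts_rotate(1)[OF t]] by auto
  then have "b \<in> S \<and> c \<in> S"
  proof -
    have C: "b \<in> \<C>" "c \<in> \<C>" using t by (auto simp: three_parts_def)
    have "c = \<sim> (a \<squnion> b)" "b = \<sim> (a \<squnion> c)"
      using compl_compl[OF C(1)] compl_compl[OF C(2)] \<open>\<sim> b = a \<squnion> c\<close> \<open>\<sim> c = a \<squnion> b\<close> by metis+
    then show ?thesis using True aS SubD(4,5)[OF S(1)] by metis
  qed
  then show ?thesis using joins_of_least[OF three_parts_partition[OF t] S(1)] aS S(3) by blast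
next
  case False
  have C: "b \<in> \<C>" "c \<in> \<C>" using t by (auto simp: three_parts_def)
  have no: "\<sim> b \<notin> S" "\<sim> c \<notin> S" using False SubD(4)[OF S(1)] compl_compl[OF C(1)] compl_compl[OF C(2)] by metis+
  have "s \<in> four B a" if "s \<in> S" for s
  proof -
    have "s \<in> {\<zero>, \<one>, a, b, c, \<sim> a, \<sim> b, \<sim> c}" using joins_of_three[OF t] S(3) that by blast
    moreover have "s \<noteq> b" "s \<noteq> c" "s \<noteq> \<sim> b" "s \<noteq> \<sim> c" using that no False by auto
    ultimately show ?thesis by (simp add: four_def)
  qed
  then show ?thesis using S(2) by blast
qed

lemma three_parts_psub:
  assumes t: "three_parts B a b c"
  defines "T \<equiv> joins_of B {a, b, c}"
  shows "T \<inter> psub B a = four B a" "T \<inter> psub B (\<sim> a) = T" "four B a \<subset> T" "T \<in> Sub B"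
proof -
  have C: "a \<in> \<C>" "b \<in> \<C>" "c \<in> \<C>" and nz: "a \<noteq> \<zero>" "b \<noteq> \<zero>" "c \<noteq> \<zero>"
    using t by (auto simp: three_parts_def)
  have v: "(v a \<and> \<not> v b \<and> \<not> v c) \<or> (\<not> v a \<and> v b \<and> \<not> v c) \<or> (\<not> v a \<and> \<not> v b \<and> v c)" if "valuation B v" for v
    using t that by (simp add: three_parts_def)
  note part = three_parts_partition[OF t]
  show TS: "T \<in> Sub B" using joins_of_in_Sub[OF part] by (simp add: T_def)
  have FT: "a \<in> T" "b \<in> T" "c \<in> T" using mem_joins_of[of "{a, b, c}"] C by (auto simp: T_def)
  have le: "b \<sqinter> \<sim> a = b" "c \<sqinter> \<sim> a = c" "\<sim> b \<sqinter> \<sim> a = c"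
    by (rule valuation_eqI; use C v in auto)+
  have bn: "b \<notin> psub B a" unfolding psub_def using le nz by simp
  then have ne: "T \<inter> psub B a \<noteq> T" using FT by blast
  show "T \<inter> psub B a = four B a"
    using three_parts_four_cover[OF t Int_in_Sub[OF TS psub_in_Sub[OF C(1)]]] ne
      four_least[OF TS FT(1)] four_subset_psub[OF C(1)] unfolding T_def by blast
  have "four B a \<noteq> T" using bn FT four_subset_psub[OF C(1)] by blast
  then show "four B a \<subset> T" using four_least[OF TS FT(1)] by blast
  have "a \<in> psub B (\<sim> a)" using mem_psub(2)[of "\<sim> a"] compl_compl C by auto
  moreover have "b \<in> psub B (\<sim> a)" "c \<in> psub B (\<sim> a)"
    using le C v by (auto simp: mem_psub_iff)
  ultimately have "T \<subseteq> psub B (\<sim> a)"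
    unfolding T_def using joins_of_least[OF part psub_in_Sub[of "\<sim> a"]] C by blast
  then show "T \<inter> psub B (\<sim> a) = T" by blast
qed

end

section \<open>Directions of a short orthodomain\<close>

text \<open>
  The directions whose base lies below \<open>w\<close>.  It turns out that these sets are the Boolean
  subalgebras of height at most \<open>3\<close> of the orthoalgebra of directions.
\<close>

definition dirs_at :: "'x::order set \<Rightarrow> 'x \<Rightarrow> 'x dir set" where
  "dirs_at X w = {d \<in> Dir X. w \<in> dom d}"

lemma is_directionD:
  assumes "is_direction X x d"
  shows "basic X x" "dom d = up_in X x"
    "\<And>y p. y \<in> up_in X x \<Longrightarrow> d y = Some p \<Longrightarrow> principal_pair_for (down_in X y) x p"
    "\<And>y z v w. y \<in> up_in X x \<Longrightarrow> z \<in> up_in X x \<Longrightarrow> y \<le> z \<Longrightarrow> d z = Some (v, w)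
       \<Longrightarrow> d y = Some (meet_in X y v, meet_in X y w)"
    "\<And>y z. covers X x y \<Longrightarrow> covers X x z \<Longrightarrow> d y = Some (x, y) \<Longrightarrow> d z = Some (z, x)
       \<Longrightarrow> \<exists>u. is_lub X {y, z} u \<and> covers X y u \<and> covers X z u"
proof -
  note c = assms[unfolded is_direction_def]
  show "basic X x" "dom d = up_in X x" by (rule conjunct1[OF c], rule conjunct1[OF conjunct2[OF c]])
  have 3: "\<forall>y\<in>up_in X x. \<forall>p. d y = Some p \<longrightarrow> principal_pair_for (down_in X y) x p"
    and 4: "\<forall>y\<in>up_in X x. \<forall>z\<in>up_in X x. \<forall>v w. y \<le> z \<and> d z = Some (v, w)
        \<longrightarrow> d y = Some (meet_in X y v, meet_in X y w)"
    and 5: "\<forall>y\<in>up_in X x. \<forall>z\<in>up_in X x.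
        covers X x y \<and> covers X x z \<and> d y = Some (x, y) \<and> d z = Some (z, x)
        \<longrightarrow> (\<exists>u. is_lub X {y, z} u \<and> covers X y u \<and> covers X z u)"
    using conjunct1[OF conjunct2[OF conjunct2[OF c]]] conjunct1[OF conjunct2[OF conjunct2[OF conjunct2[OF c]]]]
      conjunct2[OF conjunct2[OF conjunct2[OF conjunct2[OF c]]]] .
  show "principal_pair_for (down_in X y) x p" if "y \<in> up_in X x" "d y = Some p" for y p
    using 3 that by blast
  show "d y = Some (meet_in X y v, meet_in X y w)"
    if "y \<in> up_in X x" "z \<in> up_in X x" "y \<le> z" "d z = Some (v, w)" for y z v w
    using 4 that by blast
  show "\<exists>u. is_lub X {y, z} u \<and> covers X y u \<and> covers X z u"
    if "covers X x y" "covers X x z" "d y = Some (x, y)" "d z = Some (z, x)" for y z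
  proof -
    have "y \<in> up_in X x" "z \<in> up_in X x" using that(1,2) by (auto simp: covers_def up_in_def)
    then show ?thesis using 5 that by blast
  qed
qed

lemma principal_pair_for_swap:
  "principal_pair_for L x (y, z) \<Longrightarrow> principal_pair_for L x (z, y)"
  by (auto simp: principal_pair_for_def principal_pair_def meet_in_def join_in_def insert_commute)

lemma dir_compl_apply [simp]:
  "dir_compl d w = Some (y, z) \<longleftrightarrow> d w = Some (z, y)"
  by (auto simp: dir_compl_def)

lemma dir_compl_dir_compl [simp]: "dir_compl (dir_compl d) = d"
  by (auto simp: dir_compl_def fun_eq_iff option.map_comp o_def option.map_ident)

lemma dom_dir_compl [simp]: "dom (dir_compl d) = dom d"
  by (auto simp: dir_compl_def dom_def)

lemma is_direction_dir_compl:
  assumes d: "is_direction X x d"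
  shows "is_direction X x (dir_compl d)"
  unfolding is_direction_def
proof (intro conjI ballI allI impI; (elim conjE)?)
  note D = is_directionD[OF d]
  show "basic X x" "dom (dir_compl d) = up_in X x" using D(1,2) by simp_all
  show "principal_pair_for (down_in X y) x p" if "y \<in> up_in X x" "dir_compl d y = Some p" for y p
    using D(3)[OF that(1), of "(snd p, fst p)"] that(2) principal_pair_for_swap by (cases p) auto
  show "dir_compl d y = Some (meet_in X y v, meet_in X y w)"
    if "y \<in> up_in X x" "z \<in> up_in X x" "y \<le> z" "dir_compl d z = Some (v, w)" for y z v w
    using D(4)[OF that(1-3)] that(4) by simp
  show "\<exists>u. is_lub X {y, z} u \<and> covers X y u \<and> covers X z u"
    if "covers X x y" "covers X x z" "dir_compl d y = Some (x, y)" "dir_compl d z = Some (z, x)" for y z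
    using D(5)[OF that(2,1)] that(3,4) by (auto simp: insert_commute)
qed

locale short_orthodomain =
  fixes X :: "'x::order set"
  assumes od: "orthodomain X" and short: "short X" and enough: "enough_directions X"
begin

definition bt :: 'x where "bt = bot_of X"

lemma bt_least: "is_least X bt"
  using od bot_of_eq unfolding bt_def orthodomain_def by metis

lemma is_least_iff_bt: "is_least X c \<longleftrightarrow> c = bt"
  using bt_least is_least_unique by blast

lemma bt_in: "bt \<in> X" "x \<in> X \<Longrightarrow> bt \<le> x"
  using bt_least by (auto simp: is_least_def)

lemma basic_in: "basic X x \<Longrightarrow> x \<in> X"
  by (auto simp: basic_def is_atom_def is_least_def covers_def)

lemma is_atom_iff: "is_atom X x \<longleftrightarrow> basic X x \<and> x \<noteq> bt"
  unfolding basic_def is_least_iff_bt is_atom_def by (auto simp: covers_def)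

lemma lub_of_covered_atoms: "is_atom X x \<Longrightarrow> is_atom X y \<Longrightarrow> x \<noteq> y \<Longrightarrow> covers X x w \<Longrightarrow> covers X y w \<Longrightarrow> is_lub X {x, y} w"
  using od unfolding orthodomain_def by blast

lemma no_five_chain:
  assumes w: "w \<in> X" and "{a, b, c, d, e} \<subseteq> down_in X w" "a < b" "b < c" "c < d" "d < e"
  shows False
proof -
  have "height X w \<le> 3" using short w by (auto simp: short_def star_def)
  then show False using height_le_three_no_chain assms by blast
qed

lemma obtain_chart:
  assumes w: "w \<in> X"
  obtains B :: "('x \<times> bool) boolalg" and g where "short_chart B (down_in X w) g"
proof -
  have "boolean_domain (down_in X w)" using od w by (auto simp: orthodomain_def)
  then obtain B :: "('x \<times> bool) boolalg" and g where B: "boolalg B" and g: "bij_betw g (down_in X w) (Sub B)"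
    "\<forall>x\<in>down_in X w. \<forall>y\<in>down_in X w. x \<le> y \<longleftrightarrow> g x \<le> g y"
    by (auto simp: boolean_domain_def poset_iso_def)
  have ch: "boolean_chart B (down_in X w) g"
    using B g by (simp add: boolean_chart_def boolean_chart_axioms_def)
  interpret boolean_chart B "down_in X w" g by (rule ch)
  have "short_chart B (down_in X w) g"
  proof
    fix S0 S1 S2 S3 S4
    assume S: "S0 \<in> Sub B" "S1 \<in> Sub B" "S2 \<in> Sub B" "S3 \<in> Sub B" "S4 \<in> Sub B"
      and lt: "S0 \<subset> S1" "S1 \<subset> S2" "S2 \<subset> S3" "S3 \<subset> S4"
    have "pt S0 < pt S1" "pt S1 < pt S2" "pt S2 < pt S3" "pt S3 < pt S4"
      using S lt pt_in g_pt less_iff by metis+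
    then show False using no_five_chain[OF w, of "pt S0" "pt S1" "pt S2" "pt S3" "pt S4"] S pt_in by blast
  qed
  then show thesis using that by blast
qed

lemma basic_down: "w \<in> X \<Longrightarrow> x \<in> down_in X w \<Longrightarrow> basic (down_in X w) x \<longleftrightarrow> basic X x"
  using basic_down_iff[OF bt_least] .

lemma is_least_down: "w \<in> X \<Longrightarrow> is_least (down_in X w) x \<longleftrightarrow> x = bt"
  using is_least_down_iff[OF bt_least] .

lemma direction_pair:
  assumes d: "is_direction X x d" and w: "w \<in> X" "x \<le> w"
  obtains y z where "d w = Some (y, z)" "principal_pair_for (down_in X w) x (y, z)"
proof -
  have up: "w \<in> up_in X x" using w by (simp add: up_in_def)
  then have "w \<in> dom d" using is_directionD(2)[OF d] by simp
  then obtain p where p: "d w = Some p" by blast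
  show thesis using that[of "fst p" "snd p"] p is_directionD(3)[OF d up] by simp
qed

lemma base_unique:
  assumes "is_direction X x d" "is_direction X y d"
  shows "x = y"
proof -
  have "up_in X x = up_in X y" "x \<in> X" "y \<in> X"
    using is_directionD(1,2)[OF assms(1)] is_directionD(1,2)[OF assms(2)] basic_in by auto
  then have "x \<le> y" "y \<le> x" by (auto simp: up_in_def)
  then show ?thesis by simp
qed

text \<open>
  Above \<open>x\<close> and below a cover \<open>w\<close> there are only \<open>x\<close> and \<open>w\<close>, and a principal pair for \<open>x\<close>
  cannot have equal components unless \<open>x\<close> is the top.  So on covers of its base a direction amounts
  to a choice of one of two orientations.
\<close>

lemma dir_on_cover:
  assumes d: "is_direction X x d" and c: "covers X x w"
  shows "d w = Some (x, w) \<or> d w = Some (w, x)"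
proof -
  have w: "w \<in> X" "x \<in> X" "x < w" using c by (auto simp: covers_def)
  obtain y z where yz: "d w = Some (y, z)" "principal_pair_for (down_in X w) x (y, z)"
    using direction_pair[OF d] w by (metis less_imp_le)
  obtain B :: "('x \<times> bool) boolalg" and g where "short_chart B (down_in X w) g" using obtain_chart w by blast
  then interpret short_chart B "down_in X w" g .
  obtain a where a: "a \<in> ba_carrier B" "x \<in> down_in X w" "y \<in> down_in X w" "z \<in> down_in X w"
    "g x = four B a" "g y = psub B a" "g z = psub B (ba_compl B a)"
    using principal_pair_forD[OF yz(2)] by blast
  have wd: "w \<in> down_in X w" using w by (simp add: down_in_def)
  have gw: "g w = ba_carrier B" using is_greatest_iff[of w] wd by (auto simp: is_greatest_def down_in_def)
  have "x \<le> y" "x \<le> z"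
    using le_iff a four_subset_psub[OF a(1)] four_subset_psub[of "ba_compl B a"] four_compl[OF a(1)] by auto
  moreover have "y \<in> X" "z \<in> X" "y \<le> w" "z \<le> w" using a by (auto simp: down_in_def)
  ultimately have "y = x \<or> y = w" "z = x \<or> z = w" using c by (auto simp: covers_def le_less)
  moreover have "\<not> (y = w \<and> z = w)"
    using a gw psub_Int_psub_compl[OF a(1)] g_eq_iff[OF a(2) wd] w by auto
  moreover have "\<not> (y = x \<and> z = x)"
    using a gw psub_eq_four_imp_psub_compl[OF a(1)] g_eq_iff[OF a(2) wd] w by auto
  ultimately show ?thesis using yz by auto
qed

lemma dir_at_base:
  assumes d: "is_direction X x d"
  shows "d x = Some (x, x)"
proof -
  have x: "x \<in> X" using is_directionD(1)[OF d] basic_in by blast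
  obtain y z where yz: "d x = Some (y, z)" "principal_pair_for (down_in X x) x (y, z)"
    using direction_pair[OF d x] by blast
  obtain B :: "('x \<times> bool) boolalg" and g where "short_chart B (down_in X x) g" using obtain_chart x by blast
  then interpret short_chart B "down_in X x" g .
  obtain a where a: "a \<in> ba_carrier B" "x \<in> down_in X x" "y \<in> down_in X x" "z \<in> down_in X x"
    "g x = four B a" "g y = psub B a" "g z = psub B (ba_compl B a)"
    using principal_pair_forD[OF yz(2)] by blast
  have "x \<le> y" "x \<le> z"
    using le_iff a four_subset_psub[OF a(1)] four_subset_psub[of "ba_compl B a"] four_compl[OF a(1)] by auto
  then show ?thesis using a yz by (auto simp: down_in_def)
qed

text \<open>
  A principal pair for \<open>x\<close> is given by a generator of the four-element subalgebra representing \<open>x\<close>,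
  and this generator is unique up to complement.
\<close>

lemma principal_pairs_agree:
  assumes w: "w \<in> X" and p: "principal_pair_for (down_in X w) x p" and q: "principal_pair_for (down_in X w) x q"
  shows "q = p \<or> q = prod.swap p"
proof -
  obtain B :: "('x \<times> bool) boolalg" and g where "short_chart B (down_in X w) g" using obtain_chart w by blast
  then interpret short_chart B "down_in X w" g .
  obtain y z where pe: "p = (y, z)" by (cases p)
  obtain y' z' where qe: "q = (y', z')" by (cases q)
  obtain a where a: "a \<in> ba_carrier B" "x \<in> down_in X w" "y \<in> down_in X w" "z \<in> down_in X w"
    "g x = four B a" "g y = psub B a" "g z = psub B (ba_compl B a)"
    using principal_pair_forD[OF p[unfolded pe]] by blast
  obtain b where b: "b \<in> ba_carrier B" "y' \<in> down_in X w" "z' \<in> down_in X w"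
    "g x = four B b" "g y' = psub B b" "g z' = psub B (ba_compl B b)"
    using principal_pair_forD[OF q[unfolded qe]] by blast
  have "b = a \<or> b = ba_compl B a" using four_eqD[of a b] a b by simp
  then show ?thesis
  proof
    assume "b = a"
    then have "y' = y" "z' = z" using a b g_eq_iff by metis+
    then show ?thesis by (simp add: pe qe)
  next
    assume "b = ba_compl B a"
    then have "y' = z" "z' = y" using a b g_eq_iff compl_compl[OF a(1)] by metis+
    then show ?thesis by (simp add: pe qe)
  qed
qed

lemma directions_agree_or_swap:
  assumes d: "is_direction X x d" and e: "is_direction X x e" and w: "w \<in> X" "x \<le> w"
  shows "e w = d w \<or> e w = dir_compl d w"
proof -
  obtain y z where yz: "d w = Some (y, z)" "principal_pair_for (down_in X w) x (y, z)"
    using direction_pair[OF d w] by blast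
  obtain y' z' where yz': "e w = Some (y', z')" "principal_pair_for (down_in X w) x (y', z')"
    using direction_pair[OF e w] by blast
  show ?thesis using principal_pairs_agree[OF w(1) yz(2) yz'(2)] yz(1) yz'(1) by (auto simp: dir_compl_def)
qed

text \<open>
  Otherwise one could descend from \<open>w\<close> towards \<open>x\<close> three times, giving a chain of five elements.
\<close>

lemma cover_exists:
  assumes x: "x \<in> X" and w: "w \<in> X" and lt: "x < w"
  shows "\<exists>y. covers X x y \<and> y \<le> w"
proof (rule ccontr)
  assume no: "\<not> ?thesis"
  have step: "\<exists>z\<in>X. x < z \<and> z < y" if "y \<in> X" "x < y" "y \<le> w" for y
    using no that x unfolding covers_def by blast
  obtain a where a: "a \<in> X" "x < a" "a < w" using step[OF w lt] by blast
  obtain b where b: "b \<in> X" "x < b" "b < a" using step[OF a(1,2) less_imp_le[OF a(3)]] by blast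
  obtain c where c: "c \<in> X" "x < c" "c < b" using step[OF b(1,2)] a(3) b(3) by (meson less_imp_le less_trans)
  have "x \<le> w" "c \<le> w" "b \<le> w" "a \<le> w" using a b c by (meson less_imp_le less_trans)+
  then show False using no_five_chain[OF w, of x c b a w] x w a b c by (auto simp: down_in_def)
qed

lemma direction_restrict:
  assumes d: "is_direction X x d" and e: "is_direction X x e"
    and yw: "y \<in> X" "w \<in> X" "x \<le> y" "y \<le> w" and eq: "d w = e w"
  shows "d y = e y"
proof -
  have up: "y \<in> up_in X x" "w \<in> up_in X x"
    using yw(1-3) order.trans[OF yw(3,4)] by (simp_all add: up_in_def)
  obtain v u where dw: "d w = Some (v, u)" by (rule direction_pair[OF d yw(2) order.trans[OF yw(3,4)]])
  have "d y = Some (meet_in X y v, meet_in X y u)" by (rule is_directionD(4)[OF d up yw(4) dw])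
  also have "\<dots> = e y" by (rule is_directionD(4)[OF e up yw(4) dw[unfolded eq], symmetric])
  finally show ?thesis .
qed

lemma dir_compl_ne:
  assumes d: "is_direction X x d" and c: "covers X x y"
  shows "dir_compl d y \<noteq> d y"
proof -
  have ne: "x \<noteq> y" using c by (auto simp: covers_def)
  from dir_on_cover[OF d c] show ?thesis
  proof
    assume *: "d y = Some (x, y)"
    then have "dir_compl d y = Some (y, x)" by simp
    then show ?thesis using * ne by simp
  next
    assume *: "d y = Some (y, x)"
    then have "dir_compl d y = Some (x, y)" by simp
    then show ?thesis using * ne by simp
  qed
qed

text \<open>
  At each point \<open>e\<close> equals \<open>d\<close> or \<open>d'\<close>, and restriction passes this down, so agreement at a cover
  \<open>y\<close> of the base forces agreement at every \<open>u \<ge> y\<close>.  If \<open>d\<close> and \<open>e\<close> differed at a cover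
  \<open>z\<close>, one of them would have opposite orientations at \<open>y\<close> and \<open>z\<close>; by condition (3) the
  join of \<open>y\<close> and \<open>z\<close> would exist, and agreement would pass from \<open>y\<close> through the join to \<open>z\<close>.
\<close>

lemma direction_determined:
  assumes d: "is_direction X x d" and e: "is_direction X x e"
    and w: "w \<in> X" "x < w" and eq: "d w = e w"
  shows "d = e"
proof -
  have x: "x \<in> X" using is_directionD(1)[OF d] basic_in by blast
  obtain y where y: "covers X x y" "y \<le> w" using cover_exists[OF x w] by blast
  have yX: "y \<in> X" "x < y" using y by (auto simp: covers_def)
  have ey: "d y = e y" using direction_restrict[OF d e yX(1) w(1) _ y(2) eq] yX by simp
  \<comment> \<open>agreement spreads from \<open>y\<close> to everything below an element above \<open>y\<close>\<close>
  have swap_case: "d v = e v" if v: "v \<in> X" "u \<in> X" "x \<le> v" "v \<le> u" "y \<le> u" for u v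
  proof -
    have "e u = d u"
    proof (rule ccontr)
      assume "e u \<noteq> d u"
      then have "e u = dir_compl d u" using directions_agree_or_swap[OF d e v(2)] v by auto
      then have "e y = dir_compl d y"
        using direction_restrict[OF e is_direction_dir_compl[OF d] yX(1) v(2) _ v(5)] yX by simp
      then show False using ey dir_compl_ne[OF d y(1)] by simp
    qed
    then show ?thesis using direction_restrict[OF d e v(1,2,3,4)] by simp
  qed
  have cov: "d z = e z" if z: "covers X x z" for z
  proof (rule ccontr)
    assume ne: "d z \<noteq> e z"
    have zX: "z \<in> X" "x < z" using z by (auto simp: covers_def)
    have "\<exists>u. is_lub X {y, z} u"
      using is_directionD(5)[OF d y(1) z] is_directionD(5)[OF e y(1) z]
        is_directionD(5)[OF d z y(1)] is_directionD(5)[OF e z y(1)]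
        dir_on_cover[OF d y(1)] dir_on_cover[OF d z] dir_on_cover[OF e z] ey ne
      by (metis insert_commute)
    then obtain u where u: "u \<in> X" "y \<le> u" "z \<le> u" by (auto simp: is_lub_def)
    then show False using swap_case[OF zX(1) u(1) less_imp_le[OF zX(2)] u(3,2)] ne by simp
  qed
  have all: "d v = e v" if v: "v \<in> X" "x \<le> v" for v
  proof (cases "v = x")
    case True
    then show ?thesis using dir_at_base[OF d] dir_at_base[OF e] by simp
  next
    case False
    then have "x < v" using v by simp
    then obtain z where z: "covers X x z" "z \<le> v" using cover_exists[OF x v(1)] by blast
    have zX: "z \<in> X" "x \<le> z" using z by (auto simp: covers_def)
    show ?thesis
    proof (rule ccontr)
      assume "d v \<noteq> e v"
      then have "e v = dir_compl d v" using directions_agree_or_swap[OF d e v] by auto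
      then have "e z = dir_compl d z"
        using direction_restrict[OF e is_direction_dir_compl[OF d] zX(1) v(1) zX(2) z(2)] by simp
      then show False using cov[OF z(1)] dir_compl_ne[OF d z(1)] by simp
    qed
  qed
  show ?thesis
  proof
    fix v
    show "d v = e v"
    proof (cases "v \<in> up_in X x")
      case True
      then show ?thesis using all by (simp add: up_in_def)
    next
      case False
      then have "d v = None" "e v = None" using is_directionD(2)[OF d] is_directionD(2)[OF e] by auto
      then show ?thesis by simp
    qed
  qed
qed

lemma direction_exists:
  assumes w: "w \<in> X" "x \<le> w" and p: "principal_pair_for (down_in X w) x p" and b: "basic X x"
  shows "\<exists>d. is_direction X x d \<and> d w = Some p"
proof -
  obtain d where d: "is_direction X x d" using enough b by (auto simp: enough_directions_def)
  obtain y z where yz: "d w = Some (y, z)" "principal_pair_for (down_in X w) x (y, z)"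
    using direction_pair[OF d w] by blast
  have "p = (y, z) \<or> p = prod.swap (y, z)" using principal_pairs_agree[OF w(1) yz(2) p] .
  then show ?thesis
  proof
    assume "p = (y, z)" then show ?thesis using d yz by blast
  next
    assume "p = prod.swap (y, z)"
    then show ?thesis using is_direction_dir_compl[OF d] yz by (intro exI[of _ "dir_compl d"]) simp
  qed
qed

lemma principal_pair_bt:
  assumes "w \<in> X"
  shows "principal_pair_for (down_in X w) bt (bt, w)"
proof -
  obtain B :: "('x \<times> bool) boolalg" and g where "short_chart B (down_in X w) g" using obtain_chart assms by blast
  then interpret short_chart B "down_in X w" g .
  have "is_greatest (down_in X w) w" using assms by (auto simp: is_greatest_def down_in_def)
  then show ?thesis using bottom_principal_pair(1) is_least_down[OF assms] by blast
qed

lemma dir_zero_direction: "is_direction X bt (dir_zero X)"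
  unfolding is_direction_def
proof (intro conjI ballI allI impI; (elim conjE)?)
  have up: "up_in X bt = X" using bt_in by (auto simp: up_in_def)
  show "basic X bt" by (simp add: basic_def is_least_iff_bt)
  show "dom (dir_zero X) = up_in X bt" unfolding up by (auto simp: dir_zero_def dom_def)
  show "principal_pair_for (down_in X y) bt p" if "y \<in> up_in X bt" "dir_zero X y = Some p" for y p
    using that principal_pair_bt[of y] up by (auto simp: dir_zero_def bt_def)
  show "dir_zero X y = Some (meet_in X y v, meet_in X y w)"
    if "y \<in> up_in X bt" "z \<in> up_in X bt" "y \<le> z" "dir_zero X z = Some (v, w)" for y z v w
  proof -
    have yz: "y \<in> X" "z \<in> X" "v = bt" "w = z" using that up by (auto simp: dir_zero_def bt_def)
    have "meet_in X y bt = bt" by (rule meet_in_eq) (use yz bt_in in \<open>auto simp: is_glb_def\<close>)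
    moreover have "meet_in X y z = y" by (rule meet_in_eq) (use yz that in \<open>auto simp: is_glb_def\<close>)
    ultimately show ?thesis using yz by (simp add: dir_zero_def bt_def)
  qed
  show "\<exists>u. is_lub X {y, z} u \<and> covers X y u \<and> covers X z u"
    if "covers X bt z" "dir_zero X z = Some (z, bt)" for y z
  proof -
    have "z \<in> X" using that(1) by (simp add: covers_def)
    then have "dir_zero X z = Some (bt, z)" by (simp add: dir_zero_def bt_def)
    then have "z = bt" using that(2) by (metis option.inject prod.inject)
    then show ?thesis using that(1) by (simp add: covers_def)
  qed
qed

lemma dir_compl_zero: "dir_compl (dir_zero X) = dir_one X"
  by (auto simp: dir_compl_def dir_zero_def dir_one_def fun_eq_iff)

lemma dir_one_direction: "is_direction X bt (dir_one X)"
  using is_direction_dir_compl[OF dir_zero_direction] dir_compl_zero by simp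

text \<open>
  One application of properness may lead only from the least element to an atom; then a second one
  leads to an element that is not basic.
\<close>

lemma nonbasic_above:
  assumes "basic X x"
  shows "\<exists>w\<in>X. x \<le> w \<and> \<not> basic X w"
proof -
  have up: "\<exists>y\<in>X. x < y" if x: "basic X x" for x
    using enough x basic_in[OF x] unfolding enough_directions_def od_proper_def is_maximal_def
    by (metis order.not_eq_order_implies_strict)
  obtain y where y: "y \<in> X" "x < y" using up assms by blast
  show ?thesis
  proof (cases "basic X y")
    case True
    obtain w where w: "w \<in> X" "y < w" using up[OF True] by blast
    have "bt < y" using y bt_in basic_in[OF assms] by (metis le_less_trans)
    have "\<not> basic X w"
    proof
      assume "basic X w"
      moreover have "w \<noteq> bt" using w bt_in y by (metis leD)
      ultimately have "covers X bt w" unfolding basic_def is_atom_def is_least_iff_bt by blast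
      then show False using \<open>bt < y\<close> w y by (auto simp: covers_def)
    qed
    then show ?thesis using w y by (metis less_imp_le order.trans)
  next
    case False then show ?thesis using y by (auto intro: less_imp_le)
  qed
qed

lemma nonbasic_of_cover:
  assumes "is_atom X x" "covers X x w"
  shows "\<not> basic X w"
proof
  assume b: "basic X w"
  have x: "x \<in> X" "bt < x" using assms(1) bt_in basic_in is_atom_iff by (auto simp: le_less)
  have w: "x < w" "w \<in> X" using assms(2) by (auto simp: covers_def)
  then have "w \<noteq> bt" using x by auto
  then have "covers X bt w" using b unfolding basic_def is_atom_def is_least_iff_bt by blast
  then show False using x w by (auto simp: covers_def)
qed

end

section \<open>Directions at an element as a Boolean algebra\<close>

text \<open>
  A chart at an element \<open>w\<close> that is not basic.  At a basic element a direction with base \<open>w\<close> and its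
  complement have the same value \<open>(w, w)\<close>, whereas here a direction is determined by its value at \<open>w\<close>.
\<close>

locale big_chart = short_orthodomain X + short_chart B "down_in X w" g
  for X :: "'x::order set" and w :: 'x and B :: "'b boolalg" and g :: "'x \<Rightarrow> 'b set" +
  assumes w_in: "w \<in> X" and nonbasic: "\<not> basic X w"
begin

text \<open>
  The direction corresponding to the element \<open>a\<close> of the Boolean algebra \<open>B\<close> with
  \<open>Sub B \<cong> \<down>w\<close>.
\<close>

definition phi :: "'b \<Rightarrow> 'x dir" where
  "phi a = (THE d. d \<in> Dir X \<and> d w = Some (pt (psub B a), pt (psub B (\<sim> a))))"

lemma w_down: "w \<in> down_in X w"
  using w_in by (simp add: down_in_def)

lemma g_w: "g w = \<C>"
  using is_greatest_iff[of w] w_in by (auto simp: is_greatest_def down_in_def)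

lemma pt_carrier: "pt \<C> = w"
  using pt_g[OF w_down] g_w by simp

lemma pt_bottom: "pt {\<zero>, \<one>} = bt"
  using is_least_iff[of bt] is_least_down[OF w_in, of bt] pt_g[of bt] by simp

lemma pt_X: "S \<in> Sub B \<Longrightarrow> pt S \<in> X" "S \<in> Sub B \<Longrightarrow> pt S \<le> w"
  using pt_in by (auto simp: down_in_def)

lemma basic_pt: "a \<in> \<C> \<Longrightarrow> basic X (pt (four B a))"
  using basic_iff[of "pt (four B a)"] basic_down[OF w_in pt_in[OF four_in_Sub]] pt_in[OF four_in_Sub]
    g_pt[OF four_in_Sub] by blast

lemma pt_four_less: "a \<in> \<C> \<Longrightarrow> pt (four B a) < w"
  using pt_X(2)[OF four_in_Sub] basic_pt nonbasic by (metis order.not_eq_order_implies_strict)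

lemma phi_determined:
  assumes a: "a \<in> \<C>" and d: "d \<in> Dir X" "d w = Some (pt (psub B a), pt (psub B (\<sim> a)))"
  shows "is_direction X (pt (four B a)) d" "phi a = d"
proof -
  have ca: "\<sim> a \<in> \<C>" using a by simp
  let ?x = "pt (four B a)" and ?p = "(pt (psub B a), pt (psub B (\<sim> a)))"
  have pp: "principal_pair_for (down_in X w) ?x ?p"
    by (rule principal_pair_forI[OF a])
      (simp_all add: pt_in g_pt four_in_Sub psub_in_Sub a)
  have base: "is_direction X ?x e" if e: "e \<in> Dir X" "e w = Some ?p" for e
  proof -
    obtain y where y: "is_direction X y e" using e by (auto simp: Dir_def)
    have "w \<in> up_in X y" using is_directionD(2)[OF y] e(2) by auto
    then have "principal_pair_for (down_in X w) y ?p" using is_directionD(3)[OF y] e(2) by blast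
    then have "y = ?x" using pp by (auto simp: principal_pair_for_def)
    then show ?thesis using y by simp
  qed
  show "is_direction X ?x d" using base d by blast
  show "phi a = d" unfolding phi_def
  proof (rule the_equality)
    fix e assume e: "e \<in> Dir X \<and> e w = Some ?p"
    then show "e = d"
      using direction_determined[OF base[of e] base[OF d] w_in pt_four_less[OF a]] d(2) by auto
  qed (use d in blast)
qed

lemma phi_direction:
  assumes a: "a \<in> \<C>"
  shows "is_direction X (pt (four B a)) (phi a)"
    "phi a w = Some (pt (psub B a), pt (psub B (\<sim> a)))" "phi a \<in> dirs_at X w"
proof -
  have pp: "principal_pair_for (down_in X w) (pt (four B a)) (pt (psub B a), pt (psub B (\<sim> a)))"
    by (rule principal_pair_forI[OF a])
      (simp_all add: pt_in g_pt four_in_Sub psub_in_Sub a)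
  obtain d where d: "is_direction X (pt (four B a)) d" "d w = Some (pt (psub B a), pt (psub B (\<sim> a)))"
    using direction_exists[OF w_in pt_X(2)[OF four_in_Sub[OF a]] pp basic_pt[OF a]] by blast
  then have "phi a = d" using phi_determined(2)[OF a] by (auto simp: Dir_def)
  then show "is_direction X (pt (four B a)) (phi a)"
    "phi a w = Some (pt (psub B a), pt (psub B (\<sim> a)))" using d by simp_all
  then show "phi a \<in> dirs_at X w" by (auto simp: dirs_at_def Dir_def)
qed

lemma phi_surj:
  assumes d: "d \<in> dirs_at X w"
  shows "\<exists>a\<in>\<C>. d = phi a"
proof -
  have dD: "d \<in> Dir X" using d by (simp add: dirs_at_def)
  then obtain x where x: "is_direction X x d" by (auto simp: Dir_def)
  have up: "w \<in> up_in X x" using d is_directionD(2)[OF x] by (simp add: dirs_at_def)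
  then obtain y z where yz: "d w = Some (y, z)" "principal_pair_for (down_in X w) x (y, z)"
    using direction_pair[OF x w_in] by (auto simp: up_in_def)
  obtain a where a: "a \<in> \<C>" "y \<in> down_in X w" "z \<in> down_in X w" "g y = psub B a" "g z = psub B (\<sim> a)"
    using principal_pair_forD[OF yz(2)] by blast
  have "pt (psub B a) = y" "pt (psub B (\<sim> a)) = z" using pt_g[OF a(2)] pt_g[OF a(3)] a(4,5) by simp_all
  then have "phi a = d" using phi_determined(2)[OF a(1) dD] yz(1) by simp
  then show ?thesis using a(1) by blast
qed

text \<open>
  The value of \<open>phi a\<close> determines \<open>four a\<close>, hence \<open>a\<close> up to complement.  If \<open>phi a\<close> and
  \<open>phi a'\<close> were equal, \<open>psub a\<close> and \<open>psub a'\<close> would coincide with their intersection \<open>four a\<close> and with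
  the whole algebra, and \<open>w\<close> would be basic.
\<close>

lemma phi_inj: "inj_on phi \<C>"
proof (rule inj_onI)
  fix a b assume ab: "a \<in> \<C>" "b \<in> \<C>" and e: "phi a = phi b"
  have ca: "\<sim> a \<in> \<C>" "\<sim> b \<in> \<C>" using ab by auto
  have "pt (psub B a) = pt (psub B b)" "pt (psub B (\<sim> a)) = pt (psub B (\<sim> b))"
    using phi_direction(2)[OF ab(1)] phi_direction(2)[OF ab(2)] e by simp_all
  then have p: "psub B a = psub B b" "psub B (\<sim> a) = psub B (\<sim> b)"
    using g_pt[OF psub_in_Sub] ab ca by metis+
  then have f: "four B a = four B b" using psub_Int_psub_compl ab by metis
  show "a = b"
  proof (rule ccontr)
    assume ne: "a \<noteq> b"
    then have "b = \<sim> a" using four_eqD[OF f ab] by blast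
    then have "psub B a = psub B (\<sim> a)" using p by simp
    then have "psub B a = four B a" "psub B (\<sim> a) = four B a" using psub_Int_psub_compl[OF ab(1)] by auto
    then have "four B a = \<C>" using psub_eq_four_imp_psub_compl[OF ab(1)] by simp
    then show False using pt_four_less[OF ab(1)] pt_carrier by simp
  qed
qed

lemma phi_eq_iff: "a \<in> \<C> \<Longrightarrow> b \<in> \<C> \<Longrightarrow> phi a = phi b \<longleftrightarrow> a = b"
  using phi_inj by (auto simp: inj_on_def)

lemma phi_image: "phi ` \<C> = dirs_at X w"
  using phi_direction(3) phi_surj by blast

lemma phi_zero: "phi \<zero> = dir_zero X"
proof (rule phi_determined(2)[OF zero_closed])
  show "dir_zero X \<in> Dir X" using dir_zero_direction by (auto simp: Dir_def)
  show "dir_zero X w = Some (pt (psub B \<zero>), pt (psub B (\<sim> \<zero>)))"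
    using w_in by (simp add: dir_zero_def psub_zero psub_one compl_zero pt_bottom pt_carrier bt_def)
qed

lemma phi_compl:
  assumes a: "a \<in> \<C>"
  shows "phi (\<sim> a) = dir_compl (phi a)"
proof (rule phi_determined(2))
  show "dir_compl (phi a) \<in> Dir X" using is_direction_dir_compl[OF phi_direction(1)[OF a]] by (auto simp: Dir_def)
  show "dir_compl (phi a) w = Some (pt (psub B (\<sim> a)), pt (psub B (\<sim> (\<sim> a))))"
    using phi_direction(2)[OF a] compl_compl[OF a] by simp
qed (use a in simp)

lemma phi_one: "phi \<one> = dir_one X"
  using phi_compl[OF zero_closed] phi_zero compl_zero dir_compl_zero by simp

text \<open>
  Restriction of directions becomes intersection of subalgebras.
\<close>

lemma phi_at:
  assumes a: "a \<in> \<C>" and v: "v \<in> down_in X w" "a \<in> g v"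
  shows "phi a v = Some (pt (g v \<inter> psub B a), pt (g v \<inter> psub B (\<sim> a)))"
proof -
  have m: "meet_in X v (pt S) = pt (g v \<inter> S)" if S: "S \<in> Sub B" for S
  proof -
    have "meet_in X v (pt S) = meet_in (down_in X w) v (pt S)"
      using meet_in_down[OF boolean_chart_axioms v(1) pt_in[OF S]] .
    also have "\<dots> = pt (g (meet_in (down_in X w) v (pt S)))" using pt_g meet_in(1)[OF v(1) pt_in[OF S]] by simp
    also have "\<dots> = pt (g v \<inter> S)" using meet_in(2)[OF v(1) pt_in[OF S]] g_pt[OF S] by simp
    finally show ?thesis .
  qed
  have vX: "v \<in> X" "v \<le> w" using v by (auto simp: down_in_def)
  have "pt (four B a) \<le> v"
    using le_iff[OF pt_in[OF four_in_Sub[OF a]] v(1)] g_pt[OF four_in_Sub[OF a]]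
      four_least[OF g_Sub[OF v(1)] v(2)] by simp
  then have up: "v \<in> up_in X (pt (four B a))" "w \<in> up_in X (pt (four B a))"
    using vX w_in pt_X(2)[OF four_in_Sub[OF a]] by (auto simp: up_in_def)
  show ?thesis
    using is_directionD(4)[OF phi_direction(1)[OF a] up vX(2) phi_direction(2)[OF a]] m psub_in_Sub a by simp
qed

text \<open>
  The base of \<open>phi a\<close> is \<open>four a\<close>, which lies below \<open>v\<close> exactly when \<open>a \<in> g v\<close>.
\<close>

lemma dirs_at_below:
  assumes v: "v \<in> down_in X w"
  shows "dirs_at X v = phi ` g v"
proof -
  have vX: "v \<in> X" "v \<le> w" using v by (auto simp: down_in_def)
  have *: "phi a \<in> dirs_at X v \<longleftrightarrow> a \<in> g v" if a: "a \<in> \<C>" for a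
  proof -
    have "phi a \<in> dirs_at X v \<longleftrightarrow> pt (four B a) \<le> v"
      using is_directionD(2)[OF phi_direction(1)[OF a]] phi_direction(1)[OF a] vX by (auto simp: dirs_at_def Dir_def up_in_def)
    also have "\<dots> \<longleftrightarrow> a \<in> g v"
      using le_iff[OF pt_in[OF four_in_Sub[OF a]] v] g_pt[OF four_in_Sub[OF a]]
        four_subset_iff[OF g_Sub[OF v]] by simp
    finally show ?thesis .
  qed
  have "dirs_at X v \<subseteq> dirs_at X w"
  proof
    fix d assume d: "d \<in> dirs_at X v"
    then obtain x where x: "is_direction X x d" by (auto simp: dirs_at_def Dir_def)
    then show "d \<in> dirs_at X w"
      using d is_directionD(2)[OF x] vX w_in by (auto simp: dirs_at_def up_in_def)
  qed
  then show ?thesis using * phi_surj SubD(1)[OF g_Sub[OF v]] by blast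
qed

lemma pt_four_atom:
  assumes "a \<in> \<C>" "a \<noteq> \<zero>" "a \<noteq> \<one>"
  shows "is_atom X (pt (four B a))"
proof -
  have "pt (four B a) \<noteq> bt"
  proof
    assume "pt (four B a) = bt"
    then have "four B a = {\<zero>, \<one>}"
      using g_pt[OF four_in_Sub[OF assms(1)]] g_pt[OF bottom_in_Sub] pt_bottom by simp
    then show False using assms mem_four by auto
  qed
  then show ?thesis using is_atom_iff basic_pt assms by blast
qed

lemma three_parts_ne_one:
  assumes t: "three_parts B a b c"
  shows "a \<in> \<C>" "a \<noteq> \<zero>" "a \<noteq> \<one>"
proof -
  have C: "a \<in> \<C>" "b \<in> \<C>" and nz: "a \<noteq> \<zero>" "b \<noteq> \<zero>" using t by (auto simp: three_parts_def)
  show "a \<in> \<C>" "a \<noteq> \<zero>" by fact+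
  show "a \<noteq> \<one>"
  proof
    assume "a = \<one>"
    then have "\<not> v b" if "valuation B v" for v using t that by (auto simp: three_parts_def)
    then have "b = \<zero>" using C by (intro valuation_eqI) auto
    then show False using nz by simp
  qed
qed

text \<open>
  The join of the near atoms \<open>four a\<close> and \<open>four b\<close> is the eight-element subalgebra with atoms
  \<open>a\<close>, \<open>b\<close>, \<open>c\<close>.
\<close>

lemma three_cover:
  assumes t: "three_parts B a b c"
  shows "covers X (pt (four B a)) (pt (joins_of B {a, b, c}))"
proof -
  let ?T = "joins_of B {a, b, c}"
  note T = three_parts_psub[OF t]
  note a = three_parts_ne_one(1)[OF t]
  note aS = four_in_Sub[OF a]
  show ?thesis
    unfolding covers_def
  proof (intro conjI)
    show "pt (four B a) \<in> X" "pt ?T \<in> X" using pt_X(1) aS T(4) by auto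
    show "pt (four B a) < pt ?T"
      using less_iff[OF pt_in[OF aS] pt_in[OF T(4)]] g_pt[OF aS] g_pt[OF T(4)] T(3) by simp
    show "\<not> (\<exists>y\<in>X. pt (four B a) < y \<and> y < pt ?T)"
    proof
      assume "\<exists>y\<in>X. pt (four B a) < y \<and> y < pt ?T"
      then obtain y where y: "y \<in> X" "pt (four B a) < y" "y < pt ?T" by blast
      then have yd: "y \<in> down_in X w" using pt_X(2)[OF T(4)] by (auto simp: down_in_def)
      have "four B a \<subset> g y" "g y \<subset> ?T"
        using y less_iff[OF pt_in[OF aS] yd] less_iff[OF yd pt_in[OF T(4)]] g_pt[OF aS] g_pt[OF T(4)] by auto
      then show False using three_parts_four_cover[OF t g_Sub[OF yd]] by blast
    qed
  qed
qed

lemma three_phi: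
  assumes t: "three_parts B a b c"
  defines "v \<equiv> pt (joins_of B {a, b, c})"
  shows "phi a v = Some (pt (four B a), v)" "phi (\<sim> a) v = Some (v, pt (four B a))"
proof -
  note T = three_parts_psub[OF t]
  note a = three_parts_ne_one(1)[OF t]
  have v: "v \<in> down_in X w" "g v = joins_of B {a, b, c}" using pt_in[OF T(4)] g_pt[OF T(4)] by (simp_all add: v_def)
  have "a \<in> g v" using v(2) T(3) mem_four by auto
  then show 1: "phi a v = Some (pt (four B a), v)"
    using phi_at[OF a v(1)] T(1,2) v(2) by (simp add: v_def)
  show "phi (\<sim> a) v = Some (v, pt (four B a))" unfolding phi_compl[OF a] using 1 by simp
qed

text \<open>
  For orthogonal \<open>a\<close> and \<open>b\<close> with \<open>c = (a \<squnion> b)'\<close> nonzero, the bases of \<open>phi a\<close> and \<open>phi b\<close> are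
  near, and \<open>four c\<close> is the third atom below their join.  That this join in \<open>\<down>w\<close> is also the join in
  \<open>X\<close> is the last axiom of orthodomains.
\<close>

lemma three_near:
  assumes t: "three_parts B a b c"
  shows "near_summands X (phi a) (phi b) u z \<longleftrightarrow> u = pt (joins_of B {a, b, c}) \<and> z = pt (four B c)"
proof -
  let ?T = "joins_of B {a, b, c}"
  let ?x = "pt (four B a)" and ?y = "pt (four B b)" and ?z = "pt (four B c)" and ?v = "pt ?T"
  note tb = three_parts_rotate(1)[OF t] and tc = three_parts_rotate(2)[OF t]
  have perm: "{b, a, c} = {a, b, c}" "{c, b, a} = {a, b, c}" by auto
  have T: "?T \<in> Sub B" using three_parts_psub(4)[OF t] .
  have C: "a \<in> \<C>" "b \<in> \<C>" "c \<in> \<C>" using t by (auto simp: three_parts_def)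
  have cov: "covers X ?x ?v" "covers X ?y ?v" "covers X ?z ?v"
    using three_cover[OF t] three_cover[OF tb] three_cover[OF tc] unfolding perm by simp_all
  have at: "is_atom X ?x" "is_atom X ?y" "is_atom X ?z"
    using pt_four_atom three_parts_ne_one[OF t] three_parts_ne_one[OF tb] three_parts_ne_one[OF tc] by blast+
  have ne: "pt (four B p) \<noteq> pt (four B q)" if pq: "three_parts B p q r" for p q r
  proof
    assume "pt (four B p) = pt (four B q)"
    have PC: "p \<in> \<C>" "q \<in> \<C>" "r \<in> \<C>" "r \<noteq> \<zero>" "q \<noteq> \<zero>" using pq by (auto simp: three_parts_def)
    then have "four B p = four B q"
      using g_pt[OF four_in_Sub] \<open>pt (four B p) = pt (four B q)\<close> by metis
    then have "q = p \<or> q = \<sim> p" using four_eqD PC by blast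
    then have "(\<forall>v. valuation B v \<longrightarrow> \<not> v q) \<or> (\<forall>v. valuation B v \<longrightarrow> \<not> v r)"
    proof
      assume "q = p" then show ?thesis using pq by (auto simp: three_parts_def)
    next
      assume "q = \<sim> p" then show ?thesis using pq PC by (auto simp: three_parts_def)
    qed
    then have "q = \<zero> \<or> r = \<zero>"
    proof
      assume "\<forall>v. valuation B v \<longrightarrow> \<not> v q"
      then have "q = \<zero>" using PC by (intro valuation_eqI) auto
      then show ?thesis ..
    next
      assume "\<forall>v. valuation B v \<longrightarrow> \<not> v r"
      then have "r = \<zero>" using PC by (intro valuation_eqI) auto
      then show ?thesis ..
    qed
    then show False using PC by blast
  qed
  have xy: "?x \<noteq> ?y" using ne[OF t] .
  have zx: "?z \<noteq> ?x" using ne[OF three_parts_rotate(1)[OF three_parts_rotate(2)[OF tb]]] by simp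
  have zy: "?z \<noteq> ?y" using ne[OF tc] .
  have lub: "is_lub X {?x, ?y} ?v" using lub_of_covered_atoms[OF at(1,2) xy cov(1,2)] .
  have ph: "phi a ?v = Some (?x, ?v)" "phi b ?v = Some (?y, ?v)"
    using three_phi(1)[OF t] three_phi(1)[OF tb] unfolding perm by simp_all
  have zle: "?z \<le> ?v" using cov(3) by (auto simp: covers_def)
  show ?thesis
  proof
    assume "near_summands X (phi a) (phi b) u z"
    then obtain x y where n: "is_direction X x (phi a)" "is_direction X y (phi b)" "is_lub X {x, y} u"
      "is_atom X z" "z \<le> u" "z \<noteq> x" "z \<noteq> y" unfolding near_summands_def by blast
    have xe: "x = ?x" "y = ?y" using base_unique n(1,2) phi_direction(1) C by blast+
    then have u: "u = ?v" using n(3) lub is_lub_unique by blast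
    have zX: "z \<in> X" "basic X z" "z \<noteq> bt" using n(4) is_atom_iff basic_in by auto
    have zd: "z \<in> down_in X w" using zX n(5) u pt_X(2)[OF T] by (auto simp: down_in_def)
    obtain s where s: "s \<in> \<C>" "g z = four B s" using zX(2) basic_down[OF w_in zd] basic_iff by blast
    have "g z \<subseteq> ?T" using le_iff[OF zd pt_in[OF T]] n(5) u g_pt[OF T] by simp
    then have "s \<in> ?T" using s mem_four by auto
    then have "s \<in> {\<zero>, \<one>, a, b, c, \<sim> a, \<sim> b, \<sim> c}" using joins_of_three[OF t] by blast
    then have "four B s \<in> {{\<zero>, \<one>}, four B a, four B b, four B c}"
      using four_compl C four_zero four_compl[OF zero_closed] compl_zero by auto
    moreover have ze: "z = pt (four B s)" using pt_g[OF zd] s by simp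
    ultimately have "z = ?z" using zX(3) pt_bottom n(6,7) xe by auto
    then show "u = ?v \<and> z = ?z" using u by blast
  next
    assume "u = ?v \<and> z = ?z"
    moreover have "near_summands X (phi a) (phi b) ?v ?z"
      unfolding near_summands_def near_def
      using phi_direction(1)[OF C(1)] phi_direction(1)[OF C(2)] at xy zx zy lub cov ph zle by blast
    ultimately show "near_summands X (phi a) (phi b) u z" by blast
  qed
qed

text \<open>
  The sum of directions below \<open>w\<close> is the orthogonal join in \<open>B\<close>.  Apart from the sums with \<open>0\<close> and
  of complements, there are two cases.  If \<open>a \<sqinter> b = 0\<close>, then \<open>(a \<squnion> b)' = c\<close> gives the
  third atom and \<open>phi (a \<squnion> b)\<close> has the value required of the sum.  Conversely, if the sum is defined by an
  eight-element subalgebra \<open>v\<close>, its definition makes \<open>a\<close> and \<open>b\<close> distinct atoms of \<open>v\<close>.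
\<close>

lemma phi_plus:
  assumes a: "a \<in> \<C>" and b: "b \<in> \<C>"
  shows "dir_plus X (phi a) (phi b) = (if a \<sqinter> b = \<zero> then Some (phi (a \<squnion> b)) else None)"
proof -
  have z: "phi t = dir_zero X \<longleftrightarrow> t = \<zero>" if "t \<in> \<C>" for t
    using phi_eq_iff[OF that zero_closed] phi_zero by simp
  have c: "phi b = dir_compl (phi a) \<longleftrightarrow> b = \<sim> a"
    using phi_eq_iff[OF b compl_closed[OF a]] phi_compl[OF a] by simp
  consider "b = \<zero>" | "b \<noteq> \<zero>" "a = \<zero>" | "b \<noteq> \<zero>" "a \<noteq> \<zero>" "b = \<sim> a"
    | "b \<noteq> \<zero>" "a \<noteq> \<zero>" "b \<noteq> \<sim> a" "a \<sqinter> b = \<zero>" | "b \<noteq> \<zero>" "a \<noteq> \<zero>" "b \<noteq> \<sim> a" "a \<sqinter> b \<noteq> \<zero>" by blast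
  then show ?thesis
  proof cases
    case 1
    then have "dir_plus X (phi a) (phi b) = Some (phi a)" using z[OF b] by (simp add: dir_plus_def)
    then show ?thesis using 1 a by (simp add: meet_zero join_zero)
  next
    case 2
    then have "dir_plus X (phi a) (phi b) = Some (phi b)" using z[OF a] z[OF b] by (simp add: dir_plus_def)
    moreover have "\<zero> \<sqinter> b = \<zero>" "\<zero> \<squnion> b = b" using b by (intro valuation_eqI; auto)+
    ultimately show ?thesis using 2 by simp
  next
    case 3
    then have "dir_plus X (phi a) (phi b) = Some (phi \<one>)"
      using z[OF a] z[OF b] c phi_one by (simp add: dir_plus_def)
    then show ?thesis using 3 a by (simp add: meet_compl join_compl)
  next
    case 4
    have "a \<squnion> b \<noteq> \<one>" using compl_unique[OF a b _ 4(4)] 4(3) by blast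
    then have t: "three_parts B a b (\<sim> (a \<squnion> b))" using three_partsI a b 4 by blast
    let ?c = "\<sim> (a \<squnion> b)" and ?v = "pt (joins_of B {a, b, \<sim> (a \<squnion> b)})"
    have perm: "{?c, b, a} = {a, b, ?c}" by auto
    have cC: "?c \<in> \<C>" "a \<squnion> b \<in> \<C>" using a b by auto
    have cc: "\<sim> ?c = a \<squnion> b" using compl_compl[OF cC(2)] .
    note tc = three_parts_rotate(2)[OF t]
    have f: "phi (a \<squnion> b) ?v = Some (?v, pt (four B ?c))"
      using three_phi(2)[OF tc] unfolding perm cc .
    have fd: "is_direction X (pt (four B ?c)) (phi (a \<squnion> b))"
      using phi_direction(1)[OF cC(2)] four_compl[OF cC(2)] by simp
    have cov: "covers X (pt (four B ?c)) ?v" using three_cover[OF tc] unfolding perm .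
    then have lt: "pt (four B ?c) < ?v" "?v \<in> X" by (auto simp: covers_def)
    have "(THE f. \<exists>w z. near_summands X (phi a) (phi b) w z \<and> is_direction X z f \<and> f w = Some (w, z))
       = phi (a \<squnion> b)"
      unfolding three_near[OF t]
    proof (rule the_equality)
      show "\<exists>w z. (w = ?v \<and> z = pt (four B ?c)) \<and> is_direction X z (phi (a \<squnion> b)) \<and> phi (a \<squnion> b) w = Some (w, z)"
        using fd f by blast
      fix h assume "\<exists>w z. (w = ?v \<and> z = pt (four B ?c)) \<and> is_direction X z h \<and> h w = Some (w, z)"
      then have "is_direction X (pt (four B ?c)) h" "h ?v = phi (a \<squnion> b) ?v" using f by auto
      then show "h = phi (a \<squnion> b)" using direction_determined[OF _ fd lt(2,1)] by blast
    qed
    moreover have "\<exists>w z. near_summands X (phi a) (phi b) w z" unfolding three_near[OF t] by blast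
    ultimately have "dir_plus X (phi a) (phi b) = Some (phi (a \<squnion> b))"
      unfolding dir_plus_def using z[OF a] z[OF b] c 4 by simp
    then show ?thesis using 4 by simp
  next
    case 5
    have "\<not> near_summands X (phi a) (phi b) v z" for v z
    proof
      assume "near_summands X (phi a) (phi b) v z"
      then obtain x y where n: "is_direction X x (phi a)" "is_direction X y (phi b)" "near X x y"
        "is_lub X {x, y} v" "phi a v = Some (x, v)" "phi b v = Some (y, v)" unfolding near_summands_def by blast
      have xe: "x = pt (four B a)" "y = pt (four B b)" using base_unique n(1,2) phi_direction(1) a b by blast+
      have xy: "x \<noteq> y" "is_atom X x" "is_atom X y" using n(3) by (auto simp: near_def)
      have vX: "v \<in> X" "x \<le> v" "y \<le> v" "v \<le> w"
        using n(4) w_in pt_X(2)[OF four_in_Sub] a b xe unfolding is_lub_def by auto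
      then have vd: "v \<in> down_in X w" by (simp add: down_in_def)
      note vS = g_Sub[OF vd]
      have in_v: "a \<in> g v" "b \<in> g v"
        using le_iff[OF pt_in[OF four_in_Sub] vd] g_pt[OF four_in_Sub] four_subset_iff[OF vS] vX(2,3) xe a b
        by metis+
      have eq: "p \<sqinter> q = p" if p: "p \<in> \<C>" "p \<in> g v" and q: "q \<in> \<C>" "q \<in> g v" and at: "is_atom X (pt (four B p))"
        and ph: "phi p v = Some (pt (four B p), v)" and nz: "p \<sqinter> q \<noteq> \<zero>" for p q
      proof -
        have "pt (g v \<inter> psub B p) = pt (four B p)" using phi_at[OF p(1) vd p(2)] ph by simp
        then have e: "g v \<inter> psub B p = four B p"
          using g_pt[OF Int_in_Sub[OF vS psub_in_Sub[OF p(1)]]] g_pt[OF four_in_Sub[OF p(1)]] by metis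
        have "p \<sqinter> q \<in> g v" using SubD(6)[OF vS] p q by blast
        moreover have "p \<sqinter> q \<in> psub B p" using p q by (auto simp: mem_psub_iff)
        ultimately have "p \<sqinter> q \<in> {\<zero>, \<one>, p, \<sim> p}" using e by (auto simp: four_def)
        then have "p \<sqinter> q = \<one> \<or> p \<sqinter> q = p \<or> p \<sqinter> q = \<sim> p" using nz by blast
        moreover have "p = \<one>" if "p \<sqinter> q = \<one> \<or> p \<sqinter> q = \<sim> p"
        proof (rule valuation_eqI)
          fix v assume v: "valuation B v"
          show "v p = v \<one>"
            using that
          proof
            assume "p \<sqinter> q = \<one>" from arg_cong[OF this, of v] show ?thesis using v p q by simp
          next
            assume "p \<sqinter> q = \<sim> p" from arg_cong[OF this, of v] show ?thesis using v p q by auto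
          qed
        qed (use p in auto)
        moreover have "p \<noteq> \<one>"
        proof
          assume "p = \<one>"
          then have "four B p = {\<zero>, \<one>}" by (auto simp: four_def compl_one)
          then show False using at pt_bottom is_atom_iff by simp
        qed
        ultimately show ?thesis by blast
      qed
      have "a \<sqinter> b = a" using eq[OF a in_v(1) b in_v(2)] xy xe n(5) 5(4) by simp
      moreover have "b \<sqinter> a = b" using eq[OF b in_v(2) a in_v(1)] xy xe n(6) 5(4) meet_commute[OF a b] by simp
      ultimately have "a = b" using meet_commute[OF a b] by simp
      then show False using xy xe by simp
    qed
    then have "dir_plus X (phi a) (phi b) = None"
      unfolding dir_plus_def using z[OF a] z[OF b] c 5 by simp
    then show ?thesis using 5 by simp
  qed
qed

lemma structure_at: "boolean_structure (Dir_orthoalg X) (dirs_at X w) (transport_boolalg phi B)"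
proof -
  have D: "oa_zero (Dir_orthoalg X) = dir_zero X" "oa_one (Dir_orthoalg X) = dir_one X"
    "oa_compl (Dir_orthoalg X) = dir_compl" "oa_plus (Dir_orthoalg X) = dir_plus X"
    by (simp_all add: Dir_orthoalg_def)
  show ?thesis
    unfolding phi_image[symmetric]
  proof (rule boolean_structure_transport[OF boolalg_axioms phi_inj])
    show "phi \<zero> = oa_zero (Dir_orthoalg X)" "phi \<one> = oa_one (Dir_orthoalg X)"
      unfolding D by (rule phi_zero, rule phi_one)
    show "phi (\<sim> c) = oa_compl (Dir_orthoalg X) (phi c)" if "c \<in> \<C>" for c
      unfolding D by (rule phi_compl[OF that])
    show "oa_plus (Dir_orthoalg X) (phi c) (phi d) = (if c \<sqinter> d = \<zero> then Some (phi (c \<squnion> d)) else None)"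
      if "c \<in> \<C>" "d \<in> \<C>" for c d
      unfolding D by (rule phi_plus[OF that])
  qed
qed

end

section \<open>The orthoalgebra of directions\<close>

context short_orthodomain
begin

abbreviation DA :: "'x dir orthoalg" where "DA \<equiv> Dir_orthoalg X"

lemma DA_simps:
  "oa_carrier DA = Dir X" "oa_plus DA = dir_plus X" "oa_compl DA = dir_compl"
  "oa_zero DA = dir_zero X" "oa_one DA = dir_one X"
  by (simp_all add: Dir_orthoalg_def)

lemma obtain_big:
  assumes "w \<in> X" "\<not> basic X w"
  obtains B :: "('x \<times> bool) boolalg" and g where "big_chart X w B g"
proof -
  obtain B :: "('x \<times> bool) boolalg" and g where "short_chart B (down_in X w) g"
    using obtain_chart assms by blast
  then have "big_chart X w B g"
    using assms short_orthodomain_axioms by (simp add: big_chart_def big_chart_axioms_def)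
  then show thesis using that by blast
qed

lemma dirs_at_Dir: "d \<in> dirs_at X w \<Longrightarrow> d \<in> Dir X"
  by (simp add: dirs_at_def)

lemma dirs_at_iff: "is_direction X x d \<Longrightarrow> d \<in> dirs_at X w \<longleftrightarrow> w \<in> X \<and> x \<le> w"
  using is_directionD(2)[of X x d] by (auto simp: dirs_at_def Dir_def up_in_def)

lemma dirs_at_mono:
  assumes "v \<le> w" "w \<in> X"
  shows "dirs_at X v \<subseteq> dirs_at X w"
proof
  fix d assume d: "d \<in> dirs_at X v"
  then obtain x where x: "is_direction X x d" by (auto simp: dirs_at_def Dir_def)
  then have "x \<le> v" using dirs_at_iff d by blast
  then show "d \<in> dirs_at X w" using dirs_at_iff[OF x] assms by auto
qed

lemma zero_one_dirs_at: "w \<in> X \<Longrightarrow> dir_zero X \<in> dirs_at X w" "w \<in> X \<Longrightarrow> dir_one X \<in> dirs_at X w"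
  using dirs_at_iff[OF dir_zero_direction] dirs_at_iff[OF dir_one_direction] bt_in by auto

lemma Dir_compl: "d \<in> Dir X \<Longrightarrow> dir_compl d \<in> Dir X"
  using is_direction_dir_compl by (auto simp: Dir_def)

lemma compl_dirs_at: "d \<in> dirs_at X w \<Longrightarrow> dir_compl d \<in> dirs_at X w"
  using Dir_compl by (simp add: dirs_at_def)

lemma Dir_big:
  assumes "d \<in> Dir X"
  shows "\<exists>w\<in>X. \<not> basic X w \<and> d \<in> dirs_at X w"
proof -
  obtain x where x: "is_direction X x d" using assms by (auto simp: Dir_def)
  then obtain w where "w \<in> X" "x \<le> w" "\<not> basic X w" using nonbasic_above is_directionD(1) by blast
  then show ?thesis using dirs_at_iff[OF x] by blast
qed

lemma nonbasic_mono:
  assumes v: "v \<in> X" "\<not> basic X v" and m: "v \<le> m" "m \<in> X"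
  shows "\<not> basic X m"
proof
  assume b: "basic X m"
  have bv: "bt < v" using v bt_in(2)[OF v(1)] by (metis basic_def is_least_iff_bt order.not_eq_order_implies_strict)
  then have "m \<noteq> bt" using m by auto
  then have "covers X bt m" using b unfolding basic_def is_atom_def is_least_iff_bt by blast
  then have "\<not> v < m" using bv v by (auto simp: covers_def)
  then show False using m b v(2) by (auto simp: le_less)
qed

lemma near_summands_at:
  assumes "near_summands X d e v z"
  shows "v \<in> X" "\<not> basic X v" "d \<in> dirs_at X v" "e \<in> dirs_at X v"
proof -
  obtain x y where n: "is_direction X x d" "is_direction X y e" "near X x y" "is_lub X {x, y} v"
    using assms unfolding near_summands_def by blast
  obtain u where u: "is_lub X {x, y} u" "covers X x u" "is_atom X x" using n(3) unfolding near_def by blast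
  have "u = v" using is_lub_unique u(1) n(4) by blast
  then show "v \<in> X" "\<not> basic X v" using u nonbasic_of_cover by (auto simp: covers_def)
  then show "d \<in> dirs_at X v" "e \<in> dirs_at X v"
    using dirs_at_iff[OF n(1)] dirs_at_iff[OF n(2)] n(4) by (auto simp: is_lub_def)
qed

lemma dir_plus_cases:
  assumes "dir_plus X d e = Some s"
  obtains "e = dir_zero X" "s = d" | "d = dir_zero X" "s = e" | "e = dir_compl d" "s = dir_one X"
    | v z where "near_summands X d e v z" "e \<noteq> dir_zero X" "d \<noteq> dir_zero X" "e \<noteq> dir_compl d"
  using assms unfolding dir_plus_def by (metis option.distinct(1) option.inject)

lemma common_big:
  assumes "d \<in> Dir X" "e \<in> Dir X" "dir_plus X d e = Some s"
  shows "\<exists>w\<in>X. \<not> basic X w \<and> d \<in> dirs_at X w \<and> e \<in> dirs_at X w"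
  using assms(3)
proof (cases rule: dir_plus_cases)
  case 1
  then show ?thesis using Dir_big[OF assms(1)] zero_one_dirs_at by blast
next
  case 2
  then show ?thesis using Dir_big[OF assms(2)] zero_one_dirs_at by blast
next
  case 3
  then show ?thesis using Dir_big[OF assms(1)] compl_dirs_at by blast
next
  case 4
  then show ?thesis using near_summands_at by blast
qed

lemma plus_dirs_at:
  assumes w: "w \<in> X" "\<not> basic X w" and de: "d \<in> dirs_at X w" "e \<in> dirs_at X w"
  shows "dir_plus X d e = dir_plus X e d" "dir_plus X d e = Some s \<Longrightarrow> s \<in> dirs_at X w"
proof -
  obtain B :: "('x \<times> bool) boolalg" and g where "big_chart X w B g" using obtain_big w by blast
  then interpret big_chart X w B g .
  obtain a b where ab: "a \<in> ba_carrier B" "b \<in> ba_carrier B" "d = phi a" "e = phi b" using phi_surj[OF de(1)] phi_surj[OF de(2)] by blast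
  show "dir_plus X d e = dir_plus X e d"
    unfolding ab phi_plus[OF ab(1,2)] phi_plus[OF ab(2,1)]
    using meet_commute[OF ab(1,2)] join_commute[OF ab(1,2)] by simp
  assume s: "dir_plus X d e = Some s"
  have "s = phi (ba_join B a b)" using s unfolding ab phi_plus[OF ab(1,2)] by (simp split: if_splits)
  then show "s \<in> dirs_at X w" using phi_direction(3) ab by simp
qed

lemma dir_plus_commute:
  assumes "d \<in> Dir X" "e \<in> Dir X"
  shows "dir_plus X d e = dir_plus X e d"
proof (cases "dir_plus X d e = None \<and> dir_plus X e d = None")
  case False
  then obtain s where "dir_plus X d e = Some s \<or> dir_plus X e d = Some s" by auto
  then obtain w where "w \<in> X" "\<not> basic X w" "d \<in> dirs_at X w" "e \<in> dirs_at X w"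
    using common_big[OF assms] common_big[OF assms(2,1)] by blast
  then show ?thesis using plus_dirs_at(1) by blast
qed simp

text \<open>
  In the chart at \<open>v\<close> itself the sum is \<open>phi (a \<squnion> b)\<close>, whose base and value at \<open>v\<close> are
  known.
\<close>

lemma near_plus:
  assumes n: "near_summands X d e v z" and ne: "e \<noteq> dir_zero X" "d \<noteq> dir_zero X" "e \<noteq> dir_compl d"
    and s: "dir_plus X d e = Some s"
  shows "is_direction X z s" "s v = Some (v, z)" "covers X z v"
proof -
  note at = near_summands_at[OF n]
  obtain B :: "('x \<times> bool) boolalg" and g where "big_chart X v B g" using obtain_big at by blast
  then interpret big_chart X v B g .
  obtain a b where ab: "a \<in> ba_carrier B" "b \<in> ba_carrier B" "d = phi a" "e = phi b" using phi_surj[OF at(3)] phi_surj[OF at(4)] by blast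
  have sab: "ba_meet B a b = ba_zero B" "s = phi (ba_join B a b)"
    using s unfolding ab phi_plus[OF ab(1,2)] by (simp_all split: if_splits)
  have nz: "a \<noteq> (ba_zero B)" "b \<noteq> (ba_zero B)" "b \<noteq> (ba_compl B a)" using ne phi_zero phi_compl[OF ab(1)] ab by auto
  then have "ba_join B a b \<noteq> (ba_one B)" using compl_unique[OF ab(1,2) _ sab(1)] by blast
  then have t: "three_parts B a b (ba_compl B (ba_join B a b))" using three_partsI ab sab nz by blast
  let ?c = "(ba_compl B (ba_join B a b))"
  have cC: "ba_join B a b \<in> ba_carrier B" using ab by simp
  have vz: "v = inv_into (down_in X v) g (joins_of B {a, b, ?c})" "z = inv_into (down_in X v) g (four B ?c)"
    using n unfolding ab(3,4) three_near[OF t] by auto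
  note tc = three_parts_rotate(2)[OF t]
  have perm: "{?c, b, a} = {a, b, ?c}" by auto
  show "is_direction X z s" using phi_direction(1)[OF cC] four_compl[OF cC] sab(2) vz(2) by simp
  have cc: "ba_compl B ?c = ba_join B a b" using compl_compl[OF cC] .
  show "s v = Some (v, z)" using three_phi(2)[OF tc] unfolding perm cc sab(2) vz(1)[symmetric] vz(2)[symmetric] .
  show "covers X z v" using three_cover[OF tc] unfolding perm vz(1)[symmetric] vz(2)[symmetric] .
qed

lemma plus_eq_zero_dirs:
  assumes "d \<in> Dir X" "e \<in> Dir X" "dir_plus X d e = Some (dir_zero X)"
  shows "d = dir_zero X" "e = dir_zero X"
proof -
  obtain w where w: "w \<in> X" "\<not> basic X w" "d \<in> dirs_at X w" "e \<in> dirs_at X w"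
    using common_big assms by blast
  obtain B :: "('x \<times> bool) boolalg" and g where "big_chart X w B g" using obtain_big w by blast
  then interpret big_chart X w B g .
  obtain a b where ab: "a \<in> ba_carrier B" "b \<in> ba_carrier B" "d = phi a" "e = phi b"
    using phi_surj[OF w(3)] phi_surj[OF w(4)] by blast
  have "phi (ba_join B a b) = phi (ba_zero B)"
    using assms(3) unfolding ab phi_plus[OF ab(1,2)] phi_zero by (simp split: if_splits)
  then have j: "ba_join B a b = ba_zero B" using phi_eq_iff ab by simp
  have "\<not> v a \<and> \<not> v b" if "valuation B v" for v using arg_cong[OF j, of v] that ab(1,2) by simp
  then have "a = ba_zero B" "b = ba_zero B" using ab(1,2) by (intro valuation_eqI; auto)+
  then show "d = dir_zero X" "e = dir_zero X" using ab phi_zero by simp_all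
qed

text \<open>
  The point of associativity: summands of an iterated sum lie below one element.  In the
  main case \<open>s = d \<oplus> e\<close> has orientation \<open>(v, u)\<close> at the join \<open>v\<close> of the bases of \<open>d\<close> and \<open>e\<close>,
  because it is a sum, and \<open>(u, t)\<close> at the join \<open>t\<close> of the bases of \<open>s\<close> and \<open>f\<close>, because it is a
  summand.  Both \<open>v\<close> and \<open>t\<close> cover the base \<open>u\<close> of \<open>s\<close>, so condition (3) yields an upper bound of
  \<open>v\<close> and \<open>t\<close>.
\<close>

lemma common_big_three:
  assumes D: "d \<in> Dir X" "e \<in> Dir X" "f \<in> Dir X"
    and s: "dir_plus X d e = Some s" and r: "dir_plus X s f = Some r"
  shows "\<exists>w\<in>X. \<not> basic X w \<and> d \<in> dirs_at X w \<and> e \<in> dirs_at X w \<and> f \<in> dirs_at X w"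
proof -
  obtain w where w: "w \<in> X" "\<not> basic X w" "d \<in> dirs_at X w" "e \<in> dirs_at X w"
    using common_big[OF D(1,2) s] by blast
  have sw: "s \<in> dirs_at X w" using plus_dirs_at(2)[OF w s] .
  from r show ?thesis
  proof (cases rule: dir_plus_cases)
    case 1
    then show ?thesis using w zero_one_dirs_at by blast
  next
    case 2
    then have "d = dir_zero X" "e = dir_zero X" using plus_eq_zero_dirs D s by auto
    then show ?thesis using Dir_big[OF D(3)] zero_one_dirs_at by blast
  next
    case 3
    then show ?thesis using w sw compl_dirs_at by blast
  next
    case (4 t z')
    note t = near_summands_at[OF 4(1)]
    obtain u where u: "is_direction X u s" "is_atom X u" "s t = Some (u, t)" "covers X u t"
    proof -
      obtain u y where n: "is_direction X u s" "s t = Some (u, t)" "near X u y" "is_lub X {u, y} t"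
        using 4(1) unfolding near_summands_def by blast
      obtain m where "is_lub X {u, y} m" "covers X u m" "is_atom X u" using n(3) unfolding near_def by blast
      then show thesis using that n is_lub_unique by metis
    qed
    from s show ?thesis
    proof (cases rule: dir_plus_cases)
      case 1
      then show ?thesis using t zero_one_dirs_at by blast
    next
      case 2
      then show ?thesis using t zero_one_dirs_at by blast
    next
      case 3
      then have "u = bt" using base_unique u(1) dir_one_direction by blast
      then show ?thesis using u(2) is_atom_iff by blast
    next
      case (4 v z)
      note v = near_summands_at[OF 4(1)] and nv = near_plus[OF 4 s]
      have "z = u" using base_unique nv(1) u(1) by blast
      then obtain m where m: "is_lub X {t, v} m"
        using is_directionD(5)[OF u(1,4) _ u(3)] nv(2,3) by blast
      then have m': "m \<in> X" "t \<le> m" "v \<le> m" by (auto simp: is_lub_def)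
      have "\<not> basic X m" using nonbasic_mono v(1,2) m' by blast
      moreover have "d \<in> dirs_at X m" "e \<in> dirs_at X m" "f \<in> dirs_at X m"
        using v t m' dirs_at_mono by blast+
      ultimately show ?thesis using m'(1) by blast
    qed
  qed
qed

lemma dir_plus_assocD:
  assumes D: "d \<in> Dir X" "e \<in> Dir X" "f \<in> Dir X"
    and s: "dir_plus X d e = Some s" and r: "dir_plus X s f = Some r"
  shows "\<exists>t. dir_plus X e f = Some t \<and> dir_plus X d t = Some r"
proof -
  obtain w where w: "w \<in> X" "\<not> basic X w" "d \<in> dirs_at X w" "e \<in> dirs_at X w" "f \<in> dirs_at X w"
    using common_big_three[OF assms] by blast
  obtain B :: "('x \<times> bool) boolalg" and g where "big_chart X w B g" using obtain_big w by blast
  then interpret big_chart X w B g .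
  obtain a b c where abc: "a \<in> ba_carrier B" "b \<in> ba_carrier B" "c \<in> ba_carrier B" "d = phi a" "e = phi b" "f = phi c"
    using phi_surj[OF w(3)] phi_surj[OF w(4)] phi_surj[OF w(5)] by blast
  have ab: "ba_meet B a b = ba_zero B" "s = phi (ba_join B a b)"
    using s unfolding abc phi_plus[OF abc(1,2)] by (simp_all split: if_splits)
  have jC: "ba_join B a b \<in> ba_carrier B" "ba_join B b c \<in> ba_carrier B" using abc by auto
  have abc0: "ba_meet B (ba_join B a b) c = ba_zero B" "r = phi (ba_join B (ba_join B a b) c)"
    using r unfolding abc ab phi_plus[OF jC(1) abc(3)] by (simp_all split: if_splits)
  have v: "\<not> (v a \<and> v b) \<and> \<not> (v a \<and> v c) \<and> \<not> (v b \<and> v c)" if "valuation B v" for v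
    using arg_cong[OF ab(1), of v] arg_cong[OF abc0(1), of v] that abc(1-3) by auto
  have "ba_meet B b c = ba_zero B" "ba_meet B a (ba_join B b c) = ba_zero B" by (rule valuation_eqI; use v abc(1-3) in auto)+
  then have "dir_plus X e f = Some (phi (ba_join B b c))" "dir_plus X d (phi (ba_join B b c)) = Some (phi (ba_join B a (ba_join B b c)))"
    unfolding abc by (simp_all add: phi_plus abc(1-3))
  then show ?thesis using abc0(2) join_assoc[OF abc(1-3)] by simp
qed

lemma dir_plus_closed:
  assumes "d \<in> Dir X" "e \<in> Dir X" "dir_plus X d e = Some s"
  shows "s \<in> Dir X"
  using common_big[OF assms] plus_dirs_at(2) assms(3) dirs_at_Dir by blast

text \<open>
  All axioms hold in the Boolean algebras attached to non-basic elements, and whenever a sum is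
  defined its summands lie in one of these.
\<close>

lemma Dir_orthoalgebra: "orthoalgebra DA"
proof
  fix a b c
  show "oa_zero DA \<in> oa_carrier DA" "oa_one DA \<in> oa_carrier DA"
    using dir_zero_direction dir_one_direction by (auto simp: DA_simps Dir_def)
  show "oa_compl DA a \<in> oa_carrier DA" if "a \<in> oa_carrier DA"
    using that Dir_compl by (simp add: DA_simps)
  show "c \<in> oa_carrier DA" if "a \<in> oa_carrier DA" "b \<in> oa_carrier DA" "oa_plus DA a b = Some c"
    using that dir_plus_closed unfolding DA_simps by blast
  show "oa_plus DA a b = oa_plus DA b a" if "a \<in> oa_carrier DA" "b \<in> oa_carrier DA"
    using that dir_plus_commute unfolding DA_simps by blast
  show "Option.bind (oa_plus DA a b) (\<lambda>s. oa_plus DA s c) = Option.bind (oa_plus DA b c) (\<lambda>t. oa_plus DA a t)"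
    if "a \<in> oa_carrier DA" "b \<in> oa_carrier DA" "c \<in> oa_carrier DA"
  proof -
    have D: "a \<in> Dir X" "b \<in> Dir X" "c \<in> Dir X" using that by (simp_all add: DA_simps)
    have "Option.bind (dir_plus X a b) (\<lambda>s. dir_plus X s c) = Some r \<longleftrightarrow>
      Option.bind (dir_plus X b c) (\<lambda>t. dir_plus X a t) = Some r" for r
    proof
      assume "Option.bind (dir_plus X a b) (\<lambda>s. dir_plus X s c) = Some r"
      then obtain s where "dir_plus X a b = Some s" "dir_plus X s c = Some r"
        by (auto simp: bind_eq_Some_conv)
      then obtain t where "dir_plus X b c = Some t" "dir_plus X a t = Some r"
        using dir_plus_assocD D by blast
      then show "Option.bind (dir_plus X b c) (\<lambda>t. dir_plus X a t) = Some r" by simp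
    next
      assume "Option.bind (dir_plus X b c) (\<lambda>t. dir_plus X a t) = Some r"
      then obtain t where t: "dir_plus X b c = Some t" "dir_plus X a t = Some r"
        by (auto simp: bind_eq_Some_conv)
      have tD: "t \<in> Dir X" using dir_plus_closed D t(1) by blast
      have "dir_plus X c b = Some t" "dir_plus X t a = Some r"
        using t dir_plus_commute[OF D(2,3)] dir_plus_commute[OF D(1) tD] by simp_all
      then obtain s where s: "dir_plus X b a = Some s" "dir_plus X c s = Some r"
        using dir_plus_assocD[OF D(3,2,1)] by blast
      have sD: "s \<in> Dir X" using dir_plus_closed D s(1) by blast
      have "dir_plus X a b = Some s" "dir_plus X s c = Some r"
        using s dir_plus_commute[OF D(1,2)] dir_plus_commute[OF D(3) sD] by simp_all
      then show "Option.bind (dir_plus X a b) (\<lambda>s. dir_plus X s c) = Some r" by simp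
    qed
    then show ?thesis unfolding DA_simps by (metis not_Some_eq)
  qed
  show "oa_plus DA a b = Some (oa_one DA) \<longleftrightarrow> b = oa_compl DA a"
    if ab: "a \<in> oa_carrier DA" "b \<in> oa_carrier DA"
  proof -
    have D: "a \<in> Dir X" "b \<in> Dir X" using ab by (simp_all add: DA_simps)
    have "\<exists>w\<in>X. \<not> basic X w \<and> a \<in> dirs_at X w \<and> b \<in> dirs_at X w"
      if "dir_plus X a b = Some (dir_one X) \<or> b = dir_compl a"
      using that common_big[OF D] Dir_big[OF D(1)] compl_dirs_at by blast
    moreover have "dir_plus X a b = Some (dir_one X) \<longleftrightarrow> b = dir_compl a"
      if w: "w \<in> X" "\<not> basic X w" "a \<in> dirs_at X w" "b \<in> dirs_at X w" for w
    proof -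
      obtain B :: "('x \<times> bool) boolalg" and g where "big_chart X w B g" using obtain_big w by blast
      then interpret big_chart X w B g .
      obtain p q where pq: "p \<in> ba_carrier B" "q \<in> ba_carrier B" "a = phi p" "b = phi q"
        using phi_surj[OF w(3)] phi_surj[OF w(4)] by blast
      have "dir_plus X a b = Some (dir_one X) \<longleftrightarrow> (ba_meet B p q) = ba_zero B \<and> (ba_join B p q) = ba_one B"
        unfolding pq phi_plus[OF pq(1,2)] phi_one[symmetric] using pq phi_eq_iff by simp
      also have "\<dots> \<longleftrightarrow> q = ba_compl B p" using compl_unique[OF pq(1,2)] meet_compl[OF pq(1)] join_compl[OF pq(1)] by blast
      also have "\<dots> \<longleftrightarrow> b = dir_compl a"
        unfolding pq phi_compl[OF pq(1), symmetric] using phi_eq_iff pq by simp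
      finally show ?thesis .
    qed
    ultimately show ?thesis unfolding DA_simps by blast
  qed
  show "oa_plus DA a a \<noteq> None \<longleftrightarrow> a = oa_zero DA" if a: "a \<in> oa_carrier DA"
  proof -
    obtain w where w: "w \<in> X" "\<not> basic X w" "a \<in> dirs_at X w" using Dir_big a by (auto simp: DA_simps)
    obtain B :: "('x \<times> bool) boolalg" and g where "big_chart X w B g" using obtain_big w by blast
    then interpret big_chart X w B g .
    obtain p where p: "p \<in> ba_carrier B" "a = phi p" using phi_surj[OF w(3)] by blast
    show ?thesis
      unfolding DA_simps p(2) phi_plus[OF p(1,1)] phi_zero[symmetric]
      using phi_eq_iff[OF p(1) zero_closed] meet_idem[OF p(1)] by simp
  qed
qed

section \<open>The Boolean subalgebras of the orthoalgebra of directions\<close>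

text \<open>
  The Boolean algebra on \<open>dirs_at w\<close> is a copy of \<open>B\<close>, and under this copy the subalgebra
  \<open>g v\<close> becomes \<open>dirs_at v\<close>.
\<close>

lemma big_dirs_at:
  assumes w: "w \<in> X" "\<not> basic X w"
  shows "dirs_at X w \<in> BSub DA"
    "T \<in> BSub DA \<and> T \<subseteq> dirs_at X w \<longleftrightarrow> (\<exists>v\<in>X. v \<le> w \<and> T = dirs_at X v)"
proof -
  obtain B :: "('x \<times> bool) boolalg" and g where "big_chart X w B g" using obtain_big w by blast
  then interpret big_chart X w B g .
  interpret D: orthoalgebra DA by (rule Dir_orthoalgebra)
  show 1: "dirs_at X w \<in> BSub DA"
    using D.BSub_iff structure_at dirs_at_Dir by (auto simp: DA_simps)
  have "down_in (BSub DA) (dirs_at X w) = (`) phi ` Sub B"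
    using D.down_BSub_eq_Sub[OF 1 structure_at] transport(2)[OF phi_inj] by simp
  then have "T \<in> down_in (BSub DA) (dirs_at X w) \<longleftrightarrow> (\<exists>S\<in>Sub B. T = phi ` S)"
    by blast
  then have "T \<in> BSub DA \<and> T \<subseteq> dirs_at X w \<longleftrightarrow> (\<exists>S\<in>Sub B. T = phi ` S)"
    by (simp add: down_in_def)
  also have "\<dots> \<longleftrightarrow> (\<exists>v\<in>down_in X w. T = phi ` g v)"
  proof -
    have e: "Sub B = g ` down_in X w" using bij by (simp add: bij_betw_def)
    show ?thesis unfolding e by simp
  qed
  also have "\<dots> \<longleftrightarrow> (\<exists>v\<in>down_in X w. T = dirs_at X v)" by (simp add: dirs_at_below)
  also have "\<dots> \<longleftrightarrow> (\<exists>v\<in>X. v \<le> w \<and> T = dirs_at X v)" by (auto simp: down_in_def)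
  finally show "T \<in> BSub DA \<and> T \<subseteq> dirs_at X w \<longleftrightarrow> (\<exists>v\<in>X. v \<le> w \<and> T = dirs_at X v)" .
qed

lemma big_above:
  assumes "v \<in> X"
  shows "\<exists>w\<in>X. v \<le> w \<and> \<not> basic X w"
  using nonbasic_above assms by (cases "basic X v") auto

text \<open>
  Every atom below \<open>u\<close> is the base of some direction, and \<open>u\<close> is the join of these atoms.
\<close>

lemma dirs_at_le_iff:
  assumes u: "u \<in> X" and v: "v \<in> X"
  shows "dirs_at X u \<subseteq> dirs_at X v \<longleftrightarrow> u \<le> v"
proof
  assume sub: "dirs_at X u \<subseteq> dirs_at X v"
  have "a \<le> v" if a: "is_atom X a" "a \<le> u" for a
  proof -
    obtain d where d: "is_direction X a d" using enough a by (auto simp: enough_directions_def basic_def)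
    then have "d \<in> dirs_at X u" using dirs_at_iff u a by blast
    then show ?thesis using sub dirs_at_iff[OF d] by blast
  qed
  moreover have "is_lub X {a. is_atom X a \<and> a \<le> u} u"
    using od u by (auto simp: orthodomain_def atomistic_def)
  ultimately show "u \<le> v" using v by (auto simp: is_lub_def)
qed (use dirs_at_mono v in blast)

lemma dirs_at_BSub:
  assumes v: "v \<in> X"
  shows "dirs_at X v \<in> BSub DA"
    "T \<in> BSub DA \<and> T \<subseteq> dirs_at X v \<longleftrightarrow> (\<exists>u\<in>X. u \<le> v \<and> T = dirs_at X u)"
proof -
  obtain w where w: "w \<in> X" "v \<le> w" "\<not> basic X w" using big_above v by blast
  show 1: "dirs_at X v \<in> BSub DA" using big_dirs_at(2)[OF w(1,3), of "dirs_at X v"] v w by blast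
  show "T \<in> BSub DA \<and> T \<subseteq> dirs_at X v \<longleftrightarrow> (\<exists>u\<in>X. u \<le> v \<and> T = dirs_at X u)"
  proof
    assume T: "T \<in> BSub DA \<and> T \<subseteq> dirs_at X v"
    then have "T \<subseteq> dirs_at X w" using dirs_at_mono[OF w(2,1)] by blast
    then obtain u where u: "u \<in> X" "T = dirs_at X u" using big_dirs_at(2)[OF w(1,3), of T] T by blast
    then show "\<exists>u\<in>X. u \<le> v \<and> T = dirs_at X u" using dirs_at_le_iff[OF u(1) v] T by blast
  next
    assume "\<exists>u\<in>X. u \<le> v \<and> T = dirs_at X u"
    then obtain u where u: "u \<in> X" "u \<le> v" "T = dirs_at X u" by blast
    then show "T \<in> BSub DA \<and> T \<subseteq> dirs_at X v"
      using big_dirs_at(2)[OF w(1,3), of T] dirs_at_mono[OF u(2) v] w order.trans by blast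
  qed
qed

lemma dirs_at_star:
  assumes v: "v \<in> X"
  shows "dirs_at X v \<in> star (BSub DA)"
proof -
  have "height X v = height (BSub DA) (dirs_at X v)"
  proof (rule height_iso)
    show "bij_betw (dirs_at X) (down_in X v) (down_in (BSub DA) (dirs_at X v))"
    proof (rule bij_betw_imageI)
      show "inj_on (dirs_at X) (down_in X v)"
      proof (rule inj_onI)
        fix a b assume "a \<in> down_in X v" "b \<in> down_in X v" "dirs_at X a = dirs_at X b"
        then show "a = b" using dirs_at_le_iff[of a b] dirs_at_le_iff[of b a] by (simp add: down_in_def)
      qed
      show "dirs_at X ` down_in X v = down_in (BSub DA) (dirs_at X v)"
      proof (intro subset_antisym subsetI)
        fix T assume "T \<in> dirs_at X ` down_in X v"
        then have "T \<in> BSub DA \<and> T \<subseteq> dirs_at X v"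
          using dirs_at_BSub(2)[OF v, of T] by (auto simp: down_in_def)
        then show "T \<in> down_in (BSub DA) (dirs_at X v)" by (simp add: down_in_def)
      next
        fix T assume "T \<in> down_in (BSub DA) (dirs_at X v)"
        then have "T \<in> BSub DA \<and> T \<subseteq> dirs_at X v" by (simp add: down_in_def)
        then obtain u where "u \<in> X" "u \<le> v" "T = dirs_at X u" using dirs_at_BSub(2)[OF v, of T] by blast
        then show "T \<in> dirs_at X ` down_in X v" by (simp add: down_in_def)
      qed
    qed
    show "a \<le> b \<longleftrightarrow> dirs_at X a \<le> dirs_at X b" if "a \<in> down_in X v" "b \<in> down_in X v" for a b
      using dirs_at_le_iff that by (simp add: down_in_def)
  qed
  moreover have "height X v \<le> 3" using short v by (auto simp: short_def star_def)
  ultimately show ?thesis using dirs_at_BSub(1)[OF v] by (simp add: star_def)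
qed

lemma joins_of_dirs_at:
  assumes U: "boolean_structure DA U B" and F: "partition_of_unity B F" "F \<subseteq> dirs_at X w"
    and w: "w \<in> X" "\<not> basic X w"
  shows "joins_of B F \<subseteq> dirs_at X w"
proof
  interpret B: boolalg B using boolean_structureD(1)[OF U] .
  note b = boolean_structureD[OF U, unfolded DA_simps]
  fix s assume "s \<in> joins_of B F"
  from F(1) this show "s \<in> dirs_at X w"
  proof (induction rule: B.joins_of_induct)
    case zero
    then show ?case using b(3) zero_one_dirs_at w by simp
  next
    case (join f s)
    have "f \<in> U" "s \<in> U" using join F(1) b(2) by (auto simp: partition_of_unity_def)
    then have "dir_plus X f s = Some (ba_join B f s)" using b(6) join by simp
    then show ?case using plus_dirs_at(2)[OF w _ join.IH] join.hyps(1) F(2) by blast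
  qed
qed

text \<open>
  A Boolean algebra \<open>U\<close> whose subalgebras form a poset of height at most \<open>3\<close> consists of the joins of at
  most four orthogonal elements: starting from \<open>three_parts\<close>, one part is split once more if this does
  not exhaust \<open>U\<close>, and another split would give a chain that is too long.  The parts lie below one
  element of \<open>X\<close> by \<open>common_big\<close> or \<open>common_big_three\<close>, and then so do their joins.
\<close>

lemma star_BSub_below:
  assumes U: "U \<in> star (BSub DA)"
  shows "\<exists>w\<in>X. \<not> basic X w \<and> U \<subseteq> dirs_at X w"
proof -
  interpret D: orthoalgebra DA by (rule Dir_orthoalgebra)
  have UB: "U \<in> BSub DA" "height (BSub DA) U \<le> 3" using U by (auto simp: star_def)
  obtain B where B: "boolean_structure DA U B" using D.obtain_structure UB by blast
  interpret B: boolalg B using boolean_structureD(1)[OF B] .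
  note b = boolean_structureD[OF B, unfolded DA_simps]
  have UD: "\<And>d. d \<in> U \<Longrightarrow> d \<in> Dir X" using D.BSub_closed(6)[OF UB(1)] by (simp add: DA_simps)
  have US: "U \<in> Sub B" using B.carrier_in_Sub b(2) by simp
  have nochain: False if "S0 \<in> Sub B" "S1 \<in> Sub B" "S2 \<in> Sub B" "S3 \<in> Sub B"
    "S0 \<subset> S1" "S1 \<subset> S2" "S2 \<subset> S3" "S3 \<subset> U" for S0 S1 S2 S3
    using height_le_three_no_chain[OF UB(2), of S0 S1 S2 S3 U] that US D.down_BSub_eq_Sub[OF UB(1) B] by simp
  show ?thesis
  proof (cases "\<exists>p\<in>U. U = four B p")
    case True
    then obtain p where p: "p \<in> U" "U = four B p" by blast
    obtain w where w: "w \<in> X" "\<not> basic X w" "p \<in> dirs_at X w" using Dir_big UD p by blast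
    have "U = {dir_zero X, dir_one X, p, dir_compl p}" using p b(3,4,5) by (simp add: four_def)
    then show ?thesis using w zero_one_dirs_at compl_dirs_at by blast
  next
    case no4: False
    have "U \<noteq> {ba_zero B, ba_one B}" using no4 B.SubD(2)[OF US] B.four_zero by metis
    then obtain p where p: "p \<in> U" "p \<noteq> ba_zero B" "p \<noteq> ba_one B" using B.SubD(2,3)[OF US] by blast
    \<comment> \<open>an element \<open>q\<close> of \<open>S\<close> is split properly by \<open>t\<close> when \<open>t \<sqinter> q \<notin> S\<close>\<close>
    have split: "t' \<noteq> ba_zero B" "ba_meet B (ba_compl B t) q \<noteq> ba_zero B"
      if "t' = ba_meet B t q" "q \<in> S" "S \<in> Sub B" "t \<in> U" "t' \<notin> S" for t t' q S
    proof -
      show "t' \<noteq> ba_zero B" using that(5) B.SubD(2)[OF that(3)] by auto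
      show "ba_meet B (ba_compl B t) q \<noteq> ba_zero B"
      proof
        assume z: "ba_meet B (ba_compl B t) q = ba_zero B"
        have C: "t \<in> ba_carrier B" "q \<in> ba_carrier B" using that b(2) B.SubD(7)[OF that(3)] by auto
        have "v q \<longrightarrow> v t" if "valuation B v" for v using arg_cong[OF z, of v] that C by auto
        then have "t' = q" unfolding that(1) using C by (intro B.valuation_eqI) auto
        then show False using that by simp
      qed
    qed
    have "\<exists>a\<in>U. \<exists>b\<in>U. three_parts B a b (ba_compl B (ba_join B a b))"
    proof -
      have pC: "p \<in> ba_carrier B" using p b(2) by simp
      have fS: "four B p \<in> Sub B" using B.four_in_Sub pC by blast
      obtain t where t: "t \<in> U" "t \<notin> four B p"
        using no4 p(1) B.four_least[OF US p(1)] by blast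
      have tC: "t \<in> ba_carrier B" using t b(2) by simp
      have "ba_join B (ba_meet B t p) (ba_meet B t (ba_compl B p)) = t"
        using tC pC by (intro B.valuation_eqI) auto
      then have "ba_meet B t p \<notin> four B p \<or> ba_meet B t (ba_compl B p) \<notin> four B p"
        using B.SubD(5)[OF fS] t(2) by metis
      then obtain q where q: "q = p \<or> q = ba_compl B p" "ba_meet B t q \<notin> four B p" by blast
      have qf: "q \<in> four B p" using q(1) by (auto simp: four_def)
      have qC: "q \<in> ba_carrier B" "q \<noteq> ba_one B"
        using q(1) pC p B.compl_compl[OF pC] B.compl_one by auto
      let ?a = "ba_meet B t q" and ?b = "ba_meet B (ba_compl B t) q"
      have ab: "?a \<in> ba_carrier B" "?b \<in> ba_carrier B" using tC qC by auto
      have "ba_meet B ?a ?b = ba_zero B" "ba_join B ?a ?b = q"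
        using tC qC(1) by (intro B.valuation_eqI; auto)+
      then have "three_parts B ?a ?b (ba_compl B (ba_join B ?a ?b))"
        using B.three_partsI[OF ab _ split[OF refl qf fS t(1) q(2)]] qC(2) by simp
      then show ?thesis using ab b(2) by blast
    qed
    then obtain a c where ac: "a \<in> U" "c \<in> U" "three_parts B a c (ba_compl B (ba_join B a c))" by blast
    define e where "e = ba_compl B (ba_join B a c)"
    have t3: "three_parts B a c e" using ac e_def by simp
    define T where "T = joins_of B {a, c, e}"
    have three_dirs: "{a', c', e'} \<subseteq> dirs_at X w"
      if t: "three_parts B a' c' e'" and w: "w \<in> X" "\<not> basic X w" and d: "a' \<in> dirs_at X w" "c' \<in> dirs_at X w"
      for a' c' e' w
    proof -
      have C: "a' \<in> U" "c' \<in> U" "e' \<in> U" using t b(2) by (auto simp: three_parts_def)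
      have "ba_meet B a' c' = ba_zero B"
        using t by (intro B.valuation_eqI) (auto simp: three_parts_def)
      then have "dir_plus X a' c' = Some (ba_join B a' c')" using b(6)[OF C(1,2)] by simp
      then have "ba_join B a' c' \<in> dirs_at X w" using plus_dirs_at(2)[OF w d] by blast
      then have "dir_compl (ba_compl B e') \<in> dirs_at X w"
        using compl_dirs_at B.three_parts_compl(1)[OF t] by simp
      then have "e' \<in> dirs_at X w" using b(5)[OF C(3)] by simp
      then show ?thesis using d by blast
    qed
    have plus3: "dir_plus X a' c' = Some (ba_join B a' c')" if t: "three_parts B a' c' e'" for a' c' e'
    proof -
      have C: "a' \<in> U" "c' \<in> U" using t b(2) by (auto simp: three_parts_def)
      have "ba_meet B a' c' = ba_zero B"
        using t by (intro B.valuation_eqI) (auto simp: three_parts_def)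
      then show ?thesis using b(6)[OF C] by simp
    qed
    show ?thesis
    proof (cases "U = T")
      case True
      obtain w where w: "w \<in> X" "\<not> basic X w" "a \<in> dirs_at X w" "c \<in> dirs_at X w"
        using common_big[OF UD[OF ac(1)] UD[OF ac(2)] plus3[OF t3]] by blast
      then show ?thesis
        using joins_of_dirs_at[OF B B.three_parts_partition[OF t3] three_dirs[OF t3 w] w(1,2)] True T_def by blast
    next
      case False
      have TS: "T \<in> Sub B" using B.three_parts_psub(4)[OF t3] by (simp add: T_def)
      have TU: "T \<subset> U" using False B.SubD(1)[OF TS] b(2) by blast
      then obtain t where t: "t \<in> U" "t \<notin> T" by blast
      have tC: "t \<in> ba_carrier B" using t b(2) by simp
      have aceC: "a \<in> ba_carrier B" "c \<in> ba_carrier B" "e \<in> ba_carrier B"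
        using t3 by (auto simp: three_parts_def)
      have v3: "(v a \<and> \<not> v c \<and> \<not> v e) \<or> (\<not> v a \<and> v c \<and> \<not> v e) \<or> (\<not> v a \<and> \<not> v c \<and> v e)" if "valuation B v" for v
        using t3 that by (simp add: three_parts_def)
      have "ba_join B (ba_meet B t a) (ba_join B (ba_meet B t c) (ba_meet B t e)) = t"
        by (rule B.valuation_eqI; use tC aceC v3 in auto)
      then have "ba_meet B t a \<notin> T \<or> ba_meet B t c \<notin> T \<or> ba_meet B t e \<notin> T"
        using B.SubD(5)[OF TS] t(2) by metis
      moreover have "{c, a, e} = {a, c, e}" "{e, c, a} = {a, c, e}" by auto
      ultimately obtain a' c' e' where t3': "three_parts B a' c' e'" "joins_of B {a', c', e'} = T"
        "ba_meet B t a' \<notin> T"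
        using t3 B.three_parts_rotate(1)[OF t3] B.three_parts_rotate(2)[OF t3] T_def by metis
      have C: "a' \<in> ba_carrier B" "c' \<in> ba_carrier B" "e' \<in> ba_carrier B"
        using t3'(1) by (auto simp: three_parts_def)
      have v3': "(v a' \<and> \<not> v c' \<and> \<not> v e') \<or> (\<not> v a' \<and> v c' \<and> \<not> v e') \<or> (\<not> v a' \<and> \<not> v c' \<and> v e')"
        if "valuation B v" for v
        using t3'(1) that by (simp add: three_parts_def)
      have FT: "{a', c', e'} \<subseteq> T" using B.mem_joins_of[of "{a', c', e'}"] C t3'(2) by auto
      define r s where "r = ba_meet B t a'" and "s = ba_meet B (ba_compl B t) a'"
      have rsC: "r \<in> ba_carrier B" "s \<in> ba_carrier B" using tC C by (auto simp: r_def s_def)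
      have rs: "ba_join B r s = a'" "ba_meet B r s = ba_zero B"
        unfolding r_def s_def using tC C by (intro B.valuation_eqI; auto)+
      have vr: "v r \<longleftrightarrow> v t \<and> v a'" "v s \<longleftrightarrow> \<not> v t \<and> v a'" if "valuation B v" for v
        using that tC C by (auto simp: r_def s_def)
      have part: "partition_of_unity B {r, s, c', e'}"
        unfolding partition_of_unity_def
      proof (intro conjI allI impI)
        fix v assume v: "valuation B v"
        have "\<exists>f\<in>{r, s, c', e'}. v f" using v3'[OF v] vr[OF v] by (cases "v t") auto
        moreover have "\<forall>f\<in>{r, s, c', e'}. \<forall>g\<in>{r, s, c', e'}. v f \<longrightarrow> v g \<longrightarrow> f = g"
          using v3'[OF v] vr[OF v] by (cases "v t"; elim disjE) simp_all
        ultimately show "\<exists>!f. f \<in> {r, s, c', e'} \<and> v f" by blast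
      qed (use rsC C in auto)
      define T' where "T' = joins_of B {r, s, c', e'}"
      have T'S: "T' \<in> Sub B" using B.joins_of_in_Sub[OF part] by (simp add: T'_def)
      have F': "{r, s, c', e'} \<subseteq> T'"
        using B.mem_joins_of[of "{r, s, c', e'}"] rsC C by (auto simp: T'_def)
      have "a' \<in> T'" using B.SubD(5)[OF T'S, of r s] F' rs(1) by simp
      then have "T \<subseteq> T'"
        using B.joins_of_least[OF B.three_parts_partition[OF t3'(1)] T'S] F' t3'(2) by blast
      moreover have "r \<in> T'" "r \<notin> T" using F' t3'(3) by (auto simp: r_def)
      ultimately have TT': "T \<subset> T'" by blast
      \<comment> \<open>otherwise \<open>{0, 1} \<subset> four a \<subset> T \<subset> T' \<subset> U\<close>\<close>
      have "T' = U"
      proof (rule ccontr)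
        assume "T' \<noteq> U"
        then have "T' \<subset> U" using B.SubD(1)[OF T'S] b(2) by blast
        moreover have "{ba_zero B, ba_one B} \<subset> four B a"
        proof -
          have "a \<noteq> ba_zero B" "c \<noteq> ba_zero B" using t3 by (auto simp: three_parts_def)
          moreover have "a \<noteq> ba_one B"
          proof
            assume "a = ba_one B"
            then have "\<not> v c" if "valuation B v" for v using v3[OF that] that by auto
            then have "c = ba_zero B" using aceC by (intro B.valuation_eqI) auto
            then show False using \<open>c \<noteq> ba_zero B\<close> by simp
          qed
          ultimately show ?thesis by (auto simp: four_def)
        qed
        moreover have "four B a \<subset> T" using B.three_parts_psub(3)[OF t3] by (simp add: T_def)
        moreover have "{ba_zero B, ba_one B} \<in> Sub B" using B.four_in_Sub[OF B.zero_closed] B.four_zero by simp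
        ultimately show False using nochain[OF _ B.four_in_Sub[OF aceC(1)] TS T'S _ _ TT'] by blast
      qed
      have U4: "r \<in> U" "s \<in> U" "c' \<in> U" using rsC C b(2) by auto
      have "dir_plus X r s = Some a'" using b(6)[OF U4(1,2)] rs by simp
      then obtain w where w: "w \<in> X" "\<not> basic X w" "r \<in> dirs_at X w" "s \<in> dirs_at X w" "c' \<in> dirs_at X w"
        using common_big_three[OF UD[OF U4(1)] UD[OF U4(2)] UD[OF U4(3)] \<open>dir_plus X r s = Some a'\<close>
          plus3[OF t3'(1)]] by blast
      have "a' \<in> dirs_at X w" by (rule plus_dirs_at(2)[OF w(1-4) \<open>dir_plus X r s = Some a'\<close>])
      then have "{r, s, c', e'} \<subseteq> dirs_at X w" using three_dirs[OF t3'(1) w(1,2) _ w(5)] w(3,4) by simp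
      then have "U \<subseteq> dirs_at X w"
        using joins_of_dirs_at[OF B part _ w(1,2)] \<open>T' = U\<close> T'_def by simp
      then show ?thesis using w(1,2) by blast
    qed
  qed
qed

lemma iso_star_BSub: "poset_iso X (star (BSub DA))"
  unfolding poset_iso_def
proof (intro exI conjI)
  show "bij_betw (dirs_at X) X (star (BSub DA))"
  proof (rule bij_betw_imageI)
    show "inj_on (dirs_at X) X"
    proof (rule inj_onI)
      fix a b assume "a \<in> X" "b \<in> X" "dirs_at X a = dirs_at X b"
      then show "a = b" using dirs_at_le_iff[of a b] dirs_at_le_iff[of b a] by simp
    qed
    have "U \<in> dirs_at X ` X" if U: "U \<in> star (BSub DA)" for U
    proof -
      obtain w where w: "w \<in> X" "\<not> basic X w" "U \<subseteq> dirs_at X w" using star_BSub_below U by blast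
      then show ?thesis using big_dirs_at(2)[OF w(1,2), of U] U by (auto simp: star_def)
    qed
    then show "dirs_at X ` X = star (BSub DA)" using dirs_at_star by blast
  qed
  show "\<forall>x\<in>X. \<forall>y\<in>X. x \<le> y \<longleftrightarrow> dirs_at X x \<le> dirs_at X y" using dirs_at_le_iff by simp
qed

text \<open>
  A Boolean subalgebra with at most four elements has the form \<open>{0, 1, p, p'}\<close>, so it lies in
  \<open>dirs_at w\<close> for some non-basic \<open>w\<close>.  If it were a block it would equal \<open>dirs_at w\<close>, and the
  chart at \<open>w\<close> would make \<open>w\<close> basic.
\<close>

lemma proper_Dir: "oa_proper DA"
  unfolding oa_proper_def
proof
  assume "\<exists>S. is_block DA S \<and> finite S \<and> card S \<le> 4"
  then obtain U where max: "is_maximal (BSub DA) U" and fin: "finite U" "card U \<le> 4"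
    by (auto simp: is_block_def)
  interpret D: orthoalgebra DA by (rule Dir_orthoalgebra)
  have U: "U \<in> BSub DA" using max by (simp add: is_maximal_def)
  have "\<exists>p\<in>U. U = oa_four DA p"
  proof (cases "U = {dir_zero X, dir_one X}")
    case True
    then show ?thesis using D.compl_zero by (auto simp: oa_four_def DA_simps)
  next
    case False
    then obtain p where p: "p \<in> U" "p \<noteq> dir_zero X" "p \<noteq> dir_one X"
      using D.BSub_closed(2,3)[OF U] by (auto simp: DA_simps)
    have "oa_four DA p \<subseteq> U" using D.BSub_closed(2-4)[OF U] p by (auto simp: oa_four_def)
    moreover have "card (oa_four DA p) = 4"
      using D.card_four[OF D.BSub_closed(6)[OF U p(1)]] p by (simp add: DA_simps)
    ultimately have "oa_four DA p = U" using card_seteq[OF fin(1)] fin(2) by simp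
    then show ?thesis using p by blast
  qed
  then obtain p where p: "p \<in> U" "U = oa_four DA p" by blast
  have "p \<in> Dir X" using D.BSub_closed(6)[OF U p(1)] by (simp add: DA_simps)
  then obtain w where w: "w \<in> X" "\<not> basic X w" "p \<in> dirs_at X w" using Dir_big by blast
  have "U \<subseteq> dirs_at X w"
    using p w zero_one_dirs_at compl_dirs_at by (auto simp: oa_four_def DA_simps)
  then have Uw: "dirs_at X w = U" using max big_dirs_at(1)[OF w(1,2)] by (auto simp: is_maximal_def)
  obtain B :: "('x \<times> bool) boolalg" and g where "big_chart X w B g" using obtain_big w by blast
  then interpret big_chart X w B g .
  obtain a where a: "a \<in> ba_carrier B" "p = phi a" using phi_surj[OF w(3)] by blast
  have "phi ` ba_carrier B = phi ` four B a"
    unfolding phi_image Uw p(2) oa_four_def DA_simps four_def a(2)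
    by (simp add: phi_zero phi_one phi_compl[OF a(1)])
  then have "ba_carrier B = four B a"
    using inj_on_image_eq_iff[OF phi_inj] SubD(1)[OF four_in_Sub[OF a(1)]] by blast
  then show False using pt_four_less[OF a(1)] pt_carrier by simp
qed

end

theorem theorem5p18:
  fixes X :: "'x::order set"
  assumes "orthodomain X"
  shows "(short X \<and> enough_directions X \<longleftrightarrow>
            (\<exists>A :: 'x dir orthoalg. orthoalgebra A \<and> oa_proper A \<and> poset_iso X (star (BSub A))))
       \<and> ((\<exists>A :: 'a orthoalg. orthoalgebra A \<and> oa_proper A \<and> poset_iso X (star (BSub A)))
            \<longrightarrow> short X \<and> enough_directions X)
       \<and> (short X \<and> enough_directions X \<longrightarrow>
            orthoalgebra (Dir_orthoalg X) \<and> poset_iso X (star (BSub (Dir_orthoalg X))))"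
proof -
  have Dir: "orthoalgebra (Dir_orthoalg X) \<and> oa_proper (Dir_orthoalg X)
      \<and> poset_iso X (star (BSub (Dir_orthoalg X)))" if "short X" "enough_directions X"
  proof -
    interpret short_orthodomain X by unfold_locales (use assms that in auto)
    show ?thesis using Dir_orthoalgebra proper_Dir iso_star_BSub by blast
  qed
  show ?thesis
  proof (intro conjI iffI impI)
    assume "short X \<and> enough_directions X"
    then show "\<exists>A :: 'x dir orthoalg. orthoalgebra A \<and> oa_proper A \<and> poset_iso X (star (BSub A))"
      "orthoalgebra (Dir_orthoalg X)" "poset_iso X (star (BSub (Dir_orthoalg X)))"
      using Dir by blast+
  next
    assume "\<exists>A :: 'x dir orthoalg. orthoalgebra A \<and> oa_proper A \<and> poset_iso X (star (BSub A))"
    then show "short X" "enough_directions X" using short_enough_directions_of_iso by blast+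
  next
    assume "\<exists>A :: 'a orthoalg. orthoalgebra A \<and> oa_proper A \<and> poset_iso X (star (BSub A))"
    then show "short X" "enough_directions X" using short_enough_directions_of_iso by blast+
  qed
qed

end
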